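(* In the general first-fit model (sizes $\alpha_1<\alpha_2<\cdots$, probabilities $p_1,p_2,\dots$, scaling parameter $r$), for every item type $i$, as $r\to\infty$, $$\frac1r F_i(r\beta_i;\infty)\xrightarrow{P}p_i,\qquad\text{where }\beta_i=\sum_{j=1}^i\alpha_jp_j.$$
   Context: General first-fit model with scaling parameter $r>0$. Item types are indexed by $i=1,2,\dots$ (finitely or countably many types). Type-$i$ items ("$i$-items") have size $\alpha_i$, where $0<\alpha_1<\alpha_2<\cdots$ is a strictly increasing sequence of real numbers which is either finite or converges to infinity. Type $i$ has probability $p_i>0$, $\sum_i p_i=1$, and the mean item size $M=\sum_i\alpha_ip_i$ is finite. Items of type $i$ arrive as independent Poisson processes of rates $p_ir$. Items are stored on the half-axis $[0,\infty)$. First-fit discipline: an arriving $i$-item is immediately placed into the left-most interval $[x,x+\alpha_i)$, $x\ge0$, that does not intersect the intervals occupied by items currently present. Each item departs (freeing its interval) after an independent exponentially distributed service time of mean $1$. The state is the packing configuration (positions and types of all items present); restricting to the (countable) set of states reachable from the empty state, the process is an irreducible positive recurrent continuous-time Markov chain, with a unique stationary distribution for each $r$. For a state, $F_i(x)$ is the number of $i$-items located completely within $[0,x)$. $F_i(x;\infty)$ denotes the random variable $F_i(x)$ when the state has the stationary distribution of the system with parameter $r$. $\xrightarrow{P}$ denotes convergence in probability. *)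

theory Defs
  imports "HOL-Probability.Probability"
begin

text \<open>
  Continuous-time Markov chains, given by transition rates \<open>q s s'\<close> for \<open>s' \<noteq> s\<close> (the values on the
  diagonal are ignored).

  \<open>trans_upto q n t s s'\<close> is the probability that the jump process started in \<open>s\<close> makes fewer than
  \<open>n\<close> jumps during the time interval from \<open>0\<close> to \<open>t\<close> and is in \<open>s'\<close> at time \<open>t\<close>: either it stays in
  \<open>s\<close> for an exponentially distributed holding time exceeding \<open>t\<close>, or it leaves \<open>s\<close> at some time
  \<open>u \<le> t\<close>, and its jump to \<open>z\<close> at that moment has density \<open>exp (- exit_rate q s * u) * q s z\<close>.
  The limit over \<open>n\<close> is the (minimal) transition function.
\<close>

definition exit_rate :: "('s \<Rightarrow> 's \<Rightarrow> real) \<Rightarrow> 's \<Rightarrow> real" where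
  "exit_rate q s = (\<Sum>\<^sub>\<infinity>z\<in>- {s}. q s z)"

primrec trans_upto :: "('s \<Rightarrow> 's \<Rightarrow> real) \<Rightarrow> nat \<Rightarrow> real \<Rightarrow> 's \<Rightarrow> 's \<Rightarrow> ennreal" where
  "trans_upto q 0 t s s' = 0"
| "trans_upto q (Suc n) t s s' =
     (if s = s' then ennreal (exp (- exit_rate q s * t)) else 0) +
     (\<integral>\<^sup>+ u. ennreal (exp (- exit_rate q s * u)) *
        (\<integral>\<^sup>+ z. ennreal (q s z) * trans_upto q n (t - u) z s' \<partial>count_space (- {s})) *
        indicator {0..t} u \<partial>lborel)"

definition transition_prob :: "('s \<Rightarrow> 's \<Rightarrow> real) \<Rightarrow> real \<Rightarrow> 's \<Rightarrow> 's \<Rightarrow> ennreal" where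
  "transition_prob q t s s' = (SUP n. trans_upto q n t s s')"

definition reachable :: "('s \<Rightarrow> 's \<Rightarrow> real) \<Rightarrow> 's \<Rightarrow> 's set" where
  "reachable q s0 = {s. (\<lambda>x y. q x y > 0)\<^sup>*\<^sup>* s0 s}"

text \<open>Stationary distribution of the chain restricted to the states reachable from \<open>s0\<close>.\<close>

definition stationary_distribution :: "('s \<Rightarrow> 's \<Rightarrow> real) \<Rightarrow> 's \<Rightarrow> 's pmf \<Rightarrow> bool" where
  "stationary_distribution q s0 \<pi> \<longleftrightarrow>
     set_pmf \<pi> \<subseteq> reachable q s0 \<and>
     (\<forall>t\<ge>0. \<forall>s'. (\<integral>\<^sup>+ s. transition_prob q t s s' \<partial>measure_pmf \<pi>) = ennreal (pmf \<pi> s'))"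

text \<open>
  Packing configurations: the pair \<open>(x, i)\<close> is an \<open>i\<close>-item occupying \<open>{x..<x + \<alpha> i}\<close>. Items present
  simultaneously occupy disjoint nonempty intervals, so a set (rather than a multiset) suffices.
\<close>

type_synonym packing = "(real \<times> nat) set"

definition fits :: "(nat \<Rightarrow> real) \<Rightarrow> packing \<Rightarrow> nat \<Rightarrow> real \<Rightarrow> bool" where
  "fits \<alpha> s i x \<longleftrightarrow> 0 \<le> x \<and> (\<forall>(y, j)\<in>s. {x..<x + \<alpha> i} \<inter> {y..<y + \<alpha> j} = {})"

text \<open>For a finite packing the set of fitting positions is closed, so the least one exists.\<close>

definition first_fit :: "(nat \<Rightarrow> real) \<Rightarrow> packing \<Rightarrow> nat \<Rightarrow> packing" where
  "first_fit \<alpha> s i = insert (LEAST x. fits \<alpha> s i x, i) s"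

definition first_fit_rate ::
    "nat set \<Rightarrow> (nat \<Rightarrow> real) \<Rightarrow> (nat \<Rightarrow> real) \<Rightarrow> real \<Rightarrow> packing \<Rightarrow> packing \<Rightarrow> real" where
  "first_fit_rate I \<alpha> p r s s' =
     (\<Sum>\<^sub>\<infinity>i\<in>{i \<in> I. first_fit \<alpha> s i = s'}. p i * r) + real (card {a \<in> s. s - {a} = s'})"

definition items_within :: "(nat \<Rightarrow> real) \<Rightarrow> nat \<Rightarrow> real \<Rightarrow> packing \<Rightarrow> nat" where
  "items_within \<alpha> i x s = card {y. (y, i) \<in> s \<and> {y..<y + \<alpha> i} \<subseteq> {0..<x}}"

end

theory Submission
  imports Defs
begin

text \<open>
  In equilibrium the mean drift of every suitable function of the packing vanishes, and the limit
  follows from a few such balance equations. Let \<open>x\<close> be slightly less than \<open>r * beta i\<close> and call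
  an item end below \<open>x\<close> a hole if an \<open>i\<close>-item fits there. By induction the items smaller than \<open>i\<close>
  rarely start to the right of \<open>x1 = r * beta (i - 1)\<close>, so that they rarely use these holes, and
  their numbers concentrate, which prevents the items of types \<open>\<ge> i\<close> from numbering \<open>p i * r\<close>
  below \<open>x\<close>. This unmet demand consumes holes faster than they arise: the number of holes is \<open>o(r)\<close>
  in mean, and a slowly varying function is negligible once it is negligible in the absence of holes.

  This is applied to windows of length \<open>m * \<alpha> i\<close> with fewer than \<open>m\<close> items that begin with a run
  of \<open>l\<close> adjacent \<open>i\<close>-items. There are none for \<open>l = m\<close>, and whenever there is one with no hole
  around, a single departure followed by the arrival of an \<open>i\<close>-item lengthens its run; hence by
  downward induction on \<open>l\<close> their number is \<open>o(r)\<close>. The other windows between \<open>x1\<close> and \<open>x\<close> consist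
  of \<open>i\<close>-items up to a bounded amount each, so with \<open>m\<close> large there are almost \<open>p i * r\<close> of these.
  Their mean number below \<open>x\<close> is \<open>p i * r\<close> times the probability that an \<open>i\<close>-item fits there, which
  therefore tends to 1, and a second moment gives the concentration of that number.
\<close>

section \<open>Stationarity and the generator of a jump process\<close>

text \<open>The obstacle is that the absence of holes does not make the region beyond
  \<open>x1\<close> full of i-items: it may consist of larger items and of gaps shorter than
  \<alpha> i. First fit never repairs such a gap by itself; only a departure next to it and a lucky
  refill do, which is why the argument goes through runs that grow one item at a time. Each step of
  that induction multiplies the bound by a constant of order \<open>m / \<delta>\<close>, so the
  result is usable only because the constants do not depend on \<open>r\<close>. The limits are
  therefore ordered: \<open>r\<close> tends to infinity with \<delta>, \<open>m\<close> and
  \<open>J\<close> fixed, and only afterwards are these improved. Here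
  \<open>\<alpha> i * \<delta> * r\<close> is the distance from \<open>x\<close> to
  \<open>r * beta i\<close>; it leaves a demand of rate \<open>\<delta> * r\<close> that big items
  below \<open>x\<close> cannot satisfy. The type \<open>J\<close> is a truncation: the item behind
  a loose window may be arbitrarily long, and the finite mean size bounds the total length of the
  types above \<open>J\<close>. All test functions look only to the left of \<open>x\<close>,
  because the total departure rate is unbounded over the states and only boundedly many departures
  matter there.\<close>

lemma borel_measurable_nn_integral_count_space:
  fixes f :: "'a \<Rightarrow> 'b \<Rightarrow> ennreal"
  assumes A: "countable A" and f: "\<And>z. z \<in> A \<Longrightarrow> f z \<in> borel_measurable M"
  shows "(\<lambda>x. \<integral>\<^sup>+z. f z x \<partial>count_space A) \<in> borel_measurable M"
proof -
  have "(\<lambda>(z, x). f z x) \<in> borel_measurable (count_space A \<Otimes>\<^sub>M M)"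
    by (rule measurable_pair_measure_countable1[OF A]) (simp add: f)
  from measurable_compose[OF measurable_pair_swap' this]
  have "(\<lambda>(x, z). f z x) \<in> borel_measurable (M \<Otimes>\<^sub>M count_space A)"
    by (simp add: case_prod_beta')
  then show ?thesis
    by (rule sigma_finite_measure.borel_measurable_nn_integral
          [OF sigma_finite_measure_count_space_countable[OF A]])
qed

text \<open>Packings form an uncountable type, while measurability and the interchange of sums and
  integrals need countably many states; hence a countable set \<open>S\<close> that positive rates
  never leave.\<close>

locale jump_rates =
  fixes q :: "'s \<Rightarrow> 's \<Rightarrow> real" and S :: "'s set"
  assumes countable_states: "countable S"
    and rate_nonneg: "\<And>s z. 0 \<le> q s z"
    and rate_closed: "\<And>s z. s \<in> S \<Longrightarrow> 0 < q s z \<Longrightarrow> z \<in> S"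
    and rate_summable: "\<And>s. s \<in> S \<Longrightarrow> q s summable_on - {s}"
begin

lemma exit_rate_nonneg: "0 \<le> exit_rate q s"
  unfolding exit_rate_def by (intro infsum_nonneg rate_nonneg)

lemma nn_integral_rate_restrict:
  assumes "s \<in> S"
  shows "(\<integral>\<^sup>+z. ennreal (q s z) * g z \<partial>count_space (- {s})) =
         (\<integral>\<^sup>+z. ennreal (q s z) * g z \<partial>count_space (S - {s}))"
proof (rule nn_integral_count_space_eq)
  show "ennreal (q s z) * g z = 0" if "z \<in> - {s} - (S - {s})" for z
  proof -
    have "\<not> 0 < q s z" using that rate_closed[OF assms, of z] by blast
    then show ?thesis by (simp add: ennreal_neg)
  qed
qed auto

lemma nn_integral_exit_rate:
  assumes "s \<in> S"
  shows "(\<integral>\<^sup>+z. ennreal (q s z) \<partial>count_space (- {s})) = ennreal (exit_rate q s)"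
proof -
  have "Infinite_Sum.abs_summable_on (q s) (- {s})"
    using rate_summable[OF assms] summable_on_iff_abs_summable_on_real[of "q s" "- {s}"] by blast
  then have b: "Infinite_Set_Sum.abs_summable_on (q s) (- {s})"
    by (rule abs_summable_equivalent[THEN iffD1])
  show ?thesis
    unfolding exit_rate_def
    using nn_integral_conv_infsetsum[OF b] rate_nonneg infsetsum_infsum[OF b] by simp
qed

lemma measurable_trans_upto:
  assumes "s \<in> S"
  shows "(\<lambda>t. trans_upto q n t s s') \<in> borel_measurable borel"
  using assms
proof (induction n arbitrary: s)
  case 0
  then show ?case by simp
next
  case (Suc n)
  have inner: "(\<lambda>v. \<integral>\<^sup>+z. ennreal (q s z) * trans_upto q n v z s' \<partial>count_space (- {s}))
      \<in> borel_measurable borel"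
    unfolding nn_integral_rate_restrict[OF Suc.prems]
    using Suc.IH countable_states
    by (intro borel_measurable_nn_integral_count_space) auto
  have inner2: "(\<lambda>p. \<integral>\<^sup>+z. ennreal (q s z) * trans_upto q n (fst p - snd p) z s' \<partial>count_space (- {s}))
      \<in> borel_measurable (borel \<Otimes>\<^sub>M lborel)"
    by (rule measurable_compose[OF _ inner]) measurable
  have [measurable]: "(\<lambda>t. \<integral>\<^sup>+ u. ennreal (exp (- exit_rate q s * u)) *
        (\<integral>\<^sup>+ z. ennreal (q s z) * trans_upto q n (t - u) z s' \<partial>count_space (- {s})) *
        indicator {0..t} u \<partial>lborel) \<in> borel_measurable borel"
  proof (rule lborel.borel_measurable_nn_integral)
    have "Measurable.pred (borel \<Otimes>\<^sub>M lborel) (\<lambda>p::real \<times> real. snd p \<in> {0..fst p})"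
      by (simp add: atLeastAtMost_iff) measurable
    then have [measurable]: "(\<lambda>p::real \<times> real. indicator {0..fst p} (snd p) :: ennreal) \<in> borel_measurable (borel \<Otimes>\<^sub>M lborel)"
      by measurable
    show "(\<lambda>(t, u). ennreal (exp (- exit_rate q s * u)) *
        (\<integral>\<^sup>+ z. ennreal (q s z) * trans_upto q n (t - u) z s' \<partial>count_space (- {s})) *
        indicator {0..t} u) \<in> borel_measurable (borel \<Otimes>\<^sub>M lborel)"
      unfolding case_prod_beta using inner2 by measurable
  qed
  show ?case unfolding trans_upto.simps by measurable
qed

lemma measurable_trans_upto_shift [measurable]:
  assumes "s \<in> S"
  shows "(\<lambda>u. trans_upto q n (t - u) s s') \<in> borel_measurable lborel"
  using measurable_compose[OF _ measurable_trans_upto[OF assms], of "\<lambda>u. t - u" lborel n s'] by simp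

lemma trans_upto_mono: "trans_upto q n t s s' \<le> trans_upto q (Suc n) t s s'"
proof (induction n arbitrary: t s)
  case 0
  then show ?case by simp
next
  case (Suc n)
  show ?case
    unfolding trans_upto.simps(2)[of q "Suc n" t s s'] trans_upto.simps(2)[of q n t s s']
    by (intro add_left_mono nn_integral_mono mult_right_mono mult_left_mono Suc.IH) auto
qed

lemma trans_upto_le_transition_prob: "trans_upto q n t s s' \<le> transition_prob q t s s'"
  unfolding transition_prob_def by (rule SUP_upper) simp

text \<open>
  The bound is exact along the recursion because
  \<open>- exp (- exit_rate q s * u) * (f s + K * (t - u))\<close> is an antiderivative of the integrand.
\<close>

lemma trans_upto_bound:
  fixes f :: "'s \<Rightarrow> real"
  assumes f: "\<And>s. s \<in> S \<Longrightarrow> 0 \<le> f s" and K: "0 \<le> K"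
    and rate: "\<And>s. s \<in> S \<Longrightarrow> (\<integral>\<^sup>+z. ennreal (q s z) * ennreal (f z) \<partial>count_space (S - {s}))
        \<le> ennreal (exit_rate q s * f s + K)"
    and "s \<in> S" "0 \<le> t"
  shows "(\<integral>\<^sup>+s'. trans_upto q n t s s' * ennreal (f s') \<partial>count_space S) \<le> ennreal (f s + K * t)"
  using assms(4,5)
proof (induction n arbitrary: s t)
  case 0
  then show ?case by simp
next
  case (Suc n)
  let ?c = "exit_rate q s"
  note cS = countable_states
  have cSs: "countable (S - {s})" using cS by auto
  have meas: "(\<lambda>u. \<integral>\<^sup>+ z. ennreal (q s z) * trans_upto q n (t - u) z s' \<partial>count_space (S - {s}))
      \<in> borel_measurable lborel" for s'
    by (rule borel_measurable_nn_integral_count_space[OF cSs])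
       (intro borel_measurable_times_ennreal borel_measurable_const measurable_trans_upto_shift, auto)
  have eq: "(\<integral>\<^sup>+s'. trans_upto q (Suc n) t s s' * ennreal (f s') \<partial>count_space S) =
     (\<integral>\<^sup>+s'. (if s = s' then ennreal (exp (- ?c * t)) else 0) * ennreal (f s') \<partial>count_space S) +
     (\<integral>\<^sup>+ u. ennreal (exp (- ?c * u)) *
        (\<integral>\<^sup>+ z. ennreal (q s z) * (\<integral>\<^sup>+s'. trans_upto q n (t - u) z s' * ennreal (f s') \<partial>count_space S)
           \<partial>count_space (S - {s})) * indicator {0..t} u \<partial>lborel)"
    (is "?L = ?A + ?R")
  proof -
    have "?L = (\<integral>\<^sup>+s'. (if s = s' then ennreal (exp (- ?c * t)) else 0) * ennreal (f s') +
       (\<integral>\<^sup>+ u. ennreal (exp (- ?c * u)) *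
        (\<integral>\<^sup>+ z. ennreal (q s z) * trans_upto q n (t - u) z s' \<partial>count_space (S - {s})) *
        indicator {0..t} u \<partial>lborel) * ennreal (f s') \<partial>count_space S)"
      unfolding trans_upto.simps nn_integral_rate_restrict[OF Suc.prems(1)]
      by (simp add: distrib_right)
    also have "\<dots> = ?A + (\<integral>\<^sup>+s'. (\<integral>\<^sup>+ u. ennreal (exp (- ?c * u)) *
        (\<integral>\<^sup>+ z. ennreal (q s z) * trans_upto q n (t - u) z s' \<partial>count_space (S - {s})) *
        indicator {0..t} u \<partial>lborel) * ennreal (f s') \<partial>count_space S)"
      by (rule nn_integral_add) auto
    also have "(\<integral>\<^sup>+s'. (\<integral>\<^sup>+ u. ennreal (exp (- ?c * u)) *
        (\<integral>\<^sup>+ z. ennreal (q s z) * trans_upto q n (t - u) z s' \<partial>count_space (S - {s})) *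
        indicator {0..t} u \<partial>lborel) * ennreal (f s') \<partial>count_space S) =
      (\<integral>\<^sup>+s'. (\<integral>\<^sup>+ u. ennreal (exp (- ?c * u)) *
        (\<integral>\<^sup>+ z. ennreal (q s z) * trans_upto q n (t - u) z s' \<partial>count_space (S - {s})) *
        indicator {0..t} u * ennreal (f s') \<partial>lborel) \<partial>count_space S)"
      by (intro nn_integral_cong nn_integral_multc[symmetric] borel_measurable_times_ennreal meas) auto
    also have "\<dots> = (\<integral>\<^sup>+ u. (\<integral>\<^sup>+s'. ennreal (exp (- ?c * u)) *
        (\<integral>\<^sup>+ z. ennreal (q s z) * trans_upto q n (t - u) z s' \<partial>count_space (S - {s})) *
        indicator {0..t} u * ennreal (f s') \<partial>count_space S) \<partial>lborel)"
      by (intro nn_integral_count_space_nn_integral[symmetric] cS borel_measurable_times_ennreal meas) auto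
    also have "\<dots> = (\<integral>\<^sup>+ u. ennreal (exp (- ?c * u)) * (\<integral>\<^sup>+s'.
        (\<integral>\<^sup>+ z. ennreal (q s z) * trans_upto q n (t - u) z s' \<partial>count_space (S - {s})) *
        ennreal (f s') \<partial>count_space S) * indicator {0..t} u \<partial>lborel)"
    proof (intro nn_integral_cong)
      fix u
      have "(\<integral>\<^sup>+s'. ennreal (exp (- ?c * u)) *
        (\<integral>\<^sup>+ z. ennreal (q s z) * trans_upto q n (t - u) z s' \<partial>count_space (S - {s})) *
        indicator {0..t} u * ennreal (f s') \<partial>count_space S) =
       (\<integral>\<^sup>+s'. ennreal (exp (- ?c * u)) * ((\<integral>\<^sup>+ z. ennreal (q s z) * trans_upto q n (t - u) z s' \<partial>count_space (S - {s})) *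
         ennreal (f s')) * indicator {0..t} u \<partial>count_space S)"
        by (intro nn_integral_cong) (simp only: mult_ac)
      also have "\<dots> = ennreal (exp (- ?c * u)) * (\<integral>\<^sup>+s'.
        (\<integral>\<^sup>+ z. ennreal (q s z) * trans_upto q n (t - u) z s' \<partial>count_space (S - {s})) *
        ennreal (f s') \<partial>count_space S) * indicator {0..t} u"
        by (subst nn_integral_multc, simp, subst nn_integral_cmult, simp, rule refl)
      finally show "(\<integral>\<^sup>+s'. ennreal (exp (- ?c * u)) *
        (\<integral>\<^sup>+ z. ennreal (q s z) * trans_upto q n (t - u) z s' \<partial>count_space (S - {s})) *
        indicator {0..t} u * ennreal (f s') \<partial>count_space S) = \<dots>" .
    qed
    also have "\<dots> = ?R"
    proof (intro nn_integral_cong arg_cong2[where f="(*)"] refl)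
      fix u
      have "(\<integral>\<^sup>+s'. (\<integral>\<^sup>+ z. ennreal (q s z) * trans_upto q n (t - u) z s' \<partial>count_space (S - {s})) *
          ennreal (f s') \<partial>count_space S) =
        (\<integral>\<^sup>+s'. (\<integral>\<^sup>+ z. ennreal (q s z) * (trans_upto q n (t - u) z s' * ennreal (f s'))
           \<partial>count_space (S - {s})) \<partial>count_space S)"
        by (intro nn_integral_cong) (subst nn_integral_multc[symmetric], simp, simp only: mult.assoc)
      also have "\<dots> = (\<integral>\<^sup>+ z. (\<integral>\<^sup>+s'. ennreal (q s z) * (trans_upto q n (t - u) z s' * ennreal (f s'))
           \<partial>count_space S) \<partial>count_space (S - {s}))"
        by (rule nn_integral_count_space_nn_integral[OF cSs]) auto
      also have "\<dots> = (\<integral>\<^sup>+ z. ennreal (q s z) * (\<integral>\<^sup>+s'. trans_upto q n (t - u) z s' * ennreal (f s')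
           \<partial>count_space S) \<partial>count_space (S - {s}))"
        by (simp add: nn_integral_cmult)
      finally show "(\<integral>\<^sup>+s'. (\<integral>\<^sup>+ z. ennreal (q s z) * trans_upto q n (t - u) z s' \<partial>count_space (S - {s})) *
          ennreal (f s') \<partial>count_space S) = \<dots>" .
    qed
    finally show ?thesis .
  qed
  have c0: "0 \<le> ?c" by (rule exit_rate_nonneg)
  have fs: "0 \<le> f s" using f Suc.prems by auto
  have A: "?A = ennreal (exp (- ?c * t) * f s)"
  proof -
    have "?A = (\<integral>\<^sup>+s'. (ennreal (exp (- ?c * t) * f s)) * indicator {s} s' \<partial>count_space S)"
      using fs by (intro nn_integral_cong) (auto simp: ennreal_mult split: split_indicator)
    also have "\<dots> = ennreal (exp (- ?c * t) * f s)"
      using Suc.prems by simp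
    finally show ?thesis .
  qed
  have "?R \<le> (\<integral>\<^sup>+ u. ennreal (exp (- ?c * u) * (?c * (f s + K * (t - u)) + K)) * indicator {0..t} u \<partial>lborel)"
  proof (rule nn_integral_mono)
    fix u
    show "ennreal (exp (- ?c * u)) *
        (\<integral>\<^sup>+ z. ennreal (q s z) * (\<integral>\<^sup>+s'. trans_upto q n (t - u) z s' * ennreal (f s') \<partial>count_space S)
           \<partial>count_space (S - {s})) * indicator {0..t} u
      \<le> ennreal (exp (- ?c * u) * (?c * (f s + K * (t - u)) + K)) * indicator {0..t} u"
    proof (cases "u \<in> {0..t}")
      case True
      then have u: "0 \<le> u" "0 \<le> t - u" by auto
      have "(\<integral>\<^sup>+ z. ennreal (q s z) * (\<integral>\<^sup>+s'. trans_upto q n (t - u) z s' * ennreal (f s') \<partial>count_space S)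
           \<partial>count_space (S - {s})) \<le> (\<integral>\<^sup>+ z. ennreal (q s z) * ennreal (f z) + ennreal (K * (t - u)) * ennreal (q s z)
           \<partial>count_space (S - {s}))"
      proof (rule nn_integral_mono)
        fix z assume z: "z \<in> space (count_space (S - {s}))"
        then have "(\<integral>\<^sup>+s'. trans_upto q n (t - u) z s' * ennreal (f s') \<partial>count_space S) \<le> ennreal (f z + K * (t - u))"
          using Suc.IH[of z "t - u"] u by auto
        then have "ennreal (q s z) * (\<integral>\<^sup>+s'. trans_upto q n (t - u) z s' * ennreal (f s') \<partial>count_space S)
           \<le> ennreal (q s z) * ennreal (f z + K * (t - u))"
          by (intro mult_left_mono) auto
        also have "ennreal (f z + K * (t - u)) = ennreal (f z) + ennreal (K * (t - u))"
          using z f u K by (intro ennreal_plus) auto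
        finally show "ennreal (q s z) * (\<integral>\<^sup>+s'. trans_upto q n (t - u) z s' * ennreal (f s') \<partial>count_space S)
           \<le> ennreal (q s z) * ennreal (f z) + ennreal (K * (t - u)) * ennreal (q s z)"
          by (simp add: distrib_left mult_ac)
      qed
      also have "\<dots> = (\<integral>\<^sup>+ z. ennreal (q s z) * ennreal (f z) \<partial>count_space (S - {s}))
         + ennreal (K * (t - u)) * (\<integral>\<^sup>+ z. ennreal (q s z) * 1 \<partial>count_space (S - {s}))"
        by (subst nn_integral_add) (auto simp: nn_integral_cmult)
      also have "\<dots> \<le> ennreal (?c * f s + K) + ennreal (K * (t - u)) * ennreal ?c"
        unfolding nn_integral_rate_restrict[OF Suc.prems(1), symmetric]
        using nn_integral_exit_rate[OF Suc.prems(1)] rate[OF Suc.prems(1)]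
        unfolding nn_integral_rate_restrict[OF Suc.prems(1), symmetric]
        by (intro add_mono) auto
      also have "\<dots> = ennreal ((?c * f s + K) + K * (t - u) * ?c)"
        using c0 K u fs by (subst ennreal_plus) (auto simp: ennreal_mult)
      also have "(?c * f s + K) + K * (t - u) * ?c = ?c * (f s + K * (t - u)) + K"
        by (simp add: algebra_simps)
      finally have "ennreal (exp (- ?c * u)) * (\<integral>\<^sup>+ z. ennreal (q s z) * (\<integral>\<^sup>+s'. trans_upto q n (t - u) z s' * ennreal (f s') \<partial>count_space S)
           \<partial>count_space (S - {s})) \<le> ennreal (exp (- ?c * u)) * ennreal (?c * (f s + K * (t - u)) + K)"
        by (intro mult_left_mono) auto
      then show ?thesis using True c0 K u fs by (simp add: ennreal_mult)
    qed auto
  qed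
  also have "\<dots> = ennreal ((- exp (- ?c * t) * (f s + K * (t - t))) - (- exp (- ?c * 0) * (f s + K * (t - 0))))"
  proof (rule nn_integral_FTC_Icc)
    show "0 \<le> exp (- ?c * u) * (?c * (f s + K * (t - u)) + K)" if "u \<in> {0..t}" for u
      using that c0 K fs by (intro mult_nonneg_nonneg add_nonneg_nonneg) auto
    show "((\<lambda>u. - exp (- ?c * u) * (f s + K * (t - u))) has_real_derivative
        exp (- ?c * u) * (?c * (f s + K * (t - u)) + K)) (at u)" for u
      by (auto intro!: derivative_eq_intros simp: algebra_simps)
  qed (use Suc.prems in auto)
  finally have R: "?R \<le> ennreal (f s + K * t - exp (- ?c * t) * f s)" by (simp add: algebra_simps)
  have "exp (- ?c * t) * f s \<le> 1 * f s"
    using c0 Suc.prems fs by (intro mult_right_mono) auto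
  then have "0 \<le> f s + K * t - exp (- ?c * t) * f s"
    using K Suc.prems by (simp add: add_increasing2 add.commute add_increasing)
  then have "?A + ?R \<le> ennreal (exp (- ?c * t) * f s + (f s + K * t - exp (- ?c * t) * f s))"
    unfolding A using R fs by (subst ennreal_plus) (auto intro: add_left_mono)
  then show ?case unfolding eq by simp
qed

text \<open>The bound of \<open>trans_upto_bound\<close> does not depend on the number of jumps, so
  monotone convergence carries it to the limit. This is one half of Dynkin's formula; using it for
  \<open>f\<close> and for \<open>B - f\<close> gives both halves, and for the constant 1 it gives
  total mass at most 1.\<close>

lemma transition_prob_bound:
  fixes f :: "'s \<Rightarrow> real"
  assumes f: "\<And>s. s \<in> S \<Longrightarrow> 0 \<le> f s" and K: "0 \<le> K"
    and rate: "\<And>s. s \<in> S \<Longrightarrow> (\<integral>\<^sup>+z. ennreal (q s z) * ennreal (f z) \<partial>count_space (S - {s}))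
        \<le> ennreal (exit_rate q s * f s + K)"
    and st: "s \<in> S" "0 \<le> t"
  shows "(\<integral>\<^sup>+s'. transition_prob q t s s' * ennreal (f s') \<partial>count_space S) \<le> ennreal (f s + K * t)"
proof -
  have "(\<integral>\<^sup>+s'. transition_prob q t s s' * ennreal (f s') \<partial>count_space S) =
      (\<integral>\<^sup>+s'. (SUP n. trans_upto q n t s s' * ennreal (f s')) \<partial>count_space S)"
    unfolding transition_prob_def by (simp add: SUP_mult_right_ennreal)
  also have "\<dots> = (SUP n. \<integral>\<^sup>+s'. trans_upto q n t s s' * ennreal (f s') \<partial>count_space S)"
    by (rule nn_integral_monotone_convergence_SUP)
       (auto intro!: incseq_SucI le_funI mult_right_mono trans_upto_mono)
  also have "\<dots> \<le> ennreal (f s + K * t)"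
    by (intro SUP_least trans_upto_bound assms)
  finally show ?thesis .
qed

lemma transition_prob_ge_stay: "ennreal (exp (- exit_rate q s * t)) \<le> transition_prob q t s s"
  using trans_upto_le_transition_prob[of "Suc 0" t s s] by simp

text \<open>Keeps only the paths with a single jump, from \<open>s\<close> to \<open>z\<close>.
  Bounding both holding times by \<open>t\<close> costs nothing to first order in
  \<open>t\<close>.\<close>

lemma transition_prob_ge_jump:
  assumes "s \<in> S" "z \<in> S" "s \<noteq> z" "0 \<le> t"
  shows "ennreal (t * exp (- (exit_rate q s + exit_rate q z) * t) * q s z) \<le> transition_prob q t s z"
proof -
  let ?c = "exit_rate q s" and ?d = "exit_rate q z"
  have "ennreal (t * exp (- (?c + ?d) * t) * q s z) =
      (\<integral>\<^sup>+u. ennreal (exp (- (?c + ?d) * t) * q s z) * indicator {0..t} u \<partial>lborel)"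
    using assms rate_nonneg by (subst nn_integral_cmult_indicator) (auto simp: ennreal_mult[symmetric] mult_ac)
  also have "\<dots> \<le> (\<integral>\<^sup>+u. ennreal (exp (- ?c * u)) *
        (\<integral>\<^sup>+ w. ennreal (q s w) * trans_upto q (Suc 0) (t - u) w z \<partial>count_space (- {s})) *
        indicator {0..t} u \<partial>lborel)"
  proof (intro nn_integral_mono)
    fix u :: real
    show "ennreal (exp (- (?c + ?d) * t) * q s z) * indicator {0..t} u \<le>
      ennreal (exp (- ?c * u)) *
        (\<integral>\<^sup>+ w. ennreal (q s w) * trans_upto q (Suc 0) (t - u) w z \<partial>count_space (- {s})) * indicator {0..t} u"
    proof (cases "u \<in> {0..t}")
      case True
      have "ennreal (q s z) * trans_upto q (Suc 0) (t - u) z z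
          \<le> (\<integral>\<^sup>+ w. ennreal (q s w) * trans_upto q (Suc 0) (t - u) w z \<partial>count_space (- {s}))"
        using assms by (intro nn_integral_ge_point) auto
      then have le: "ennreal (exp (- ?c * u)) * (ennreal (q s z) * ennreal (exp (- ?d * (t - u)))) \<le>
          ennreal (exp (- ?c * u)) * (\<integral>\<^sup>+ w. ennreal (q s w) * trans_upto q (Suc 0) (t - u) w z \<partial>count_space (- {s}))"
        by (intro mult_left_mono) auto
      have "?c * u \<le> ?c * t" "?d * (t - u) \<le> ?d * t"
        using True exit_rate_nonneg by (auto intro!: mult_left_mono)
      then have "exp (- (?c + ?d) * t) \<le> exp (- ?c * u + - ?d * (t - u))"
        by (simp add: algebra_simps)
      then have "ennreal (exp (- (?c + ?d) * t) * q s z) \<le> ennreal (exp (- ?c * u) * exp (- ?d * (t - u)) * q s z)"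
        unfolding exp_add[symmetric] by (intro ennreal_leI mult_right_mono rate_nonneg)
      also have "\<dots> = ennreal (exp (- ?c * u)) * (ennreal (q s z) * ennreal (exp (- ?d * (t - u))))"
        using rate_nonneg by (simp add: ennreal_mult[symmetric] mult_ac)
      finally show ?thesis using le True by simp
    qed auto
  qed
  also have "\<dots> = trans_upto q (Suc (Suc 0)) t s z"
    unfolding trans_upto.simps(2)[of q "Suc 0"] using assms(3) by simp
  finally show ?thesis
    using trans_upto_le_transition_prob[of "Suc (Suc 0)" t s z] by (rule order_trans)
qed

text \<open>\<open>enn2real\<close> would send an infinite sum to 0; the bounds assumed in
  \<open>gen_bounds\<close> rule this case out.\<close>

definition gen :: "('s \<Rightarrow> real) \<Rightarrow> 's \<Rightarrow> real" where
  "gen f s = enn2real (\<integral>\<^sup>+z. ennreal (q s z) * ennreal (f z) \<partial>count_space (S - {s})) - exit_rate q s * f s"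

text \<open>Paths with at most one jump already produce the generator to first order in
  \<open>t\<close>, as the exponential factors increase to 1 when \<open>t\<close> decreases to
  0.\<close>

lemma transition_prob_ge:
  fixes f :: "'s \<Rightarrow> real"
  assumes f: "\<And>s. s \<in> S \<Longrightarrow> 0 \<le> f s" and st: "s \<in> S" "0 \<le> t"
  shows "ennreal (exp (- exit_rate q s * t) * f s) + ennreal t *
     (\<integral>\<^sup>+z. ennreal (exp (- (exit_rate q s + exit_rate q z) * t)) * (ennreal (q s z) * ennreal (f z)) \<partial>count_space (S - {s}))
    \<le> (\<integral>\<^sup>+s'. transition_prob q t s s' * ennreal (f s') \<partial>count_space S)"
proof -
  have "(\<integral>\<^sup>+z. ennreal (exp (- (exit_rate q s + exit_rate q z) * t)) * (ennreal (q s z) * ennreal (f z)) \<partial>count_space (S - {s}))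
      = (\<integral>\<^sup>+z. ennreal (exp (- (exit_rate q s + exit_rate q z) * t)) * (ennreal (q s z) * ennreal (f z)) * indicator (- {s}) z \<partial>count_space S)"
    by (subst nn_integral_count_space_eq[where B = "S - {s}" and A = S]) (auto intro!: nn_integral_cong split: split_indicator)
  moreover have "ennreal (exp (- exit_rate q s * t) * f s) =
      (\<integral>\<^sup>+z. ennreal (exp (- exit_rate q s * t) * f s) * indicator {s} z \<partial>count_space S)"
    using st by simp
  ultimately have "ennreal (exp (- exit_rate q s * t) * f s) + ennreal t *
     (\<integral>\<^sup>+z. ennreal (exp (- (exit_rate q s + exit_rate q z) * t)) * (ennreal (q s z) * ennreal (f z)) \<partial>count_space (S - {s})) =
     (\<integral>\<^sup>+z. ennreal (exp (- exit_rate q s * t) * f s) * indicator {s} z + ennreal t *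
      (ennreal (exp (- (exit_rate q s + exit_rate q z) * t)) * (ennreal (q s z) * ennreal (f z)) * indicator (- {s}) z) \<partial>count_space S)"
    by (subst nn_integral_add) (auto simp: nn_integral_cmult)
  also have "\<dots> \<le> (\<integral>\<^sup>+s'. transition_prob q t s s' * ennreal (f s') \<partial>count_space S)"
  proof (rule nn_integral_mono)
    fix z assume "z \<in> space (count_space S)"
    then have z: "z \<in> S" by simp
    show "ennreal (exp (- exit_rate q s * t) * f s) * indicator {s} z + ennreal t *
      (ennreal (exp (- (exit_rate q s + exit_rate q z) * t)) * (ennreal (q s z) * ennreal (f z)) * indicator (- {s}) z)
      \<le> transition_prob q t s z * ennreal (f z)"
    proof (cases "z = s")
      case True
      then show ?thesis
        using mult_right_mono[OF transition_prob_ge_stay[of s t], of "ennreal (f s)"] f[OF z]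
        by (simp add: ennreal_mult)
    next
      case False
      then show ?thesis
        using mult_right_mono[OF transition_prob_ge_jump[OF st(1) z _ st(2)], of "ennreal (f z)"] f[OF z] rate_nonneg st
        by (simp add: ennreal_mult mult_ac)
    qed
  qed
  finally show ?thesis .
qed

text \<open>The sums for \<open>f\<close> and for \<open>B - f\<close> add up to
  \<open>B * exit_rate q s\<close>, so an upper bound for one is a lower bound for the
  other.\<close>

lemma gen_bounds:
  fixes f :: "'s \<Rightarrow> real"
  assumes s: "s \<in> S" and f: "\<And>s. s \<in> S \<Longrightarrow> 0 \<le> f s \<and> f s \<le> B" and K: "0 \<le> K"
    and up: "(\<integral>\<^sup>+z. ennreal (q s z) * ennreal (f z) \<partial>count_space (S - {s}))
        \<le> ennreal (exit_rate q s * f s + K)"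
    and down: "(\<integral>\<^sup>+z. ennreal (q s z) * ennreal (B - f z) \<partial>count_space (S - {s}))
        \<le> ennreal (exit_rate q s * (B - f s) + K)"
  shows "(\<integral>\<^sup>+z. ennreal (q s z) * ennreal (f z) \<partial>count_space (S - {s})) = ennreal (gen f s + exit_rate q s * f s)"
    and "(\<integral>\<^sup>+z. ennreal (q s z) * ennreal (B - f z) \<partial>count_space (S - {s})) = ennreal (- gen f s + exit_rate q s * (B - f s))"
    and "gen (\<lambda>z. B - f z) s = - gen f s"
    and "\<bar>gen f s\<bar> \<le> K"
proof -
  let ?c = "exit_rate q s"
  have c0: "0 \<le> ?c" by (rule exit_rate_nonneg)
  let ?U = "\<integral>\<^sup>+z. ennreal (q s z) * ennreal (f z) \<partial>count_space (S - {s})"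
  let ?D = "\<integral>\<^sup>+z. ennreal (q s z) * ennreal (B - f z) \<partial>count_space (S - {s})"
  obtain u where u: "0 \<le> u" "?U = ennreal u" "u \<le> ?c * f s + K"
    using up c0 f[OF s] K by (cases ?U) (auto simp: top_unique simp del: ennreal_plus)
  obtain d where d: "0 \<le> d" "?D = ennreal d" "d \<le> ?c * (B - f s) + K"
    using down c0 f[OF s] K by (cases ?D) (auto simp: top_unique simp del: ennreal_plus)
  have B: "0 \<le> B" using f[OF s] by auto
  have "?U + ?D = (\<integral>\<^sup>+z. ennreal (q s z) * ennreal (f z) + ennreal (q s z) * ennreal (B - f z) \<partial>count_space (S - {s}))"
    by (subst nn_integral_add) auto
  also have "\<dots> = (\<integral>\<^sup>+z. ennreal B * (ennreal (q s z) * 1) \<partial>count_space (S - {s}))"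
  proof (rule nn_integral_cong)
    fix z assume "z \<in> space (count_space (S - {s}))"
    then have "ennreal (f z) + ennreal (B - f z) = ennreal B"
      using f[of z] by (simp add: ennreal_plus[symmetric] del: ennreal_plus)
    then show "ennreal (q s z) * ennreal (f z) + ennreal (q s z) * ennreal (B - f z) = ennreal B * (ennreal (q s z) * 1)"
      by (metis distrib_left mult.commute mult.right_neutral)
  qed
  also have "\<dots> = ennreal B * ennreal ?c"
    using nn_integral_exit_rate[OF s] nn_integral_rate_restrict[OF s, of "\<lambda>_. 1"]
    by (simp add: nn_integral_cmult)
  finally have "ennreal (u + d) = ennreal (B * ?c)"
    using u d B c0 by (simp add: ennreal_mult)
  then have eq: "u + d = B * ?c" using u d B c0 by (subst (asm) ennreal_inj) auto
  have g: "gen f s = u - ?c * f s" unfolding gen_def u by (simp add: u)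
  have g': "gen (\<lambda>z. B - f z) s = d - ?c * (B - f s)" unfolding gen_def d by (simp add: d)
  show "?U = ennreal (gen f s + exit_rate q s * f s)" using g u by simp
  have d': "d = - gen f s + exit_rate q s * (B - f s)" using g eq by (simp add: algebra_simps)
  then show "?D = ennreal (- gen f s + exit_rate q s * (B - f s))" using d by simp
  show "gen (\<lambda>z. B - f z) s = - gen f s" using g' d' by simp
  show "\<bar>gen f s\<bar> \<le> K" using g d' d u by (simp add: abs_le_iff)
qed

section \<open>Vanishing mean of the generator under a stationary distribution\<close>

context
  fixes \<pi> :: "'s pmf"
  assumes supp: "set_pmf \<pi> \<subseteq> S"
    and stat: "\<And>t s'. 0 \<le> t \<Longrightarrow> (\<integral>\<^sup>+ s. transition_prob q t s s' \<partial>measure_pmf \<pi>) = ennreal (pmf \<pi> s')"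
begin

lemma stationary_nn_integral:
  assumes "0 \<le> t"
  shows "(\<integral>\<^sup>+s. (\<integral>\<^sup>+s'. transition_prob q t s s' * ennreal (f s') \<partial>count_space S) \<partial>measure_pmf \<pi>) =
         (\<integral>\<^sup>+s. ennreal (f s) \<partial>measure_pmf \<pi>)"
proof -
  have "(\<integral>\<^sup>+s. (\<integral>\<^sup>+s'. transition_prob q t s s' * ennreal (f s') \<partial>count_space S) \<partial>measure_pmf \<pi>) =
     (\<integral>\<^sup>+s'. (\<integral>\<^sup>+s. transition_prob q t s s' * ennreal (f s') \<partial>measure_pmf \<pi>) \<partial>count_space S)"
    by (rule nn_integral_count_space_nn_integral[OF countable_states]) auto
  also have "\<dots> = (\<integral>\<^sup>+s'. ennreal (pmf \<pi> s') * ennreal (f s') \<partial>count_space S)"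
    by (simp add: nn_integral_multc stat[OF assms])
  also have "\<dots> = (\<integral>\<^sup>+s'. ennreal (pmf \<pi> s') * ennreal (f s') \<partial>count_space UNIV)"
    using supp by (intro nn_integral_count_space_eq) (auto simp: pmf_eq_0_set_pmf)
  finally show ?thesis by (simp add: nn_integral_measure_pmf)
qed

text \<open>The minimal transition function loses mass if the process explodes. Stationarity
  excludes this: the mass is at most 1 from every state and has mean 1 under \<pi>, so it equals 1
  from every state of positive probability.\<close>

lemma transition_prob_honest:
  assumes "0 \<le> t" "s \<in> set_pmf \<pi>"
  shows "(\<integral>\<^sup>+s'. transition_prob q t s s' \<partial>count_space S) = 1"
proof -
  let ?m = "\<lambda>s. \<integral>\<^sup>+s'. transition_prob q t s s' \<partial>count_space S"
  have le: "?m s \<le> 1" if "s \<in> S" for s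
  proof -
    have "(\<integral>\<^sup>+s'. transition_prob q t s s' * ennreal 1 \<partial>count_space S) \<le> ennreal (1 + 0 * t)"
      using assms(1) that nn_integral_exit_rate nn_integral_rate_restrict[where g = "\<lambda>_. 1"]
      by (intro transition_prob_bound) auto
    then show ?thesis by simp
  qed
  have "(\<integral>\<^sup>+s. ?m s \<partial>measure_pmf \<pi>) = 1"
    using stationary_nn_integral[OF assms(1), of "\<lambda>_. 1"] by simp
  then have "(\<integral>\<^sup>+s. 1 - ?m s \<partial>measure_pmf \<pi>) = 0"
    using supp le by (subst nn_integral_diff) (auto simp: AE_measure_pmf_iff)
  then have "AE s in measure_pmf \<pi>. 1 - ?m s = 0"
    by (subst (asm) nn_integral_0_iff_AE) auto
  then have "1 - ?m s = 0" using assms(2) by (simp add: AE_measure_pmf_iff)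
  then show ?thesis using le[of s] assms(2) supp by (auto simp: diff_eq_0_iff_ennreal intro: antisym)
qed

text \<open>Fatou's lemma for the difference quotients of the mean of \<open>f\<close>, shifted by
  \<open>K\<close> to be nonnegative: by stationarity their mean is exactly \<open>K\<close>, and
  their lower limit is at least \<open>gen f + K\<close>. The reverse inequality will come from
  \<open>B - f\<close>.\<close>

lemma stationary_gen_le:
  fixes f :: "'s \<Rightarrow> real"
  assumes f: "\<And>s. s \<in> S \<Longrightarrow> 0 \<le> f s \<and> f s \<le> B" and K: "0 \<le> K"
    and up: "\<And>s. s \<in> S \<Longrightarrow> (\<integral>\<^sup>+z. ennreal (q s z) * ennreal (f z) \<partial>count_space (S - {s}))
        \<le> ennreal (exit_rate q s * f s + K)"
    and down: "\<And>s. s \<in> S \<Longrightarrow> (\<integral>\<^sup>+z. ennreal (q s z) * ennreal (B - f z) \<partial>count_space (S - {s}))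
        \<le> ennreal (exit_rate q s * (B - f s) + K)"
  shows "measure_pmf.expectation \<pi> (gen f) \<le> 0"
proof -
  define t :: "nat \<Rightarrow> real" where "t k = inverse (real (Suc k))" for k
  have t: "0 < t k" for k by (simp add: t_def)
  have t0: "t \<longlonglongrightarrow> 0" unfolding t_def by (rule LIMSEQ_inverse_real_of_nat)
  define P where "P k s = (\<integral>\<^sup>+s'. transition_prob q (t k) s s' * ennreal (f s') \<partial>count_space S)" for k s
  have P_up: "P k s \<le> ennreal (f s + K * t k)" if "s \<in> S" for k s
    unfolding P_def using f K up that t[of k] by (intro transition_prob_bound) auto
  have P_fin: "P k s = ennreal (enn2real (P k s))" if "s \<in> S" for k s
    using P_up[OF that, of k] by (metis enn2real_nonneg ennreal_enn2real ennreal_less_top order_le_less_trans)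
  define h where "h k s = (enn2real (P k s) - f s) / t k + K" for k s
  \<comment> \<open>Nonnegativity uses honesty: the means of \<open>f\<close> and
    \<open>B - f\<close> add up to \<open>B\<close>, so the upper bound for \<open>B - f\<close>
    becomes a lower bound for \<open>f\<close>.\<close>
  have h0: "0 \<le> h k s" "h k s \<le> 2 * K" if s: "s \<in> set_pmf \<pi>" for k s
  proof -
    have sS: "s \<in> S" using s supp by auto
    have "P k s + (\<integral>\<^sup>+s'. transition_prob q (t k) s s' * ennreal (B - f s') \<partial>count_space S)
        = (\<integral>\<^sup>+s'. ennreal B * transition_prob q (t k) s s' \<partial>count_space S)"
      unfolding P_def
    proof (subst nn_integral_add[symmetric])
      show "(\<integral>\<^sup>+s'. transition_prob q (t k) s s' * ennreal (f s') + transition_prob q (t k) s s' * ennreal (B - f s') \<partial>count_space S)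
        = (\<integral>\<^sup>+s'. ennreal B * transition_prob q (t k) s s' \<partial>count_space S)"
      proof (rule nn_integral_cong)
        fix z assume "z \<in> space (count_space S)"
        then have "ennreal (f z) + ennreal (B - f z) = ennreal B"
          using f[of z] by (simp add: ennreal_plus[symmetric] del: ennreal_plus)
        then show "transition_prob q (t k) s z * ennreal (f z) + transition_prob q (t k) s z * ennreal (B - f z)
            = ennreal B * transition_prob q (t k) s z"
          by (metis distrib_left mult.commute)
      qed
    qed auto
    also have "\<dots> = ennreal B"
      using transition_prob_honest[of "t k", OF _ s] t[of k] by (simp add: nn_integral_cmult)
    finally have "ennreal B = P k s + (\<integral>\<^sup>+s'. transition_prob q (t k) s s' * ennreal (B - f s') \<partial>count_space S)" ..
    also have "\<dots> \<le> P k s + ennreal (B - f s + K * t k)"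
      using f K down sS t[of k] by (intro add_left_mono transition_prob_bound) auto
    also have "\<dots> = ennreal (enn2real (P k s) + (B - f s + K * t k))"
      using f[OF sS] K t[of k] by (subst P_fin[OF sS]) (simp add: ennreal_plus[symmetric] del: ennreal_plus)
    finally have "B \<le> enn2real (P k s) + (B - f s + K * t k)"
      using f[OF sS] K t[of k] by (subst (asm) ennreal_le_iff) auto
    then have "- (K * t k) \<le> enn2real (P k s) - f s" by simp
    then have "- K \<le> (enn2real (P k s) - f s) / t k" using t[of k] by (simp add: field_simps)
    then show "0 \<le> h k s" by (simp add: h_def)
    have "enn2real (P k s) \<le> f s + K * t k"
      using P_up[OF sS, of k] f[OF sS] K t[of k] by (intro enn2real_leI) auto
    then show "h k s \<le> 2 * K" using t[of k] by (simp add: h_def field_simps)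
  qed
  have gb: "\<bar>gen f s\<bar> \<le> K" if "s \<in> S" for s
    using gen_bounds(4)[OF that f K up down] that by auto
  have lim: "ennreal (gen f s + K) \<le> liminf (\<lambda>k. ennreal (h k s))" if s: "s \<in> set_pmf \<pi>" for s
  proof -
    let ?c = "exit_rate q s"
    have sS: "s \<in> S" using s supp by auto
    define G where "G k = (\<integral>\<^sup>+z. ennreal (exp (- (?c + exit_rate q z) * t k)) * (ennreal (q s z) * ennreal (f z)) \<partial>count_space (S - {s}))" for k
    let ?U = "\<integral>\<^sup>+z. ennreal (q s z) * ennreal (f z) \<partial>count_space (S - {s})"
    have U: "?U = ennreal (gen f s + ?c * f s)"
      using gen_bounds(1)[OF sS f K up down] sS by auto
    have gU: "0 \<le> gen f s + ?c * f s"
      unfolding gen_def by simp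
    have G_le: "G k \<le> ?U" for k
    proof -
      have "ennreal (exp (- (?c + exit_rate q z) * t k)) \<le> 1" for z
        using t[of k] exit_rate_nonneg[of s] exit_rate_nonneg[of z]
        by (simp add: ennreal_le_1 mult_nonneg_nonneg flip: minus_add_distrib)
      then show ?thesis
        unfolding G_def by (intro nn_integral_mono) (metis mult_right_mono mult_1 zero_le)
    qed
    \<comment> \<open>The exit rates of the targets \<open>z\<close> may be unbounded, so the
      exponential factors do not converge uniformly; they increase in \<open>k\<close>, and monotone
      convergence applies.\<close>
    have G_lim: "G \<longlonglongrightarrow> ?U"
    proof -
      have dec: "t (Suc k) \<le> t k" for k unfolding t_def by (simp add: field_simps)
      have "G \<longlonglongrightarrow> (\<integral>\<^sup>+z. (SUP k. ennreal (exp (- (?c + exit_rate q z) * t k)) * (ennreal (q s z) * ennreal (f z))) \<partial>count_space (S - {s}))"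
      proof -
        have inc: "incseq (\<lambda>k z. ennreal (exp (- (?c + exit_rate q z) * t k)) * (ennreal (q s z) * ennreal (f z)))"
        proof (intro incseq_SucI le_funI mult_right_mono ennreal_leI)
          fix k z
          show "exp (- (?c + exit_rate q z) * t k) \<le> exp (- (?c + exit_rate q z) * t (Suc k))"
            using mult_left_mono[OF dec[of k], of "?c + exit_rate q z"] exit_rate_nonneg[of s] exit_rate_nonneg[of z]
            by (simp del: minus_add_distrib)
        qed auto
        have eq: "(\<integral>\<^sup>+z. (SUP k. ennreal (exp (- (?c + exit_rate q z) * t k)) * (ennreal (q s z) * ennreal (f z))) \<partial>count_space (S - {s})) = (SUP k. G k)"
          unfolding G_def by (rule nn_integral_monotone_convergence_SUP[OF inc]) auto
        have "incseq G" unfolding G_def using inc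
          by (auto simp: incseq_def le_fun_def intro!: nn_integral_mono)
        then show ?thesis unfolding eq by (rule LIMSEQ_SUP)
      qed
      moreover have "(SUP k. ennreal (exp (- (?c + exit_rate q z) * t k)) * (ennreal (q s z) * ennreal (f z))) = ennreal (q s z) * ennreal (f z)" for z
      proof -
        have "(\<lambda>k. ennreal (exp (- (?c + exit_rate q z) * t k))) \<longlonglongrightarrow> ennreal (exp (- (?c + exit_rate q z) * 0))"
          by (intro tendsto_ennrealI tendsto_intros t0)
        moreover have "incseq (\<lambda>k. ennreal (exp (- (?c + exit_rate q z) * t k)))"
        proof (intro incseq_SucI ennreal_leI)
          fix k
          show "exp (- (?c + exit_rate q z) * t k) \<le> exp (- (?c + exit_rate q z) * t (Suc k))"
            using mult_left_mono[OF dec[of k], of "?c + exit_rate q z"] exit_rate_nonneg[of s] exit_rate_nonneg[of z]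
            by (simp del: minus_add_distrib)
        qed
        ultimately have "(SUP k. ennreal (exp (- (?c + exit_rate q z) * t k))) = 1"
          using LIMSEQ_SUP LIMSEQ_unique by fastforce
        then show ?thesis by (simp add: SUP_mult_right_ennreal[symmetric])
      qed
      ultimately show ?thesis by simp
    qed
    define g where "g k = enn2real (G k)" for k
    have Gg: "G k = ennreal (g k)" for k
      unfolding g_def using G_le[of k] unfolding U by (metis enn2real_nonneg ennreal_enn2real ennreal_less_top order_le_less_trans)
    have g0: "0 \<le> g k" for k by (simp add: g_def)
    have g_lim: "g \<longlonglongrightarrow> gen f s + ?c * f s"
      using G_lim gU g0 unfolding U Gg by (subst (asm) tendsto_ennreal_iff) auto
    have low: "(exp (- ?c * t k) - 1) / t k * f s + g k \<le> (enn2real (P k s) - f s) / t k" for k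
    proof -
      have "ennreal (exp (- ?c * t k) * f s) + ennreal (t k) * G k \<le> P k s"
        unfolding P_def G_def using f sS t[of k] by (intro transition_prob_ge) auto
      then have "ennreal (exp (- ?c * t k) * f s + t k * g k) \<le> ennreal (enn2real (P k s))"
        unfolding P_fin[OF sS, symmetric] Gg using f[OF sS] t[of k] g0[of k]
        by (subst ennreal_plus) (auto simp: ennreal_mult)
      then have "exp (- ?c * t k) * f s + t k * g k \<le> enn2real (P k s)"
        by (subst (asm) ennreal_le_iff) auto
      then have "(exp (- ?c * t k) * f s + t k * g k - f s) / t k \<le> (enn2real (P k s) - f s) / t k"
        using t[of k] by (intro divide_right_mono) auto
      moreover have "(exp (- ?c * t k) - 1) / t k * f s + g k = (exp (- ?c * t k) * f s + t k * g k - f s) / t k"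
        using t[of k] by (simp add: field_simps)
      ultimately show ?thesis by simp
    qed
    have "(\<lambda>k. (exp (- ?c * t k) - 1) / t k) \<longlonglongrightarrow> - ?c"
    proof -
      have "((\<lambda>x. exp (- ?c * x)) has_real_derivative - ?c) (at 0)"
        by (auto intro!: derivative_eq_intros)
      then have "((\<lambda>x. (exp (- ?c * x) - 1) / x) \<longlongrightarrow> - ?c) (at 0)"
        by (simp add: has_field_derivative_iff)
      moreover have "filterlim t (at 0) sequentially"
        using t0 t by (auto simp: filterlim_at intro!: always_eventually less_imp_neq[THEN not_sym])
      ultimately show ?thesis by (rule filterlim_compose)
    qed
    then have "(\<lambda>k. ennreal ((exp (- ?c * t k) - 1) / t k * f s + g k + K)) \<longlonglongrightarrow> ennreal (- ?c * f s + (gen f s + ?c * f s) + K)"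
      by (intro tendsto_ennrealI tendsto_intros g_lim)
    then have "ennreal (gen f s + K) = liminf (\<lambda>k. ennreal ((exp (- ?c * t k) - 1) / t k * f s + g k + K))"
      by (simp add: lim_imp_Liminf)
    also have "\<dots> \<le> liminf (\<lambda>k. ennreal (h k s))"
      unfolding h_def using low by (intro Liminf_mono always_eventually allI ennreal_leI add_right_mono)
    finally show ?thesis .
  qed
  have f_nonneg: "0 \<le> f s" if "s \<in> set_pmf \<pi>" for s
    using f supp that by blast
  have int_f: "integrable (measure_pmf \<pi>) f"
    using f supp by (intro measure_pmf.integrable_const_bound[where B=B]) (auto simp: AE_measure_pmf_iff)
  have int_gen: "integrable (measure_pmf \<pi>) (gen f)"
    using gb supp by (intro measure_pmf.integrable_const_bound[where B=K]) (auto simp: AE_measure_pmf_iff)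
  have hK: "(\<integral>\<^sup>+s. ennreal (h k s) \<partial>measure_pmf \<pi>) = ennreal K" for k
  proof -
    have intP: "integrable (measure_pmf \<pi>) (\<lambda>s. enn2real (P k s))"
    proof (rule measure_pmf.integrable_const_bound[where B="B + K * t k"])
      show "AE s in measure_pmf \<pi>. norm (enn2real (P k s)) \<le> B + K * t k"
      proof (unfold AE_measure_pmf_iff, rule ballI)
        fix s assume "s \<in> set_pmf \<pi>"
        then have sS: "s \<in> S" using supp by auto
        have "enn2real (P k s) \<le> f s + K * t k"
          using P_up[OF sS, of k] f[OF sS] K t[of k] by (intro enn2real_leI) auto
        then show "norm (enn2real (P k s)) \<le> B + K * t k" using f[OF sS] by simp
      qed
    qed auto
    have "ennreal (measure_pmf.expectation \<pi> (\<lambda>s. enn2real (P k s))) = (\<integral>\<^sup>+s. ennreal (enn2real (P k s)) \<partial>measure_pmf \<pi>)"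
      by (rule nn_integral_eq_integral[symmetric, OF intP]) auto
    also have "\<dots> = (\<integral>\<^sup>+s. P k s \<partial>measure_pmf \<pi>)"
      using P_fin supp by (intro nn_integral_cong_AE) (auto simp: AE_measure_pmf_iff)
    also have "\<dots> = (\<integral>\<^sup>+s. ennreal (f s) \<partial>measure_pmf \<pi>)"
      unfolding P_def using t[of k] by (intro stationary_nn_integral) auto
    also have "\<dots> = ennreal (measure_pmf.expectation \<pi> f)"
      using f_nonneg by (intro nn_integral_eq_integral int_f) (auto simp: AE_measure_pmf_iff)
    finally have eq: "measure_pmf.expectation \<pi> (\<lambda>s. enn2real (P k s)) = measure_pmf.expectation \<pi> f"
      using f_nonneg by (subst (asm) ennreal_inj) (auto intro!: integral_nonneg_AE simp: AE_measure_pmf_iff)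
    have int_h: "integrable (measure_pmf \<pi>) (h k)"
      unfolding h_def using intP int_f by auto
    have "(\<integral>\<^sup>+s. ennreal (h k s) \<partial>measure_pmf \<pi>) = ennreal (measure_pmf.expectation \<pi> (h k))"
      using h0 by (intro nn_integral_eq_integral int_h) (auto simp: AE_measure_pmf_iff)
    also have "measure_pmf.expectation \<pi> (h k) = K"
      unfolding h_def using intP int_f eq by simp
    finally show ?thesis .
  qed
  have "(\<integral>\<^sup>+s. ennreal (gen f s + K) \<partial>measure_pmf \<pi>) \<le> (\<integral>\<^sup>+s. liminf (\<lambda>k. ennreal (h k s)) \<partial>measure_pmf \<pi>)"
    using lim by (intro nn_integral_mono_AE) (auto simp: AE_measure_pmf_iff)
  also have "\<dots> \<le> liminf (\<lambda>k. \<integral>\<^sup>+s. ennreal (h k s) \<partial>measure_pmf \<pi>)"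
    by (rule nn_integral_liminf) auto
  also have "\<dots> = ennreal K" unfolding hK by (simp add: Liminf_const)
  also have "(\<integral>\<^sup>+s. ennreal (gen f s + K) \<partial>measure_pmf \<pi>) = ennreal (measure_pmf.expectation \<pi> (\<lambda>s. gen f s + K))"
  proof (rule nn_integral_eq_integral)
    have "0 \<le> gen f s + K" if "s \<in> set_pmf \<pi>" for s
      using gb[of s] supp that by auto
    then show "AE s in measure_pmf \<pi>. 0 \<le> gen f s + K" by (simp add: AE_measure_pmf_iff)
  qed (use int_gen in auto)
  finally have "measure_pmf.expectation \<pi> (\<lambda>s. gen f s + K) \<le> K"
    using K by (subst (asm) ennreal_le_iff) auto
  then show ?thesis using int_gen by simp
qed

theorem stationary_gen:
  fixes f :: "'s \<Rightarrow> real"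
  assumes f: "\<And>s. s \<in> S \<Longrightarrow> 0 \<le> f s \<and> f s \<le> B" and K: "0 \<le> K"
    and up: "\<And>s. s \<in> S \<Longrightarrow> (\<integral>\<^sup>+z. ennreal (q s z) * ennreal (f z) \<partial>count_space (S - {s}))
        \<le> ennreal (exit_rate q s * f s + K)"
    and down: "\<And>s. s \<in> S \<Longrightarrow> (\<integral>\<^sup>+z. ennreal (q s z) * ennreal (B - f z) \<partial>count_space (S - {s}))
        \<le> ennreal (exit_rate q s * (B - f s) + K)"
  shows "measure_pmf.expectation \<pi> (gen f) = 0"
proof (rule antisym)
  show "measure_pmf.expectation \<pi> (gen f) \<le> 0"
    by (rule stationary_gen_le[OF f K up down])
  have "measure_pmf.expectation \<pi> (gen (\<lambda>z. B - f z)) \<le> 0"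
    using f up down by (intro stationary_gen_le[where B = B and K = K] K) auto
  also have "measure_pmf.expectation \<pi> (gen (\<lambda>z. B - f z)) = measure_pmf.expectation \<pi> (\<lambda>s. - gen f s)"
  proof (rule integral_cong_AE)
    have "gen (\<lambda>z. B - f z) s = - gen f s" if "s \<in> S" for s
      by (rule gen_bounds(3)[OF that f K up[OF that] down[OF that]])
    then show "AE s in measure_pmf \<pi>. gen (\<lambda>z. B - f z) s = - gen f s"
      using supp by (auto simp: AE_measure_pmf_iff)
  qed auto
  finally show "0 \<le> measure_pmf.expectation \<pi> (gen f)" by simp
qed

end

end

section \<open>Packings and their holes\<close>

locale first_fit_model =
  fixes I :: "nat set" and \<alpha> p :: "nat \<Rightarrow> real"
  assumes types: "I = {1..} \<or> (\<exists>n. I = {1..n})"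
    and sizes_pos: "\<And>j. j \<in> I \<Longrightarrow> 0 < \<alpha> j"
    and sizes_increasing: "strict_mono_on I \<alpha>"
    and probs_pos: "\<And>j. j \<in> I \<Longrightarrow> 0 < p j"
    and probs_sum: "(p has_sum 1) I"
begin

text \<open>The type of an arriving item as a random variable, so that sums over possibly infinitely
  many types become expectations.\<close>

definition arrival_type :: "nat pmf" where
  "arrival_type = embed_pmf (\<lambda>j. if j \<in> I then p j else 0)"

lemma pmf_arrival_type: "pmf arrival_type j = (if j \<in> I then p j else 0)"
  unfolding arrival_type_def
proof (rule pmf_embed_pmf)
  show "0 \<le> (if j \<in> I then p j else 0)" for j
    using probs_pos[of j] by auto
  have "Infinite_Sum.abs_summable_on p I"
    using probs_sum summable_on_iff_abs_summable_on_real[of p I] has_sum_imp_summable by blast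
  then have a: "Infinite_Set_Sum.abs_summable_on p I"
    by (rule abs_summable_equivalent[THEN iffD1])
  have "(\<integral>\<^sup>+j. ennreal (if j \<in> I then p j else 0) \<partial>count_space UNIV) = (\<integral>\<^sup>+j. ennreal (p j) \<partial>count_space I)"
    by (subst nn_integral_count_space_eq[where A = UNIV and B = I]) (auto intro!: nn_integral_cong)
  also have "\<dots> = ennreal (infsetsum p I)"
    using probs_pos by (intro nn_integral_conv_infsetsum a) (auto intro: less_imp_le)
  also have "infsetsum p I = 1"
    using infsetsum_infsum[OF a] probs_sum by (simp add: infsumI)
  finally show "(\<integral>\<^sup>+j. ennreal (if j \<in> I then p j else 0) \<partial>count_space UNIV) = 1" by simp
qed

lemma set_arrival_type: "set_pmf arrival_type = I"
  using probs_pos less_irrefl by (fastforce simp: set_pmf_eq pmf_arrival_type)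

lemma arrival_type_nn_integral:
  "(\<integral>\<^sup>+j. ennreal (p j) * g j \<partial>count_space I) = (\<integral>\<^sup>+j. g j \<partial>measure_pmf arrival_type)"
  unfolding nn_integral_measure_pmf pmf_arrival_type
  by (subst nn_integral_count_space_eq[where A = UNIV and B = I]) (auto intro!: nn_integral_cong)

section \<open>Valid packings and the left-most fitting position\<close>

definition pos :: "packing \<Rightarrow> nat \<Rightarrow> real" where
  "pos s j = (LEAST x. fits \<alpha> s j x)"

definition arrive :: "packing \<Rightarrow> nat \<Rightarrow> packing" where
  "arrive s j = insert (pos s j, j) s"

lemma first_fit_eq: "first_fit \<alpha> s j = arrive s j"
  by (simp add: first_fit_def arrive_def pos_def)

text \<open>The origin counts as an item end: an item pushed to the left comes to rest at the origin
  or at the end of another item, so these finitely many points are the only candidates for a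
  first-fit position.\<close>

definition ends :: "packing \<Rightarrow> real set" where
  "ends s = insert 0 ((\<lambda>(y, j). y + \<alpha> j) ` s)"

text \<open>An invariant of the dynamics; the geometric arguments rest on it and not on
  reachability.\<close>

definition valid :: "packing \<Rightarrow> bool" where
  "valid s \<longleftrightarrow> finite s \<and> (\<forall>(y, j)\<in>s. j \<in> I \<and> 0 \<le> y) \<and>
     (\<forall>(y, j)\<in>s. \<forall>(z, k)\<in>s. (y, j) = (z, k) \<or> y + \<alpha> j \<le> z \<or> z + \<alpha> k \<le> y)"

lemma valid_finite: "valid s \<Longrightarrow> finite s" by (simp add: valid_def)

lemma valid_item:
  assumes "valid s" "(y, j) \<in> s"
  shows "j \<in> I" "0 \<le> y" "0 < \<alpha> j"
  using assms sizes_pos by (auto simp: valid_def)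

lemma valid_disjoint:
  assumes "valid s" "(y, j) \<in> s" "(z, k) \<in> s" "y < z + \<alpha> k" "z < y + \<alpha> j"
  shows "y = z" "j = k"
  using assms unfolding valid_def by fastforce+

lemma valid_same_start:
  assumes "valid s" "(y, j) \<in> s" "(y, k) \<in> s"
  shows "j = k"
  using valid_disjoint[OF assms] valid_item(3)[OF assms(1,2)] valid_item(3)[OF assms(1,3)] by auto

lemma valid_less:
  assumes "valid s" "(y, j) \<in> s" "(z, k) \<in> s" "y < z"
  shows "y + \<alpha> j \<le> z"
  using valid_disjoint[OF assms(1-3)] valid_item(3)[OF assms(1,3)] assms(4) by force

lemma ends_finite: "valid s \<Longrightarrow> finite (ends s)"
  by (simp add: ends_def valid_def)

lemma endsE:
  assumes "e \<in> ends s"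
  obtains "e = 0" | y j where "(y, j) \<in> s" "e = y + \<alpha> j"
  using assms by (auto simp: ends_def)

lemma zero_in_ends: "0 \<in> ends s" by (simp add: ends_def)

lemma end_in_ends: "(y, j) \<in> s \<Longrightarrow> y + \<alpha> j \<in> ends s" by (force simp: ends_def)

lemma ends_nonneg: "valid s \<Longrightarrow> e \<in> ends s \<Longrightarrow> 0 \<le> e"
  by (erule endsE) (use valid_item in \<open>metis order_refl add_nonneg_nonneg less_imp_le\<close>)+

lemma item_before_end:
  assumes "valid s" "e \<in> ends s" "(y, j) \<in> s" "y < e"
  shows "y + \<alpha> j \<le> e"
  using assms(2)
proof (cases rule: endsE)
  case 1
  then show ?thesis using assms valid_item(2) by force
next
  case (2 z k)
  then show ?thesis
    using valid_less[OF assms(1,3) 2(1)] valid_less[OF assms(1) 2(1) assms(3)] valid_item(3)[OF assms(1) 2(1)]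
      valid_same_start[OF assms(1,3)] assms(4)
    by (cases "y = z") (auto, force)
qed

lemma fits_iff:
  assumes "valid s" "i \<in> I"
  shows "fits \<alpha> s i u \<longleftrightarrow> 0 \<le> u \<and> (\<forall>(y, j)\<in>s. u + \<alpha> i \<le> y \<or> y + \<alpha> j \<le> u)"
proof -
  have "{u..<u + \<alpha> i} \<inter> {y..<y + \<alpha> j} = {} \<longleftrightarrow> u + \<alpha> i \<le> y \<or> y + \<alpha> j \<le> u" if "(y, j) \<in> s" for y j
  proof -
    have "0 < \<alpha> j" "0 < \<alpha> i" using valid_item[OF assms(1) that] sizes_pos[OF assms(2)] by auto
    then show ?thesis
      by (auto simp: disjoint_iff)
  qed
  then show ?thesis unfolding fits_def by fastforce
qed

lemma ends_below:
  assumes "valid s" "0 \<le> v"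
  obtains e where "e \<in> ends s" "e \<le> v" "\<And>e'. e' \<in> ends s \<Longrightarrow> e' \<le> v \<Longrightarrow> e' \<le> e"
proof -
  let ?E = "{e \<in> ends s. e \<le> v}"
  have "finite ?E" "?E \<noteq> {}" using ends_finite[OF assms(1)] zero_in_ends assms(2) by auto
  then have "Max ?E \<in> ?E" "\<And>e'. e' \<in> ?E \<Longrightarrow> e' \<le> Max ?E" by (rule Max_in, simp)
  then show thesis using that by blast
qed

text \<open>Moving a fitting position left to the nearest end meets no item, since the end of such
  an item would lie in between.\<close>

lemma fits_end_below:
  assumes "valid s" "i \<in> I" "fits \<alpha> s i v"
  obtains u where "u \<in> ends s" "u \<le> v" "fits \<alpha> s i u"
proof -
  have "0 \<le> v" using assms by (simp add: fits_iff)
  then obtain e where e: "e \<in> ends s" "e \<le> v" "\<And>e'. e' \<in> ends s \<Longrightarrow> e' \<le> v \<Longrightarrow> e' \<le> e"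
    using ends_below[OF assms(1)] by blast
  have "fits \<alpha> s i e"
    using assms e ends_nonneg[OF assms(1) e(1)] end_in_ends
    by (fastforce simp: fits_iff)
  then show thesis using e that by blast
qed

text \<open>Restricting the fitting positions to item ends makes them a finite set that can be
  counted and that still contains the first-fit position.\<close>

definition holes :: "nat \<Rightarrow> packing \<Rightarrow> real set" where
  "holes i s = {u \<in> ends s. fits \<alpha> s i u}"

lemma finite_holes: "valid s \<Longrightarrow> finite (holes i s)"
  using ends_finite by (simp add: holes_def)

lemma holes_nonempty:
  assumes "valid s" "i \<in> I"
  shows "holes i s \<noteq> {}"
proof -
  have "fits \<alpha> s i (Max (ends s))"
    using assms ends_finite[OF assms(1)] end_in_ends zero_in_ends
    by (auto simp: fits_iff intro!: Max_ge)
  then show ?thesis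
    using ends_finite[OF assms(1)] zero_in_ends[of s] Max_in[of "ends s"] unfolding holes_def by blast
qed

lemma pos_eq_Min:
  assumes "valid s" "i \<in> I"
  shows "pos s i = Min (holes i s)"
  unfolding pos_def
proof (rule Least_equality)
  have "Min (holes i s) \<in> holes i s" using finite_holes holes_nonempty assms by simp
  then show "fits \<alpha> s i (Min (holes i s))" by (simp add: holes_def)
  fix v assume "fits \<alpha> s i v"
  then obtain u where u: "u \<in> ends s" "u \<le> v" "fits \<alpha> s i u" using fits_end_below[OF assms] by blast
  then have "u \<in> holes i s" by (simp add: holes_def)
  then show "Min (holes i s) \<le> v" using u finite_holes[OF assms(1)] by (meson Min_le order_trans)
qed

lemma pos_in_holes: "valid s \<Longrightarrow> i \<in> I \<Longrightarrow> pos s i \<in> holes i s"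
  by (simp add: pos_eq_Min finite_holes holes_nonempty)

lemma pos_le: "valid s \<Longrightarrow> i \<in> I \<Longrightarrow> u \<in> holes i s \<Longrightarrow> pos s i \<le> u"
  by (simp add: pos_eq_Min finite_holes)

lemma pos_fits: "valid s \<Longrightarrow> i \<in> I \<Longrightarrow> fits \<alpha> s i (pos s i)"
  using pos_in_holes by (auto simp: holes_def)

lemma pos_in_ends: "valid s \<Longrightarrow> i \<in> I \<Longrightarrow> pos s i \<in> ends s"
  using pos_in_holes by (auto simp: holes_def)

lemma pos_nonneg: "valid s \<Longrightarrow> i \<in> I \<Longrightarrow> 0 \<le> pos s i"
  using pos_in_ends ends_nonneg by blast

lemma fits_not_item:
  assumes "valid s" "i \<in> I" "fits \<alpha> s i u"
  shows "(u, j) \<notin> s"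
  using assms sizes_pos[OF assms(2)] valid_item(3)[OF assms(1)] by (fastforce simp: fits_iff)

lemma arrive_new: "valid s \<Longrightarrow> j \<in> I \<Longrightarrow> (pos s j, k) \<notin> s"
  using fits_not_item pos_fits by blast

lemma arrive_neq: "valid s \<Longrightarrow> j \<in> I \<Longrightarrow> arrive s j \<noteq> s"
  using arrive_new[of s j j] by (auto simp: arrive_def)

section \<open>The chain of packings and its balance equations\<close>

lemma inj_arrive: "valid s \<Longrightarrow> inj_on (arrive s) I"
  using arrive_new unfolding arrive_def inj_on_def by (metis insert_ident insertI1 insert_iff prod.inject)

lemma valid_arrive:
  assumes "valid s" "j \<in> I"
  shows "valid (arrive s j)"
  using assms pos_fits[OF assms] pos_nonneg[OF assms]
  unfolding valid_def arrive_def fits_iff[OF assms] by fastforce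

lemma valid_depart: "valid s \<Longrightarrow> valid (s - {a})"
  unfolding valid_def by auto

lemma valid_empty: "valid {}" by (simp add: valid_def)

text \<open>Regroups a sum over target states as a sum over events. Different types lead to
  different packings, and every event changes the packing, so leaving out the diagonal loses
  nothing.\<close>

lemma nn_integral_first_fit_rate:
  assumes s: "valid s" and r: "0 < r"
  shows "(\<integral>\<^sup>+z. ennreal (first_fit_rate I \<alpha> p r s z) * g z \<partial>count_space (- {s})) =
    ennreal r * (\<integral>\<^sup>+j. g (arrive s j) \<partial>measure_pmf arrival_type) + (\<Sum>a\<in>s. g (s - {a}))"
proof -
  have fin: "finite s" using s by (rule valid_finite)
  have rate: "ennreal (first_fit_rate I \<alpha> p r s z) =
     (\<integral>\<^sup>+j. ennreal (p j * r) * indicator {z} (arrive s j) \<partial>count_space I) + (\<Sum>a\<in>s. indicator {z} (s - {a}))" for z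
  proof -
    have "ennreal (\<Sum>\<^sub>\<infinity>i\<in>{i \<in> I. first_fit \<alpha> s i = z}. p i * r) =
        (\<integral>\<^sup>+j. ennreal (p j * r) * indicator {z} (arrive s j) \<partial>count_space I)"
    proof (cases "\<exists>j\<in>I. arrive s j = z")
      case True
      then obtain j where j: "j \<in> I" "arrive s j = z" by auto
      then have "{i \<in> I. first_fit \<alpha> s i = z} = {j}"
        using inj_arrive[OF s] by (auto simp: first_fit_eq inj_on_def)
      moreover have "(\<integral>\<^sup>+j. ennreal (p j * r) * indicator {z} (arrive s j) \<partial>count_space I)
          = (\<integral>\<^sup>+k. ennreal (p k * r) * indicator {j} k \<partial>count_space I)"
        using inj_arrive[OF s] j by (intro nn_integral_cong) (auto simp: inj_on_def split: split_indicator)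
      ultimately show ?thesis using j by simp
    next
      case False
      then have e: "{i \<in> I. first_fit \<alpha> s i = z} = {}" by (auto simp: first_fit_eq)
      moreover have "(\<integral>\<^sup>+j. ennreal (p j * r) * indicator {z} (arrive s j) \<partial>count_space I) = (\<integral>\<^sup>+k. 0 \<partial>count_space I)"
        using False by (intro nn_integral_cong) auto
      ultimately show ?thesis unfolding e by simp
    qed
    moreover have "ennreal (real (card {a \<in> s. s - {a} = z})) = (\<Sum>a\<in>s. indicator {z} (s - {a}))"
    proof -
      have "(\<Sum>a\<in>s. indicator {z} (s - {a}) :: ennreal) = (\<Sum>a\<in>{a \<in> s. s - {a} = z}. 1)"
        using fin by (intro sum.mono_neutral_cong_right) (auto split: split_indicator)
      then show ?thesis by (simp add: ennreal_of_nat_eq_real_of_nat)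
    qed
    moreover have "0 \<le> (\<Sum>\<^sub>\<infinity>i\<in>{i \<in> I. first_fit \<alpha> s i = z}. p i * r)"
      using probs_pos r by (intro infsum_nonneg) (auto intro: less_imp_le)
    ultimately show ?thesis
      unfolding first_fit_rate_def by (subst ennreal_plus) auto
  qed
  have pt: "(\<integral>\<^sup>+z. indicator {z} w * g z \<partial>count_space (- {s})) = g w" if "w \<noteq> s" for w
  proof -
    have "(\<integral>\<^sup>+z. indicator {z} w * g z \<partial>count_space (- {s})) = (\<integral>\<^sup>+z. g w * indicator {w} z \<partial>count_space (- {s}))"
      by (intro nn_integral_cong) (auto split: split_indicator)
    then show ?thesis using that by simp
  qed
  have "(\<integral>\<^sup>+z. ennreal (first_fit_rate I \<alpha> p r s z) * g z \<partial>count_space (- {s})) =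
     (\<integral>\<^sup>+z. (\<integral>\<^sup>+j. ennreal (p j * r) * (indicator {z} (arrive s j) * g z) \<partial>count_space I)
       + (\<Sum>a\<in>s. indicator {z} (s - {a}) * g z) \<partial>count_space (- {s}))"
    unfolding rate by (simp add: distrib_right sum_distrib_right nn_integral_multc[symmetric] mult.assoc)
  also have "\<dots> = (\<integral>\<^sup>+z. (\<integral>\<^sup>+j. ennreal (p j * r) * (indicator {z} (arrive s j) * g z) \<partial>count_space I) \<partial>count_space (- {s}))
       + (\<Sum>a\<in>s. \<integral>\<^sup>+z. indicator {z} (s - {a}) * g z \<partial>count_space (- {s}))"
    by (subst nn_integral_add, simp, simp, subst nn_integral_sum) auto
  also have "(\<Sum>a\<in>s. \<integral>\<^sup>+z. indicator {z} (s - {a}) * g z \<partial>count_space (- {s})) = (\<Sum>a\<in>s. g (s - {a}))"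
    by (intro sum.cong refl pt) auto
  also have "(\<integral>\<^sup>+z. (\<integral>\<^sup>+j. ennreal (p j * r) * (indicator {z} (arrive s j) * g z) \<partial>count_space I) \<partial>count_space (- {s}))
     = (\<integral>\<^sup>+j. (\<integral>\<^sup>+z. ennreal (p j * r) * (indicator {z} (arrive s j) * g z) \<partial>count_space (- {s})) \<partial>count_space I)"
    by (rule nn_integral_count_space_nn_integral) auto
  also have "\<dots> = (\<integral>\<^sup>+j. ennreal r * (ennreal (p j) * g (arrive s j)) \<partial>count_space I)"
  proof (rule nn_integral_cong)
    fix j assume "j \<in> space (count_space I)"
    then have "0 < p j" "arrive s j \<noteq> s" using probs_pos arrive_neq[OF s] by auto
    then show "(\<integral>\<^sup>+z. ennreal (p j * r) * (indicator {z} (arrive s j) * g z) \<partial>count_space (- {s})) = ennreal r * (ennreal (p j) * g (arrive s j))"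
      using r pt[of "arrive s j"] by (subst nn_integral_cmult) (simp_all add: ennreal_mult mult_ac)
  qed
  also have "\<dots> = ennreal r * (\<integral>\<^sup>+j. g (arrive s j) \<partial>measure_pmf arrival_type)"
    by (simp add: nn_integral_cmult arrival_type_nn_integral)
  finally show ?thesis .
qed

lemma first_fit_rate_nonneg: "0 < r \<Longrightarrow> 0 \<le> first_fit_rate I \<alpha> p r s z"
  unfolding first_fit_rate_def using probs_pos
  by (intro add_nonneg_nonneg infsum_nonneg) (auto intro: less_imp_le)

lemma first_fit_rate_pos:
  assumes "0 < first_fit_rate I \<alpha> p r s z"
  shows "(\<exists>j\<in>I. z = arrive s j) \<or> (\<exists>a\<in>s. z = s - {a})"
proof (rule ccontr)
  assume "\<not> ?thesis"
  then have "{i \<in> I. first_fit \<alpha> s i = z} = {}" "{a \<in> s. s - {a} = z} = {}"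
    by (auto simp: first_fit_eq)
  then have "first_fit_rate I \<alpha> p r s z = 0" unfolding first_fit_rate_def by (simp only:) simp
  then show False using assms by simp
qed

lemma reachable_valid: "reachable (first_fit_rate I \<alpha> p r) {} \<subseteq> Collect valid"
proof -
  have "valid z" if "(\<lambda>x y. 0 < first_fit_rate I \<alpha> p r x y)\<^sup>*\<^sup>* {} z" for z
    using that
  proof (induction rule: rtranclp_induct)
    case base
    then show ?case by (rule valid_empty)
  next
    case (step y z)
    then show ?case using first_fit_rate_pos[OF step(2)] valid_arrive valid_depart by auto
  qed
  then show ?thesis by (auto simp: reachable_def)
qed

lemma countable_reachable: "countable (reachable (first_fit_rate I \<alpha> p r) {})"
proof -
  \<comment> \<open>\<open>X\<close> demands validity because this makes the packing finite and so
    the set of its departures countable.\<close>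
  define X where "X = {(s, z). valid s \<and> ((\<exists>j\<in>I. z = arrive s j) \<or> (\<exists>a\<in>s. z = s - {a}))}"
  have "countable (X\<^sup>* `` {{}})"
  proof (rule countable_rtrancl)
    fix Y :: "packing set" assume Y: "countable Y"
    have "X `` Y \<subseteq> (\<Union>s\<in>Y \<inter> Collect valid. arrive s ` I \<union> (\<lambda>a. s - {a}) ` s)"
      by (auto simp: X_def)
    moreover have "countable (\<Union>s\<in>Y \<inter> Collect valid. arrive s ` I \<union> (\<lambda>a. s - {a}) ` s)"
      using Y valid_finite by (intro countable_UN) (auto intro: countable_finite)
    ultimately show "countable (X `` Y)" by (rule countable_subset)
  qed simp
  moreover have "z \<in> X\<^sup>* `` {{}} \<and> valid z" if "(\<lambda>x y. 0 < first_fit_rate I \<alpha> p r x y)\<^sup>*\<^sup>* {} z" for z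
    using that
  proof (induction rule: rtranclp_induct)
    case base
    then show ?case using valid_empty by auto
  next
    case (step y z)
    then have "(y, z) \<in> X" using first_fit_rate_pos[OF step(2)] by (auto simp: X_def)
    moreover have "valid z" using step first_fit_rate_pos[OF step(2)] valid_arrive valid_depart by auto
    ultimately show ?case using step(3) by (auto intro: rtrancl_into_rtrancl)
  qed
  ultimately show ?thesis
    by (rule_tac countable_subset) (auto simp: reachable_def)
qed

lemma reachable_closed:
  assumes "s \<in> reachable q s0" "0 < q s z"
  shows "z \<in> reachable q s0"
  using assms by (auto simp: reachable_def intro: rtranclp.rtrancl_into_rtrancl)

lemma jump_rates_first_fit:
  assumes r: "0 < r"
  shows "jump_rates (first_fit_rate I \<alpha> p r) (reachable (first_fit_rate I \<alpha> p r) {})"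
proof
  fix s assume s: "s \<in> reachable (first_fit_rate I \<alpha> p r) {}"
  then have v: "valid s" using reachable_valid by auto
  have "(\<integral>\<^sup>+z. ennreal (first_fit_rate I \<alpha> p r s z) * 1 \<partial>count_space (- {s})) < \<infinity>"
    unfolding nn_integral_first_fit_rate[OF v r]
    by (simp add: ennreal_of_nat_eq_real_of_nat ennreal_mult_less_top)
  then have "Infinite_Set_Sum.abs_summable_on (first_fit_rate I \<alpha> p r s) (- {s})"
    using first_fit_rate_nonneg[OF r]
    by (auto simp: Infinite_Set_Sum.abs_summable_on_def integrable_iff_bounded)
  then have "Infinite_Sum.abs_summable_on (first_fit_rate I \<alpha> p r s) (- {s})"
    by (rule abs_summable_equivalent[THEN iffD2])
  then show "first_fit_rate I \<alpha> p r s summable_on - {s}"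
    using summable_on_iff_abs_summable_on_real[of "first_fit_rate I \<alpha> p r s" "- {s}"] by blast
qed (use countable_reachable first_fit_rate_nonneg[OF r] reachable_closed in auto)

text \<open>The generator of the chain, written as a sum over events instead of target
  states.\<close>

definition drift :: "real \<Rightarrow> (packing \<Rightarrow> real) \<Rightarrow> packing \<Rightarrow> real" where
  "drift r f s = r * measure_pmf.expectation arrival_type (\<lambda>j. f (arrive s j) - f s) + (\<Sum>a\<in>s. f (s - {a}) - f s)"

lemma AE_arrival_type: "(\<And>j. j \<in> I \<Longrightarrow> P j) \<Longrightarrow> AE j in measure_pmf arrival_type. P j"
  by (simp add: AE_measure_pmf_iff set_arrival_type)

lemma integrable_arrival_type:
  fixes g :: "nat \<Rightarrow> real"
  assumes "\<And>j. j \<in> I \<Longrightarrow> \<bar>g j\<bar> \<le> C"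
  shows "integrable (measure_pmf arrival_type) g"
  using assms by (intro measure_pmf.integrable_const_bound[where B = C] AE_arrival_type) auto

lemma expectation_arrival_type_le:
  fixes g :: "nat \<Rightarrow> real"
  assumes "\<And>j. j \<in> I \<Longrightarrow> \<bar>g j\<bar> \<le> C"
  shows "\<bar>measure_pmf.expectation arrival_type g\<bar> \<le> C"
proof -
  have int: "integrable (measure_pmf arrival_type) g" using assms by (rule integrable_arrival_type)
  have "measure_pmf.expectation arrival_type g \<le> measure_pmf.expectation arrival_type (\<lambda>_. C)"
    using assms by (intro integral_mono_AE int AE_arrival_type) (auto simp: abs_le_iff)
  moreover have "measure_pmf.expectation arrival_type (\<lambda>_. - C) \<le> measure_pmf.expectation arrival_type g"
    using assms by (intro integral_mono_AE int AE_arrival_type) (auto simp: abs_le_iff minus_le_iff)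
  ultimately show ?thesis by simp
qed

lemma drift_bound:
  assumes f: "\<And>s. valid s \<Longrightarrow> \<bar>f s\<bar> \<le> B" and r: "0 < r" and s: "valid s"
    and K: "(\<Sum>a\<in>s. \<bar>f (s - {a}) - f s\<bar>) \<le> K"
  shows "\<bar>drift r f s\<bar> \<le> 2 * B * r + K"
proof -
  have "\<bar>measure_pmf.expectation arrival_type (\<lambda>j. f (arrive s j) - f s)\<bar> \<le> 2 * B"
  proof (rule expectation_arrival_type_le)
    fix j assume "j \<in> I"
    then show "\<bar>f (arrive s j) - f s\<bar> \<le> 2 * B"
      using f[OF s] f[OF valid_arrive[OF s, of j]] by linarith
  qed
  then have "\<bar>r * measure_pmf.expectation arrival_type (\<lambda>j. f (arrive s j) - f s)\<bar> \<le> r * (2 * B)"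
    using r by (simp add: abs_mult)
  moreover have "\<bar>\<Sum>a\<in>s. f (s - {a}) - f s\<bar> \<le> K" using K sum_abs[of "\<lambda>a. f (s - {a}) - f s" s] by linarith
  ultimately show ?thesis unfolding drift_def by (simp add: algebra_simps)
qed

context
  fixes r :: real and \<pi> :: "packing pmf"
  assumes r: "0 < r" and stat: "stationary_distribution (first_fit_rate I \<alpha> p r) {} \<pi>"
begin

lemma stationary_valid: "s \<in> set_pmf \<pi> \<Longrightarrow> valid s"
  using stat reachable_valid by (auto simp: stationary_distribution_def)

lemma AE_stationary: "(\<And>s. valid s \<Longrightarrow> P s) \<Longrightarrow> AE s in measure_pmf \<pi>. P s"
  using stationary_valid by (simp add: AE_measure_pmf_iff)

lemma integrable_stationary:
  fixes f :: "packing \<Rightarrow> real"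
  assumes "\<And>s. valid s \<Longrightarrow> \<bar>f s\<bar> \<le> C"
  shows "integrable (measure_pmf \<pi>) f"
  using assms by (intro measure_pmf.integrable_const_bound[where B = C] AE_stationary) auto

text \<open>The departure rate grows with the number of items and is unbounded over the states, so a
  bounded \<open>f\<close> may have an unbounded generator; the hypothesis on the sum over
  departures supplies the uniform bound that \<open>stationary_gen\<close> asks for.\<close>

lemma stationary_drift_nonneg:
  assumes f: "\<And>s. valid s \<Longrightarrow> 0 \<le> f s \<and> f s \<le> B"
    and K: "\<And>s. valid s \<Longrightarrow> (\<Sum>a\<in>s. \<bar>f (s - {a}) - f s\<bar>) \<le> K"
  shows "measure_pmf.expectation \<pi> (drift r f) = 0"
proof -
  let ?q = "first_fit_rate I \<alpha> p r"
  let ?S = "reachable ?q {}"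
  interpret J: jump_rates ?q ?S by (rule jump_rates_first_fit[OF r])
  have B0: "0 \<le> B" using f[OF valid_empty] by auto
  have K0: "0 \<le> K" using K[OF valid_empty] by simp
  have exit: "exit_rate ?q s = r + real (card s)" if "s \<in> ?S" for s
  proof -
    have v: "valid s" using that reachable_valid by auto
    have "ennreal (exit_rate ?q s) = (\<integral>\<^sup>+z. ennreal (?q s z) * 1 \<partial>count_space (- {s}))"
      using J.nn_integral_exit_rate[OF that] by simp
    also have "\<dots> = ennreal r + ennreal (real (card s))"
      unfolding nn_integral_first_fit_rate[OF v r] by (simp add: ennreal_of_nat_eq_real_of_nat)
    also have "\<dots> = ennreal (r + real (card s))" using r by (intro ennreal_plus[symmetric]) auto
    finally show ?thesis using r J.exit_rate_nonneg by (subst (asm) ennreal_inj) auto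
  qed
  have U: "(\<integral>\<^sup>+z. ennreal (?q s z) * ennreal (g z) \<partial>count_space (?S - {s})) =
      ennreal (exit_rate ?q s * g s + drift r g s) \<and> 0 \<le> exit_rate ?q s * g s + drift r g s"
    if s: "s \<in> ?S" and g: "\<And>s. valid s \<Longrightarrow> 0 \<le> g s \<and> g s \<le> B" for s and g :: "packing \<Rightarrow> real"
  proof -
    have v: "valid s" using s reachable_valid by auto
    have ga: "0 \<le> g (arrive s j) \<and> g (arrive s j) \<le> B" if "j \<in> I" for j
      using g valid_arrive[OF v that] by auto
    have gd: "0 \<le> g (s - {a}) \<and> g (s - {a}) \<le> B" for a using g valid_depart[OF v] by auto
    have ig: "integrable (measure_pmf arrival_type) (\<lambda>j. g (arrive s j))"
      using ga by (intro integrable_arrival_type[where C = B]) auto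
    let ?e = "measure_pmf.expectation arrival_type (\<lambda>j. g (arrive s j))"
    have e0: "0 \<le> ?e" using ga by (intro integral_nonneg_AE AE_arrival_type) auto
    have "(\<integral>\<^sup>+z. ennreal (?q s z) * ennreal (g z) \<partial>count_space (?S - {s})) =
      ennreal r * (\<integral>\<^sup>+j. ennreal (g (arrive s j)) \<partial>measure_pmf arrival_type) + (\<Sum>a\<in>s. ennreal (g (s - {a})))"
      unfolding J.nn_integral_rate_restrict[OF s, symmetric] nn_integral_first_fit_rate[OF v r] ..
    also have "(\<integral>\<^sup>+j. ennreal (g (arrive s j)) \<partial>measure_pmf arrival_type) = ennreal ?e"
      using ga by (intro nn_integral_eq_integral ig AE_arrival_type) auto
    also have "(\<Sum>a\<in>s. ennreal (g (s - {a}))) = ennreal (\<Sum>a\<in>s. g (s - {a}))"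
      using gd by (intro sum_ennreal) auto
    also have "ennreal r * ennreal ?e + ennreal (\<Sum>a\<in>s. g (s - {a})) = ennreal (r * ?e + (\<Sum>a\<in>s. g (s - {a})))"
      using r e0 gd by (subst ennreal_plus) (auto simp: ennreal_mult intro!: sum_nonneg)
    also have "r * ?e + (\<Sum>a\<in>s. g (s - {a})) = exit_rate ?q s * g s + drift r g s"
      unfolding exit[OF s] drift_def using ig by (simp add: sum_subtractf algebra_simps)
    finally have "(\<integral>\<^sup>+z. ennreal (?q s z) * ennreal (g z) \<partial>count_space (?S - {s})) =
      ennreal (exit_rate ?q s * g s + drift r g s)" .
    moreover have "0 \<le> exit_rate ?q s * g s + drift r g s"
      using r e0 gd ig unfolding exit[OF s] drift_def
      by (auto simp: sum_subtractf algebra_simps intro!: add_nonneg_nonneg sum_nonneg)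
    ultimately show ?thesis by blast
  qed
  have dr: "\<bar>drift r g s\<bar> \<le> 2 * B * r + K"
    if v: "valid s" and g: "\<And>s. valid s \<Longrightarrow> 0 \<le> g s \<and> g s \<le> B"
      and gK: "(\<Sum>a\<in>s. \<bar>g (s - {a}) - g s\<bar>) \<le> K" for s and g :: "packing \<Rightarrow> real"
    using g gK by (intro drift_bound r v) auto
  have "measure_pmf.expectation \<pi> (J.gen f) = 0"
  proof (rule J.stationary_gen)
    show "set_pmf \<pi> \<subseteq> ?S" using stat by (simp add: stationary_distribution_def)
    show "(\<integral>\<^sup>+ s. transition_prob ?q t s s' \<partial>measure_pmf \<pi>) = ennreal (pmf \<pi> s')" if "0 \<le> t" for t s'
      using stat that by (simp add: stationary_distribution_def)
    show "0 \<le> f s \<and> f s \<le> B" if "s \<in> ?S" for s using f that reachable_valid by auto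
    show "0 \<le> 2 * B * r + K" using B0 K0 r by simp
    fix s assume s: "s \<in> ?S"
    then have v: "valid s" using reachable_valid by auto
    show "(\<integral>\<^sup>+z. ennreal (?q s z) * ennreal (f z) \<partial>count_space (?S - {s})) \<le> ennreal (exit_rate ?q s * f s + (2 * B * r + K))"
      using U[OF s f] dr[OF v f K[OF v]] by (auto intro!: ennreal_leI)
    have f': "\<And>s. valid s \<Longrightarrow> 0 \<le> B - f s \<and> B - f s \<le> B" using f by auto
    have K': "(\<Sum>a\<in>s. \<bar>(B - f (s - {a})) - (B - f s)\<bar>) \<le> K"
      using K[OF v] by (simp add: abs_minus_commute)
    show "(\<integral>\<^sup>+z. ennreal (?q s z) * ennreal (B - f z) \<partial>count_space (?S - {s})) \<le> ennreal (exit_rate ?q s * (B - f s) + (2 * B * r + K))"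
      using U[OF s f'] dr[OF v f' K'] by (auto intro!: ennreal_leI)
  qed
  also have "measure_pmf.expectation \<pi> (J.gen f) = measure_pmf.expectation \<pi> (drift r f)"
  proof (rule integral_cong_AE)
    have "J.gen f s = drift r f s" if "s \<in> ?S" for s
    proof -
      note U[OF that, of f]
      then have "(\<integral>\<^sup>+z. ennreal (?q s z) * ennreal (f z) \<partial>count_space (?S - {s})) =
        ennreal (exit_rate ?q s * f s + drift r f s)" "0 \<le> exit_rate ?q s * f s + drift r f s"
        using f by auto
      then show ?thesis unfolding J.gen_def by simp
    qed
    moreover have "set_pmf \<pi> \<subseteq> ?S" using stat by (simp add: stationary_distribution_def)
    ultimately show "AE s in measure_pmf \<pi>. J.gen f s = drift r f s"
      by (auto simp: AE_measure_pmf_iff)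
  qed auto
  finally show ?thesis .
qed

theorem stationary_drift:
  assumes f: "\<And>s. valid s \<Longrightarrow> \<bar>f s\<bar> \<le> B"
    and K: "\<And>s. valid s \<Longrightarrow> (\<Sum>a\<in>s. \<bar>f (s - {a}) - f s\<bar>) \<le> K"
  shows "measure_pmf.expectation \<pi> (drift r f) = 0"
proof -
  have "measure_pmf.expectation \<pi> (drift r (\<lambda>s. f s + B)) = 0"
    using f K by (intro stationary_drift_nonneg[where B = "2 * B" and K = K]) (auto simp: abs_le_iff, force+)
  moreover have "drift r (\<lambda>s. f s + B) = drift r f" by (auto simp: drift_def fun_eq_iff)
  ultimately show ?thesis by simp
qed

end

end

section \<open>Spacing of item ends and the effect of one event on the holes\<close>

lemma card_spaced_le:
  fixes E :: "real set"
  assumes d: "0 < d" and E: "E \<subseteq> {a..<b}" and ab: "a \<le> b"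
    and sp: "\<And>e e'. e \<in> E \<Longrightarrow> e' \<in> E \<Longrightarrow> e < e' \<Longrightarrow> e + d \<le> e'"
  shows "finite E" "real (card E) \<le> (b - a) / d + 1"
proof -
  \<comment> \<open>Points at distance at least \<open>d\<close> from each other lie in different
    cells of length \<open>d\<close>.\<close>
  define g where "g e = nat \<lfloor>(e - a) / d\<rfloor>" for e
  have inj: "inj_on g E"
  proof (rule linorder_inj_onI)
    fix e e' assume e: "e < e'" "e \<in> E" "e' \<in> E"
    then have "e + d \<le> e'" using sp by blast
    then have "(e + d - a) / d \<le> (e' - a) / d" using d by (intro divide_right_mono) auto
    then have "(e - a) / d + 1 \<le> (e' - a) / d" using d by (simp add: add_divide_distrib diff_divide_distrib)
    then have "\<lfloor>(e - a) / d\<rfloor> + 1 \<le> \<lfloor>(e' - a) / d\<rfloor>" by linarith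
    moreover have "0 \<le> \<lfloor>(e - a) / d\<rfloor>" using e E d by auto
    ultimately have "nat \<lfloor>(e - a) / d\<rfloor> < nat \<lfloor>(e' - a) / d\<rfloor>" by (subst nat_less_eq_zless) linarith+
    then show "g e \<noteq> g e'" unfolding g_def by (rule less_imp_neq)
  qed auto
  have sub: "g ` E \<subseteq> {..nat \<lfloor>(b - a) / d\<rfloor>}"
  proof
    fix k assume "k \<in> g ` E"
    then obtain e where "e \<in> E" "k = g e" by auto
    then have "\<lfloor>(e - a) / d\<rfloor> \<le> \<lfloor>(b - a) / d\<rfloor>"
      using E d by (intro floor_mono divide_right_mono) auto
    then show "k \<in> {..nat \<lfloor>(b - a) / d\<rfloor>}" using \<open>k = g e\<close> by (simp add: g_def nat_mono)
  qed
  have "finite (g ` E)" using sub by (rule finite_subset) simp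
  then show "finite E" using inj by (rule finite_imageD)
  have "card E = card (g ` E)" using inj by (simp add: card_image)
  also have "\<dots> \<le> card {..nat \<lfloor>(b - a) / d\<rfloor>}" using sub by (intro card_mono) auto
  finally have "card E \<le> nat \<lfloor>(b - a) / d\<rfloor> + 1" by simp
  moreover have "0 \<le> (b - a) / d" using ab d by simp
  then have "real (nat \<lfloor>(b - a) / d\<rfloor>) \<le> (b - a) / d" by (simp add: of_nat_nat)
  ultimately show "real (card E) \<le> (b - a) / d + 1" by linarith
qed

context first_fit_model
begin

lemma one_in_types: "1 \<in> I"
proof -
  have "I \<noteq> {}" using infsumI[OF probs_sum] by auto
  then show ?thesis using types by auto
qed

lemma types_ge_1: "j \<in> I \<Longrightarrow> 1 \<le> j" using types by auto

lemma types_down: "j \<in> I \<Longrightarrow> 1 \<le> k \<Longrightarrow> k \<le> j \<Longrightarrow> k \<in> I" using types by auto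

lemma size_mono: "j \<in> I \<Longrightarrow> k \<in> I \<Longrightarrow> j \<le> k \<Longrightarrow> \<alpha> j \<le> \<alpha> k"
  using sizes_increasing by (simp add: strict_mono_on_leD)

lemma size_strict_mono: "j \<in> I \<Longrightarrow> k \<in> I \<Longrightarrow> j < k \<Longrightarrow> \<alpha> j < \<alpha> k"
  using sizes_increasing by (simp add: strict_mono_on_def)

lemma size_ge_first: "j \<in> I \<Longrightarrow> \<alpha> 1 \<le> \<alpha> j"
  using size_mono[OF one_in_types] types_ge_1 by auto

lemma first_size_pos: "0 < \<alpha> 1" using one_in_types by (rule sizes_pos)

lemma ends_spaced:
  assumes "valid s" "e \<in> ends s" "e' \<in> ends s" "e < e'"
  shows "e + \<alpha> 1 \<le> e'"
  using assms(3)
proof (cases rule: endsE)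
  case 1
  then show ?thesis using ends_nonneg[OF assms(1,2)] assms(4) by auto
next
  case (2 z k)
  then have "\<alpha> 1 \<le> \<alpha> k" using valid_item[OF assms(1)] size_ge_first by blast
  moreover have "e \<le> z" using item_before_end[OF assms(1,2) 2(1)] 2 assms(4) by force
  ultimately show ?thesis using 2 by simp
qed

lemma card_ends_le:
  assumes "valid s" "a \<le> b"
  shows "real (card (ends s \<inter> {a..<b})) \<le> (b - a) / \<alpha> 1 + 1"
  using assms ends_spaced[OF assms(1)]
  by (intro card_spaced_le first_size_pos) auto

text \<open>
  The free gap in front of an item at \<open>y\<close> begins at \<open>lend s y\<close>. Its departure enlarges this gap, so
  the only item ends at which holes change are \<open>lend s y\<close> and the end of the item.
\<close>

definition lend :: "packing \<Rightarrow> real \<Rightarrow> real" where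
  "lend s y = Max {e \<in> ends s. e \<le> y}"

lemma lend:
  assumes "valid s" "0 \<le> y"
  shows "lend s y \<in> ends s" "lend s y \<le> y" "\<And>e. e \<in> ends s \<Longrightarrow> e \<le> y \<Longrightarrow> e \<le> lend s y"
proof -
  let ?E = "{e \<in> ends s. e \<le> y}"
  have "finite ?E" "?E \<noteq> {}" using ends_finite[OF assms(1)] zero_in_ends assms(2) by auto
  then have "Max ?E \<in> ?E" "\<And>e'. e' \<in> ?E \<Longrightarrow> e' \<le> Max ?E" by (rule Max_in, simp)
  then show "lend s y \<in> ends s" "lend s y \<le> y" "\<And>e. e \<in> ends s \<Longrightarrow> e \<le> y \<Longrightarrow> e \<le> lend s y"
    unfolding lend_def by blast+
qed

lemma lend_mono_strict:
  assumes "valid s" "(y, j) \<in> s" "0 \<le> y" "(z, k) \<in> s" "y < z"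
  shows "y < lend s z"
proof -
  have "y + \<alpha> j \<le> lend s z"
    using assms valid_less[OF assms(1,2,4,5)] end_in_ends[OF assms(2)] by (intro lend(3)) auto
  then show ?thesis using valid_item(3)[OF assms(1,2)] by simp
qed

lemma lend_inj:
  assumes "valid s" "(y, j) \<in> s" "(z, k) \<in> s" "lend s y = lend s z"
  shows "(y, j) = (z, k)"
proof -
  note v = valid_item[OF assms(1,2)] valid_item[OF assms(1,3)]
  have "\<not> y < z" using lend_mono_strict[OF assms(1,2) v(2) assms(3)] lend(2)[OF assms(1) v(2)] assms(4) by auto
  moreover have "\<not> z < y" using lend_mono_strict[OF assms(1,3) v(5) assms(2)] lend(2)[OF assms(1) v(5)] assms(4) by auto
  ultimately show ?thesis using valid_same_start[OF assms(1)] assms(2,3) by (metis linorder_less_linear)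
qed

lemma end_inj:
  assumes "valid s" "(y, j) \<in> s" "(z, k) \<in> s" "y + \<alpha> j = z + \<alpha> k"
  shows "(y, j) = (z, k)"
  using valid_disjoint[OF assms(1-3)] valid_item(3)[OF assms(1,2)] valid_item(3)[OF assms(1,3)] assms(4) by auto

lemma ends_depart:
  assumes "valid s" "(y, j) \<in> s"
  shows "ends (s - {(y, j)}) = ends s - {y + \<alpha> j}"
proof -
  have "y + \<alpha> j \<noteq> 0" using valid_item[OF assms] by auto
  then show ?thesis using end_inj[OF assms _ sym] by (auto simp: ends_def)
qed

lemma ends_arrive: "ends (arrive s j) = insert (pos s j + \<alpha> j) (ends s)"
  by (auto simp: ends_def arrive_def)

lemma arrive_new_end:
  assumes "valid s" "j \<in> I"
  shows "pos s j + \<alpha> j \<notin> ends s"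
proof
  let ?u = "pos s j"
  assume e: "?u + \<alpha> j \<in> ends s"
  have f: "0 \<le> ?u" "\<And>z k. (z, k) \<in> s \<Longrightarrow> ?u + \<alpha> j \<le> z \<or> z + \<alpha> k \<le> ?u"
    using pos_fits[OF assms] by (auto simp: fits_iff[OF assms])
  from e show False
  proof (cases rule: endsE)
    case 1
    then show ?thesis using f(1) sizes_pos[OF assms(2)] by auto
  next
    case (2 z k)
    then show ?thesis using f(2)[OF 2(1)] valid_item(3)[OF assms(1) 2(1)] sizes_pos[OF assms(2)] by auto
  qed
qed

lemma fits_depart_mono: "fits \<alpha> s i u \<Longrightarrow> fits \<alpha> (s - A) i u"
  by (auto simp: fits_def)

lemma hole_fits: "valid s \<Longrightarrow> i \<in> I \<Longrightarrow> u \<in> holes i s \<Longrightarrow> (y, j) \<in> s \<Longrightarrow> u + \<alpha> i \<le> y \<or> y + \<alpha> j \<le> u"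
  by (auto simp: holes_def fits_iff)

lemma fits_arrive:
  assumes "valid s" "i \<in> I" "j \<in> I"
  shows "fits \<alpha> (arrive s j) i u \<longleftrightarrow> fits \<alpha> s i u \<and> (u + \<alpha> i \<le> pos s j \<or> pos s j + \<alpha> j \<le> u)"
  unfolding fits_iff[OF assms(1,2)] fits_iff[OF valid_arrive[OF assms(1,3)] assms(2)]
  by (auto simp: arrive_def)

lemma fits_depart:
  assumes "valid s" "i \<in> I" "(y, j) \<in> s"
  shows "fits \<alpha> s i u \<longleftrightarrow> fits \<alpha> (s - {(y, j)}) i u \<and> (u + \<alpha> i \<le> y \<or> y + \<alpha> j \<le> u)"
  unfolding fits_iff[OF assms(1,2)] fits_iff[OF valid_depart[OF assms(1)] assms(2)]
  using assms(3) by auto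

text \<open>The landing point is the origin or the end of an item, and that item already separates
  it from every hole further left; every end further right lies beyond the arriving item. So only
  the landing point and the new end change their status.\<close>

lemma holes_arrive:
  assumes s: "valid s" and i: "i \<in> I" and j: "j \<in> I"
  shows "holes i (arrive s j) = holes i s - {pos s j} \<union> (if fits \<alpha> s i (pos s j + \<alpha> j) then {pos s j + \<alpha> j} else {})"
proof -
  let ?u = "pos s j"
  have aj: "0 < \<alpha> j" "0 < \<alpha> i" using sizes_pos i j by auto
  have fu: "fits \<alpha> (arrive s j) i (?u + \<alpha> j) \<longleftrightarrow> fits \<alpha> s i (?u + \<alpha> j)"
    by (simp add: fits_arrive[OF s i j])
  have old: "fits \<alpha> (arrive s j) i u \<longleftrightarrow> fits \<alpha> s i u \<and> u \<noteq> ?u" if u: "u \<in> ends s" for u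
  proof (cases u ?u rule: linorder_cases)
    case less
    have "u + \<alpha> i \<le> ?u" if "fits \<alpha> s i u"
      using pos_in_ends[OF s j]
    proof (cases rule: endsE)
      case 1
      then show ?thesis using less ends_nonneg[OF s u] by auto
    next
      case (2 z k)
      then show ?thesis using that less valid_item(3)[OF s 2(1)] by (auto simp: fits_iff[OF s i])
    qed
    then show ?thesis using less by (auto simp: fits_arrive[OF s i j])
  next
    case equal
    then show ?thesis using aj by (auto simp: fits_arrive[OF s i j])
  next
    case greater
    from u have "?u + \<alpha> j \<le> u"
    proof (cases rule: endsE)
      case 1
      then show ?thesis using greater pos_nonneg[OF s j] by auto
    next
      case (2 z k)
      then show ?thesis using pos_fits[OF s j] greater valid_item(3)[OF s 2(1)]
        by (fastforce simp: fits_iff[OF s j])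
    qed
    then show ?thesis using greater by (auto simp: fits_arrive[OF s i j])
  qed
  show ?thesis
    unfolding holes_def ends_arrive using old fu arrive_new_end[OF s j] by auto
qed

text \<open>The item that prevents an i-item from fitting at the landing point starts to the right
  of the arriving item and less than \<alpha> i beyond the landing point; all the more it prevents
  one from fitting at the new end.\<close>

lemma arrive_not_hole:
  assumes s: "valid s" and i: "i \<in> I" and j: "j \<in> I" and "pos s j \<notin> holes i s"
  shows "\<not> fits \<alpha> s i (pos s j + \<alpha> j)"
proof
  let ?u = "pos s j"
  assume f: "fits \<alpha> s i (?u + \<alpha> j)"
  have "\<not> fits \<alpha> s i ?u" using assms(4) pos_in_ends[OF s j] by (simp add: holes_def)
  then obtain z k where z: "(z, k) \<in> s" "z < ?u + \<alpha> i" "?u < z + \<alpha> k"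
    using pos_nonneg[OF s j] by (fastforce simp: fits_iff[OF s i])
  then have "?u + \<alpha> j \<le> z"
    using pos_fits[OF s j] by (fastforce simp: fits_iff[OF s j])
  then show False
    using f z valid_item(3)[OF s z(1)] sizes_pos[OF j] by (fastforce simp: fits_iff[OF s i])
qed

lemma holes_depart:
  assumes s: "valid s" and i: "i \<in> I" and a: "(y, j) \<in> s"
  shows "holes i (s - {(y, j)}) = holes i s - {y + \<alpha> j, lend s y} \<union>
     (if fits \<alpha> (s - {(y, j)}) i (lend s y) then {lend s y} else {})"
proof -
  note it = valid_item[OF s a]
  note l = lend[OF s it(2)]
  have old: "fits \<alpha> (s - {(y, j)}) i u \<longleftrightarrow> fits \<alpha> s i u"
    if u: "u \<in> ends s" "u \<noteq> lend s y" "u \<noteq> y + \<alpha> j" for u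
  proof -
    have "u + \<alpha> i \<le> y \<or> y + \<alpha> j \<le> u" if f: "fits \<alpha> (s - {(y, j)}) i u"
    proof (cases "u \<le> y")
      case True
      then have less: "u < lend s y" using l(3)[OF u(1)] u(2) by simp
      from l(1) have "u + \<alpha> i \<le> lend s y"
      proof (cases rule: endsE)
        case 1
        then show ?thesis using less ends_nonneg[OF s u(1)] by auto
      next
        case (2 z k)
        then have "(z, k) \<in> s - {(y, j)}" using l(2) it by auto
        then have "u + \<alpha> i \<le> z \<or> z + \<alpha> k \<le> u"
          using f by (auto simp: fits_iff[OF valid_depart[OF s] i] dest!: bspec[of _ _ "(z, k)"])
        then show ?thesis using 2 less valid_item(3)[OF s 2(1)] by auto
      qed
      then show ?thesis using l(2) by simp
    next
      case False
      then show ?thesis using item_before_end[OF s u(1) a] by simp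
    qed
    then show ?thesis using fits_depart[OF s i a] by blast
  qed
  have "lend s y \<noteq> y + \<alpha> j" using l(2) it by auto
  then show ?thesis
    unfolding holes_def ends_depart[OF s a] using old l(1) by auto
qed

text \<open>The gap that opens at \<open>lend s y\<close> contains the whole place of the departed
  item, which is at least \<alpha> i long.\<close>

lemma fits_depart_large:
  assumes s: "valid s" and i: "i \<in> I" and a: "(y, j) \<in> s" and ij: "i \<le> j"
  shows "fits \<alpha> (s - {(y, j)}) i (lend s y)"
proof -
  note it = valid_item[OF s a]
  note l = lend[OF s it(2)]
  have "lend s y + \<alpha> i \<le> z \<or> z + \<alpha> k \<le> lend s y" if z: "(z, k) \<in> s" "(z, k) \<noteq> (y, j)" for z k
  proof (cases "z < y")
    case True
    then have "z + \<alpha> k \<le> lend s y" using valid_less[OF s z(1) a] l(3) end_in_ends[OF z(1)] by blast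
    then show ?thesis by simp
  next
    case False
    then have "y < z" using z a valid_same_start[OF s] by (metis linorder_less_linear)
    then have "y + \<alpha> j \<le> z" using valid_less[OF s a z(1)] by simp
    then show ?thesis using l(2) size_mono[OF i it(1) ij] by simp
  qed
  then show ?thesis
    using ends_nonneg[OF s l(1)] by (auto simp: fits_iff[OF valid_depart[OF s] i])
qed

text \<open>A hole right behind the departing item is not simply lost: the gap in which it lies now
  begins at \<open>lend s y\<close>. Hence a departure reduces the number of holes by at most one,
  even if holes on both sides of the item merge.\<close>

lemma fits_depart_next_hole:
  assumes s: "valid s" and i: "i \<in> I" and a: "(y, j) \<in> s" and h: "y + \<alpha> j \<in> holes i s"
  shows "fits \<alpha> (s - {(y, j)}) i (lend s y)"
proof -
  note it = valid_item[OF s a]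
  note l = lend[OF s it(2)]
  have "lend s y + \<alpha> i \<le> z \<or> z + \<alpha> k \<le> lend s y" if z: "(z, k) \<in> s" "(z, k) \<noteq> (y, j)" for z k
  proof (cases "z < y")
    case True
    then have "z + \<alpha> k \<le> lend s y" using valid_less[OF s z(1) a] l(3) end_in_ends[OF z(1)] by blast
    then show ?thesis by simp
  next
    case False
    then have "y < z" using z a valid_same_start[OF s] by (metis linorder_less_linear)
    then have "y + \<alpha> j \<le> z" using valid_less[OF s a z(1)] by simp
    then have "y + \<alpha> j + \<alpha> i \<le> z" using hole_fits[OF s i h z(1)] valid_item(3)[OF s z(1)] by auto
    then show ?thesis using l(2) it by simp
  qed
  then show ?thesis
    using ends_nonneg[OF s l(1)] by (auto simp: fits_iff[OF valid_depart[OF s] i])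
qed

text \<open>The intervals are disjoint parts of \<open>{a..b}\<close>, so their Lebesgue measures
  add up. The lengths \<open>len j\<close> may be shorter than the items, which allows overhanging
  items to be cut.\<close>

lemma packed_sum_le:
  assumes s: "valid s" and A: "A \<subseteq> s" and ab: "a \<le> b"
    and l: "\<And>y j. (y, j) \<in> A \<Longrightarrow> 0 \<le> len j \<and> len j \<le> \<alpha> j \<and> a \<le> y \<and> y + len j \<le> b"
  shows "(\<Sum>(y, j)\<in>A. len j) \<le> b - a"
proof -
  define J where "J = (\<lambda>(y, j). {y..<y + len j :: real})"
  have fin: "finite A" using valid_finite[OF s] A by (rule finite_subset[rotated])
  have disj: "disjoint_family_on J A"
    unfolding disjoint_family_on_def
  proof (intro ballI impI)
    fix a b assume ab: "a \<in> A" "b \<in> A" "a \<noteq> b"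
    obtain y j z k where [simp]: "a = (y, j)" "b = (z, k)" by (cases a, cases b) auto
    have "y + \<alpha> j \<le> z \<or> z + \<alpha> k \<le> y"
      using ab A valid_disjoint[OF s, of y j z k] by (auto simp: not_le[symmetric])
    then show "J a \<inter> J b = {}" using l[of y j] l[of z k] ab by (auto simp: J_def)
  qed
  have "(\<Sum>(y, j)\<in>A. len j) = (\<Sum>a\<in>A. measure lborel (J a))"
    using l by (intro sum.cong) (auto simp: J_def)
  also have "\<dots> = measure lborel (\<Union>a\<in>A. J a)"
    using fin disj
  proof (intro measure_finite_Union[symmetric])
    fix a assume "a \<in> A"
    have "bounded (J a)" by (cases a) (simp add: J_def)
    then have "emeasure lborel (J a) < \<infinity>" by (rule emeasure_bounded_finite)
    then show "emeasure lborel (J a) \<noteq> \<infinity>" by simp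
  qed (auto simp: J_def)
  also have "\<dots> \<le> measure lborel {a..b}"
  proof (rule measure_mono_fmeasurable)
    show "(\<Union>a\<in>A. J a) \<subseteq> {a..b}" using l by (force simp: J_def)
    show "(\<Union>a\<in>A. J a) \<in> sets lborel" using fin by (intro sets.finite_UN) (auto simp: J_def)
    have "emeasure lborel {a..b} < \<infinity>" by (intro emeasure_bounded_finite) auto
    then show "{a..b} \<in> fmeasurable lborel" by (simp add: fmeasurable_def)
  qed
  finally show ?thesis using ab by simp
qed

text \<open>Only the last item can reach beyond \<open>b\<close>, and after truncation by at most
  \<open>c\<close>.\<close>

lemma packed_length_le:
  assumes s: "valid s" and c: "0 \<le> c" and ab: "a \<le> b"
  shows "(\<Sum>(y, j)\<in>{(y, j) \<in> s. a \<le> y \<and> y < b}. min (\<alpha> j) c) \<le> b - a + c"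
proof -
  have "(\<Sum>(y, j)\<in>{(y, j) \<in> s. a \<le> y \<and> y < b}. min (\<alpha> j) c) \<le> (b + c) - a"
    using ab c valid_item[OF s]
    by (intro packed_sum_le[OF s, where len = "\<lambda>j. min (\<alpha> j) c"]) (auto simp: less_imp_le min_def)
  then show ?thesis by simp
qed

section \<open>Additive functionals of the packing\<close>

definition wsum :: "(real \<Rightarrow> nat \<Rightarrow> real) \<Rightarrow> packing \<Rightarrow> real" where
  "wsum \<phi> s = (\<Sum>(y, j)\<in>s. \<phi> y j)"

lemma wsum_arrive: "valid s \<Longrightarrow> j \<in> I \<Longrightarrow> wsum \<phi> (arrive s j) = \<phi> (pos s j) j + wsum \<phi> s"
  using arrive_new by (simp add: wsum_def arrive_def valid_finite)

lemma wsum_depart: "valid s \<Longrightarrow> (y, j) \<in> s \<Longrightarrow> wsum \<phi> (s - {(y, j)}) = wsum \<phi> s - \<phi> y j"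
  by (simp add: wsum_def valid_finite sum_diff1)

lemma wsum_nonneg: "(\<And>y j. (y, j) \<in> s \<Longrightarrow> 0 \<le> \<phi> y j) \<Longrightarrow> 0 \<le> wsum \<phi> s"
  unfolding wsum_def by (intro sum_nonneg) auto

lemma wsum_mono: "(\<And>y j. (y, j) \<in> s \<Longrightarrow> \<phi> y j \<le> \<psi> y j) \<Longrightarrow> wsum \<phi> s \<le> wsum \<psi> s"
  unfolding wsum_def by (intro sum_mono) auto

text \<open>Every item leaves at rate 1, so departures contribute minus the functional
  itself.\<close>

lemma drift_wsum:
  assumes "valid s"
  shows "drift r (wsum \<phi>) s = r * measure_pmf.expectation arrival_type (\<lambda>j. \<phi> (pos s j) j) - wsum \<phi> s"
proof -
  have "measure_pmf.expectation arrival_type (\<lambda>j. wsum \<phi> (arrive s j) - wsum \<phi> s)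
      = measure_pmf.expectation arrival_type (\<lambda>j. \<phi> (pos s j) j)"
    by (intro integral_cong_AE AE_arrival_type) (auto simp: wsum_arrive[OF assms])
  moreover have "(\<Sum>a\<in>s. wsum \<phi> (s - {a}) - wsum \<phi> s) = - wsum \<phi> s"
    unfolding wsum_def sum_negf[symmetric]
    by (intro sum.cong refl) (auto simp: valid_finite[OF assms] sum_diff1)
  ultimately show ?thesis by (simp add: drift_def)
qed

lemma wsum_min_le:
  assumes "valid s" "0 \<le> c" "a \<le> b"
  shows "wsum (\<lambda>y j. of_bool (a \<le> y \<and> y < b) * min (\<alpha> j) c) s \<le> b - a + c"
proof -
  have "wsum (\<lambda>y j. of_bool (a \<le> y \<and> y < b) * min (\<alpha> j) c) s =
      (\<Sum>(y, j)\<in>{(y, j) \<in> s. a \<le> y \<and> y < b}. min (\<alpha> j) c)"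
    unfolding wsum_def by (rule sum.mono_neutral_cong_right) (auto simp: valid_finite[OF assms(1)])
  then show ?thesis using packed_length_le[OF assms] by simp
qed

lemma wsum_count_le:
  assumes "valid s" "a \<le> b"
  shows "wsum (\<lambda>y j. of_bool (a \<le> y \<and> y < b)) s \<le> (b - a) / \<alpha> 1 + 1"
proof -
  have "\<alpha> 1 * wsum (\<lambda>y j. of_bool (a \<le> y \<and> y < b)) s = wsum (\<lambda>y j. of_bool (a \<le> y \<and> y < b) * min (\<alpha> j) (\<alpha> 1)) s"
    unfolding wsum_def sum_distrib_left using valid_item[OF assms(1)] size_ge_first
    by (intro sum.cong) (auto simp: min_absorb2)
  also have "\<dots> \<le> b - a + \<alpha> 1"
    using assms first_size_pos by (intro wsum_min_le) auto
  finally show ?thesis using first_size_pos by (simp add: field_simps)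
qed

text \<open>Little's law for mean service time 1, with weights \<phi>.\<close>

lemma stationary_wsum:
  assumes r: "0 < r" and stat: "stationary_distribution (first_fit_rate I \<alpha> p r) {} \<pi>"
    and nn: "\<And>y j. j \<in> I \<Longrightarrow> 0 \<le> \<phi> y j" and B: "\<And>s. valid s \<Longrightarrow> wsum \<phi> s \<le> B"
  shows "measure_pmf.expectation \<pi> (wsum \<phi>) =
     r * measure_pmf.expectation \<pi> (\<lambda>s. measure_pmf.expectation arrival_type (\<lambda>j. \<phi> (pos s j) j))"
proof -
  have w0: "0 \<le> wsum \<phi> s" if "valid s" for s
    using nn valid_item(1)[OF that] by (intro wsum_nonneg) auto
  have "measure_pmf.expectation \<pi> (drift r (wsum \<phi>)) = 0"
  proof (rule stationary_drift[OF r stat])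
    show "\<bar>wsum \<phi> s\<bar> \<le> B" if "valid s" for s using B w0 that by auto
    show "(\<Sum>a\<in>s. \<bar>wsum \<phi> (s - {a}) - wsum \<phi> s\<bar>) \<le> B" if v: "valid s" for s
    proof -
      have "(\<Sum>a\<in>s. \<bar>wsum \<phi> (s - {a}) - wsum \<phi> s\<bar>) = wsum \<phi> s"
        using nn valid_item(1)[OF v]
        by (subst (3) wsum_def, intro sum.cong refl) (auto simp: wsum_depart[OF v])
      then show ?thesis using B[OF v] by simp
    qed
  qed
  also have "measure_pmf.expectation \<pi> (drift r (wsum \<phi>)) =
     measure_pmf.expectation \<pi> (\<lambda>s. r * measure_pmf.expectation arrival_type (\<lambda>j. \<phi> (pos s j) j) - wsum \<phi> s)"
    by (intro integral_cong_AE AE_stationary[OF r stat] drift_wsum) auto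
  also have "\<dots> = r * measure_pmf.expectation \<pi> (\<lambda>s. measure_pmf.expectation arrival_type (\<lambda>j. \<phi> (pos s j) j))
      - measure_pmf.expectation \<pi> (wsum \<phi>)"
  proof -
    have "integrable (measure_pmf \<pi>) (wsum \<phi>)"
      using w0 B by (intro integrable_stationary[OF r stat, where C = B]) auto
    moreover have "\<bar>measure_pmf.expectation arrival_type (\<lambda>j. \<phi> (pos s j) j)\<bar> \<le> B" if v: "valid s" for s
    proof (rule expectation_arrival_type_le)
      fix j assume j: "j \<in> I"
      have "\<phi> (pos s j) j \<le> wsum \<phi> (arrive s j)" using wsum_arrive[OF v j] w0[OF v] by simp
      then show "\<bar>\<phi> (pos s j) j\<bar> \<le> B" using B[OF valid_arrive[OF v j]] nn[OF j] by auto
    qed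
    then have "integrable (measure_pmf \<pi>) (\<lambda>s. measure_pmf.expectation arrival_type (\<lambda>j. \<phi> (pos s j) j))"
      by (intro integrable_stationary[OF r stat, where C = B])
    ultimately show ?thesis by simp
  qed
  finally show ?thesis by simp
qed

section \<open>Events that matter to the left of a level, and hole counts\<close>

lemma depart_far:
  assumes s: "valid s" and i: "i \<in> I" and a: "(y, j) \<in> s" and far: "x \<le> lend s y"
  shows "ends (s - {(y, j)}) \<inter> {..<x} = ends s \<inter> {..<x}"
    and "holes i (s - {(y, j)}) \<inter> {..<x} = holes i s \<inter> {..<x}"
    and "x \<le> y"
proof -
  note it = valid_item[OF s a] and l = lend(2)[OF s valid_item(2)[OF s a]]
  show "ends (s - {(y, j)}) \<inter> {..<x} = ends s \<inter> {..<x}"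
    using far l it by (auto simp: ends_depart[OF s a])
  show "holes i (s - {(y, j)}) \<inter> {..<x} = holes i s \<inter> {..<x}"
    using far l it by (auto simp: holes_depart[OF s i a])
  show "x \<le> y" using far l by simp
qed

text \<open>The condition is on \<open>lend\<close> and not on the start of the item: the first item
  starting beyond \<open>x\<close> may still close a gap that begins below \<open>x\<close>.\<close>

definition near :: "real \<Rightarrow> packing \<Rightarrow> packing" where
  "near x s = {(y, j) \<in> s. lend s y < x}"

lemma card_near_le:
  assumes s: "valid s" and x: "0 \<le> x"
  shows "real (card (near x s)) \<le> x / \<alpha> 1 + 1"
proof -
  have inj: "inj_on (\<lambda>(y, j). lend s y) (near x s)"
  proof (rule inj_onI, clarsimp simp: near_def)
    fix y j z k assume "(y, j) \<in> s" "(z, k) \<in> s" "lend s y = lend s z"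
    then show "y = z \<and> j = k" using lend_inj[OF s] by blast
  qed
  have "lend s y \<in> ends s \<and> 0 \<le> lend s y" if "(y, j) \<in> s" for y j
    using lend(1)[OF s valid_item(2)[OF s that]] ends_nonneg[OF s] by blast
  then have "(\<lambda>(y, j). lend s y) ` near x s \<subseteq> ends s \<inter> {0..<x}"
    by (auto simp: near_def)
  then have "card ((\<lambda>(y, j). lend s y) ` near x s) \<le> card (ends s \<inter> {0..<x})"
    using ends_finite[OF s] by (intro card_mono) auto
  also have "real (card (ends s \<inter> {0..<x})) \<le> (x - 0) / \<alpha> 1 + 1"
    by (rule card_ends_le[OF s x])
  finally show ?thesis using card_image[OF inj] by simp
qed

text \<open>Supplies the departure bound \<open>K\<close> of \<open>stationary_drift\<close> for a
  function that looks only to the left of \<open>x\<close>.\<close>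

lemma local_change_le:
  fixes f :: "packing \<Rightarrow> real"
  assumes s: "valid s" and x: "0 \<le> x"
    and loc: "\<And>y j. (y, j) \<in> s \<Longrightarrow> x \<le> lend s y \<Longrightarrow> f (s - {(y, j)}) = f s"
    and c: "\<And>y j. (y, j) \<in> s \<Longrightarrow> lend s y < x \<Longrightarrow> \<bar>f (s - {(y, j)}) - f s\<bar> \<le> c" "0 \<le> c"
  shows "(\<Sum>a\<in>s. \<bar>f (s - {a}) - f s\<bar>) \<le> c * (x / \<alpha> 1 + 1)"
proof -
  have "(\<Sum>a\<in>s. \<bar>f (s - {a}) - f s\<bar>) = (\<Sum>a\<in>near x s. \<bar>f (s - {a}) - f s\<bar>)"
    using valid_finite[OF s] loc by (intro sum.mono_neutral_right) (auto simp: near_def, meson not_le)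
  also have "\<dots> \<le> (\<Sum>a\<in>near x s. c)"
    using c by (intro sum_mono) (auto simp: near_def)
  also have "\<dots> = c * real (card (near x s))" by simp
  also have "\<dots> \<le> c * (x / \<alpha> 1 + 1)"
    using c(2) card_near_le[OF s x] by (rule mult_left_mono[rotated])
  finally show ?thesis .
qed

definition hcount :: "nat \<Rightarrow> real set \<Rightarrow> packing \<Rightarrow> nat" where
  "hcount i V s = card (holes i s \<inter> V)"

lemma hcount_arrive:
  assumes s: "valid s" and i: "i \<in> I" and j: "j \<in> I"
  shows "real (hcount i V (arrive s j)) = real (hcount i V s)
    - of_bool (pos s j \<in> holes i s \<and> pos s j \<in> V)
    + of_bool (fits \<alpha> s i (pos s j + \<alpha> j) \<and> pos s j + \<alpha> j \<in> V)"
proof -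
  let ?u = "pos s j" and ?v = "pos s j + \<alpha> j" and ?H = "holes i s"
  have fin: "finite ?H" by (rule finite_holes[OF s])
  have v: "?v \<notin> ?H" using arrive_new_end[OF s j] by (simp add: holes_def)
  have "real (card ((?H - {?u}) \<inter> V)) = real (card (?H \<inter> V)) - of_bool (?u \<in> ?H \<and> ?u \<in> V)"
  proof -
    have e: "(?H - {?u}) \<inter> V = ?H \<inter> V - {?u}" by auto
    show ?thesis
      unfolding e using fin card_gt_0_iff[of "?H \<inter> V"]
      by (cases "?u \<in> ?H \<inter> V") (auto simp: card_Diff_singleton Suc_le_eq of_nat_diff)
  qed
  moreover have "real (card ((?H - {?u} \<union> (if fits \<alpha> s i ?v then {?v} else {})) \<inter> V))
      = real (card ((?H - {?u}) \<inter> V)) + of_bool (fits \<alpha> s i ?v \<and> ?v \<in> V)"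
  proof (cases "fits \<alpha> s i ?v \<and> ?v \<in> V")
    case True
    then have "(?H - {?u} \<union> (if fits \<alpha> s i ?v then {?v} else {})) \<inter> V = insert ?v ((?H - {?u}) \<inter> V)" by auto
    then show ?thesis using True v fin by simp
  next
    case False
    then have "(?H - {?u} \<union> (if fits \<alpha> s i ?v then {?v} else {})) \<inter> V = (?H - {?u}) \<inter> V" by auto
    then show ?thesis using False by auto
  qed
  ultimately show ?thesis unfolding hcount_def holes_arrive[OF s i j] by simp
qed

lemma hcount_depart:
  assumes s: "valid s" and i: "i \<in> I" and a: "(y, j) \<in> s"
  shows "real (hcount i V (s - {(y, j)})) = real (hcount i V s)
    - of_bool (y + \<alpha> j \<in> holes i s \<and> y + \<alpha> j \<in> V)
    - of_bool (lend s y \<in> holes i s \<and> lend s y \<in> V)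
    + of_bool (fits \<alpha> (s - {(y, j)}) i (lend s y) \<and> lend s y \<in> V)"
proof -
  let ?e = "y + \<alpha> j" and ?l = "lend s y" and ?H = "holes i s"
  let ?c = "fits \<alpha> (s - {(y, j)}) i ?l"
  have fin: "finite ?H" by (rule finite_holes[OF s])
  have ne: "?e \<noteq> ?l" using lend(2)[OF s valid_item(2)[OF s a]] valid_item(3)[OF s a] by auto
  have "real (card ((?H - {?e, ?l}) \<inter> V)) =
      real (card (?H \<inter> V)) - of_bool (?e \<in> ?H \<and> ?e \<in> V) - of_bool (?l \<in> ?H \<and> ?l \<in> V)"
  proof -
    have e: "(?H - {?e, ?l}) \<inter> V = ?H \<inter> V - ({?e, ?l} \<inter> (?H \<inter> V))" by auto
    have "real (card (?H \<inter> V - ({?e, ?l} \<inter> (?H \<inter> V)))) = real (card (?H \<inter> V)) - real (card ({?e, ?l} \<inter> (?H \<inter> V)))"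
    proof -
      have "card ({?e, ?l} \<inter> (?H \<inter> V)) \<le> card (?H \<inter> V)" using fin by (intro card_mono) auto
      moreover have "card (?H \<inter> V - ({?e, ?l} \<inter> (?H \<inter> V))) = card (?H \<inter> V) - card ({?e, ?l} \<inter> (?H \<inter> V))"
        by (rule card_Diff_subset) auto
      ultimately show ?thesis by (simp add: of_nat_diff)
    qed
    moreover have "real (card ({?e, ?l} \<inter> (?H \<inter> V))) = of_bool (?e \<in> ?H \<and> ?e \<in> V) + of_bool (?l \<in> ?H \<and> ?l \<in> V)"
      using ne by (cases "?e \<in> ?H \<and> ?e \<in> V"; cases "?l \<in> ?H \<and> ?l \<in> V") (auto simp: Int_insert_left)
    ultimately show ?thesis unfolding e by simp
  qed
  moreover have "real (card ((?H - {?e, ?l} \<union> (if ?c then {?l} else {})) \<inter> V))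
      = real (card ((?H - {?e, ?l}) \<inter> V)) + of_bool (?c \<and> ?l \<in> V)"
  proof (cases "?c \<and> ?l \<in> V")
    case True
    then have "(?H - {?e, ?l} \<union> (if ?c then {?l} else {})) \<inter> V = insert ?l ((?H - {?e, ?l}) \<inter> V)" by auto
    then show ?thesis using True fin by simp
  next
    case False
    then have "(?H - {?e, ?l} \<union> (if ?c then {?l} else {})) \<inter> V = (?H - {?e, ?l}) \<inter> V" by auto
    then show ?thesis using False by auto
  qed
  ultimately show ?thesis unfolding hcount_def holes_depart[OF s i a] by simp
qed

lemma inj_on_lend: "valid s \<Longrightarrow> inj_on (\<lambda>(y, j). lend s y) s"
proof (rule inj_onI)
  fix a b assume "valid s" "a \<in> s" "b \<in> s" "(case a of (y, j) \<Rightarrow> lend s y) = (case b of (y, j) \<Rightarrow> lend s y)"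
  then show "a = b" using lend_inj[of s "fst a" "snd a" "fst b" "snd b"] by (cases a; cases b) auto
qed

lemma inj_on_end: "valid s \<Longrightarrow> inj_on (\<lambda>(y, j). y + \<alpha> j) s"
proof (rule inj_onI)
  fix a b assume "valid s" "a \<in> s" "b \<in> s" "(case a of (y, j) \<Rightarrow> y + \<alpha> j) = (case b of (y, j) \<Rightarrow> y + \<alpha> j)"
  then show "a = b" using end_inj[of s "fst a" "snd a" "fst b" "snd b"] by (cases a; cases b) auto
qed

lemma fits_of_hole: "u \<in> holes i s \<Longrightarrow> fits \<alpha> s i u"
  by (simp add: holes_def)

lemma pos_large_in_holes:
  assumes "valid s" "i \<in> I" "j \<in> I" "i \<le> j"
  shows "pos s j \<in> holes i s"
proof -
  have "fits \<alpha> s i (pos s j)"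
    using pos_fits[OF assms(1,3)] size_mono[OF assms(2,3,4)]
    by (fastforce simp: fits_iff[OF assms(1,2)] fits_iff[OF assms(1,3)])
  then show ?thesis using pos_in_ends[OF assms(1,3)] by (simp add: holes_def)
qed

end

section \<open>Balance of big items and holes\<close>

text \<open>One type and one level are fixed. In the end the level will be
  \<open>r * beta j\<close>, \<open>r * beta0 i\<close> or slightly less than
  \<open>r * beta i\<close>.\<close>

locale stationary_first_fit = first_fit_model +
  fixes r :: real and \<pi> :: "packing pmf" and i :: nat and x :: real
  assumes r_pos: "0 < r" and stat: "stationary_distribution (first_fit_rate I \<alpha> p r) {} \<pi>"
    and i_type: "i \<in> I" and x_nonneg: "0 \<le> x"
begin

abbreviation E :: "(packing \<Rightarrow> real) \<Rightarrow> real" where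
  "E f \<equiv> measure_pmf.expectation \<pi> f"

abbreviation ET :: "(nat \<Rightarrow> real) \<Rightarrow> real" where
  "ET g \<equiv> measure_pmf.expectation arrival_type g"

text \<open>Bounds the number of item ends below \<open>x\<close>, of items starting there and of
  departures that matter there; it will be of order \<open>r\<close>.\<close>

definition M :: real where "M = x / \<alpha> 1 + 1"

definition nh :: "packing \<Rightarrow> nat" where "nh s = hcount i {..<x} s"

definition nb :: "packing \<Rightarrow> real" where
  "nb = wsum (\<lambda>y j. of_bool (y < x \<and> i \<le> j))"

definition small_fill :: "packing \<Rightarrow> nat \<Rightarrow> real" where
  "small_fill s j = of_bool (j < i \<and> pos s j \<in> holes i s \<and> pos s j < x)"

text \<open>
  An arriving item of type \<open>\<ge> i\<close> always lands in a hole, so it preserves \<open>nb + nh\<close> unless an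
  \<open>i\<close>-item fits right behind it.
\<close>

definition nonkill :: "packing \<Rightarrow> nat \<Rightarrow> real" where
  "nonkill s j = of_bool (i \<le> j \<and> pos s j + \<alpha> j < x \<and> fits \<alpha> s i (pos s j + \<alpha> j))"

definition lhole :: "packing \<Rightarrow> real \<times> nat \<Rightarrow> real" where
  "lhole s = (\<lambda>(y, j). of_bool (lend s y \<in> holes i s \<and> lend s y < x))"

definition rhole :: "packing \<Rightarrow> real \<times> nat \<Rightarrow> real" where
  "rhole s = (\<lambda>(y, j). of_bool (y + \<alpha> j \<in> holes i s \<and> y + \<alpha> j < x))"

lemma M_ge_1: "1 \<le> M" using x_nonneg first_size_pos by (simp add: M_def)

lemma integrable_E: "(\<And>s. valid s \<Longrightarrow> \<bar>f s\<bar> \<le> C) \<Longrightarrow> integrable (measure_pmf \<pi>) (f :: packing \<Rightarrow> real)"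
  by (rule integrable_stationary[OF r_pos stat])

lemma E_mono:
  assumes "\<And>s. valid s \<Longrightarrow> f s \<le> g s" "\<And>s. valid s \<Longrightarrow> \<bar>f s\<bar> \<le> C" "\<And>s. valid s \<Longrightarrow> \<bar>g s\<bar> \<le> C'"
  shows "E f \<le> E g"
  using assms by (intro integral_mono_AE integrable_E[of f C] integrable_E[of g C'] AE_stationary[OF r_pos stat]) auto

lemma E_nonneg: "(\<And>s. valid s \<Longrightarrow> 0 \<le> f s) \<Longrightarrow> 0 \<le> E f"
  by (intro integral_nonneg_AE AE_stationary[OF r_pos stat])

lemma E_cong: "(\<And>s. valid s \<Longrightarrow> f s = g s) \<Longrightarrow> E f = E g"
  by (intro integral_cong_AE AE_stationary[OF r_pos stat]) auto

lemma nh_le_M: "valid s \<Longrightarrow> real (nh s) \<le> M"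
proof -
  assume s: "valid s"
  have "nh s \<le> card (ends s \<inter> {0..<x})"
    unfolding nh_def hcount_def using ends_finite[OF s] ends_nonneg[OF s]
    by (intro card_mono) (auto simp: holes_def)
  then show ?thesis using card_ends_le[OF s x_nonneg] by (simp add: M_def)
qed

lemma nb_bounds: "valid s \<Longrightarrow> 0 \<le> nb s" "valid s \<Longrightarrow> nb s \<le> M"
proof -
  assume s: "valid s"
  show "0 \<le> nb s" unfolding nb_def by (rule wsum_nonneg) simp
  have "nb s \<le> wsum (\<lambda>y j. of_bool (0 \<le> y \<and> y < x)) s"
    unfolding nb_def using valid_item(2)[OF s] by (intro wsum_mono) auto
  also have "\<dots> \<le> M" using wsum_count_le[OF s x_nonneg] by (simp add: M_def)
  finally show "nb s \<le> M" .
qed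

lemma nb_arrive: "valid s \<Longrightarrow> j \<in> I \<Longrightarrow> nb (arrive s j) = nb s + of_bool (pos s j < x \<and> i \<le> j)"
  by (simp add: nb_def wsum_arrive)

lemma nb_depart: "valid s \<Longrightarrow> (y, j) \<in> s \<Longrightarrow> nb (s - {(y, j)}) = nb s - of_bool (y < x \<and> i \<le> j)"
  by (simp add: nb_def wsum_depart)

lemma nh_arrive_large:
  assumes s: "valid s" and j: "j \<in> I" "i \<le> j"
  shows "real (nh (arrive s j)) = real (nh s) - of_bool (pos s j < x) + nonkill s j"
  unfolding nh_def hcount_arrive[OF s i_type j(1)] nonkill_def
  using pos_large_in_holes[OF s i_type j] j by (auto simp: of_bool_def)

text \<open>By \<open>arrive_not_hole\<close>, a small item whose end becomes a hole has filled a
  hole itself, so small arrivals never increase the number of holes.\<close>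

lemma nh_arrive_small:
  assumes s: "valid s" and j: "j \<in> I" "j < i"
  shows "real (nh (arrive s j)) = real (nh s) - small_fill s j
     + of_bool (fits \<alpha> s i (pos s j + \<alpha> j) \<and> pos s j + \<alpha> j < x)"
    and "fits \<alpha> s i (pos s j + \<alpha> j) \<Longrightarrow> pos s j + \<alpha> j < x \<Longrightarrow> small_fill s j = 1"
proof -
  show "real (nh (arrive s j)) = real (nh s) - small_fill s j
     + of_bool (fits \<alpha> s i (pos s j + \<alpha> j) \<and> pos s j + \<alpha> j < x)"
    unfolding nh_def hcount_arrive[OF s i_type j(1)] small_fill_def
    using j by (auto simp: of_bool_def)
  assume "fits \<alpha> s i (pos s j + \<alpha> j)" "pos s j + \<alpha> j < x"
  then show "small_fill s j = 1"
    using arrive_not_hole[OF s i_type j(1)] j sizes_pos[OF j(1)] by (force simp: small_fill_def)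
qed

lemma nh_depart:
  assumes s: "valid s" and a: "(y, j) \<in> s"
  shows "real (nh (s - {(y, j)})) = real (nh s) - rhole s (y, j) - lhole s (y, j)
     + of_bool (fits \<alpha> (s - {(y, j)}) i (lend s y) \<and> lend s y < x)"
  unfolding nh_def hcount_depart[OF s i_type a] rhole_def lhole_def by simp

lemma lhole_le:
  assumes "valid s"
  shows "lhole s (y, j) \<le> of_bool (fits \<alpha> (s - {(y, j)}) i (lend s y) \<and> lend s y < x)"
  using fits_depart_mono[OF fits_of_hole] by (auto simp: lhole_def)

text \<open>By injectivity of \<open>lend\<close>, a hole is the beginning of the gap in front of at
  most one item.\<close>

lemma sum_lhole_le:
  assumes s: "valid s"
  shows "(\<Sum>a\<in>s. lhole s a) \<le> real (nh s)"
proof -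
  let ?A = "{(y, j) \<in> s. lend s y \<in> holes i s \<and> lend s y < x}"
  have fin: "finite s" by (rule valid_finite[OF s])
  have inj: "inj_on (\<lambda>(y, j). lend s y) ?A"
    using inj_on_lend[OF s] by (rule inj_on_subset) auto
  have "(\<Sum>a\<in>s. lhole s a) = (\<Sum>a\<in>?A. 1)"
    using fin by (intro sum.mono_neutral_cong_right) (auto simp: lhole_def)
  also have "\<dots> = real (card ((\<lambda>(y, j). lend s y) ` ?A))" using card_image[OF inj] by simp
  also have "card ((\<lambda>(y, j). lend s y) ` ?A) \<le> nh s"
    unfolding nh_def hcount_def using finite_holes[OF s] by (intro card_mono) auto
  finally show ?thesis by simp
qed

lemma sum_rhole_le:
  assumes s: "valid s"
  shows "(\<Sum>a\<in>s. rhole s a) \<le> real (nh s)"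
proof -
  let ?A = "{(y, j) \<in> s. y + \<alpha> j \<in> holes i s \<and> y + \<alpha> j < x}"
  have fin: "finite s" by (rule valid_finite[OF s])
  have inj: "inj_on (\<lambda>(y, j). y + \<alpha> j) ?A"
    using inj_on_end[OF s] by (rule inj_on_subset) auto
  have "(\<Sum>a\<in>s. rhole s a) = (\<Sum>a\<in>?A. 1)"
    using fin by (intro sum.mono_neutral_cong_right) (auto simp: rhole_def)
  also have "\<dots> = real (card ((\<lambda>(y, j). y + \<alpha> j) ` ?A))" using card_image[OF inj] by simp
  also have "card ((\<lambda>(y, j). y + \<alpha> j) ` ?A) \<le> nh s"
    unfolding nh_def hcount_def using finite_holes[OF s] by (intro card_mono) auto
  finally show ?thesis by simp
qed

lemma nh_far:
  assumes "valid s" "(y, j) \<in> s" "x \<le> lend s y"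
  shows "nh (s - {(y, j)}) = nh s" "nb (s - {(y, j)}) = nb s"
  using depart_far[OF assms(1) i_type assms(2,3)] nb_depart[OF assms(1,2)]
  by (auto simp: nh_def hcount_def)

lemma nh_change_le:
  assumes s: "valid s"
  shows "j \<in> I \<Longrightarrow> \<bar>real (nh (arrive s j)) - real (nh s)\<bar> \<le> 1"
    and "(y, j) \<in> s \<Longrightarrow> \<bar>real (nh (s - {(y, j)})) - real (nh s)\<bar> \<le> 1"
proof -
  assume j: "j \<in> I"
  show "\<bar>real (nh (arrive s j)) - real (nh s)\<bar> \<le> 1"
    unfolding nh_def hcount_arrive[OF s i_type j] by (auto simp: of_bool_def)
next
  assume a: "(y, j) \<in> s"
  have "rhole s (y, j) \<le> of_bool (fits \<alpha> (s - {(y, j)}) i (lend s y) \<and> lend s y < x)"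
    using fits_depart_next_hole[OF s i_type a] lend(2)[OF s valid_item(2)[OF s a]] valid_item(3)[OF s a]
    by (auto simp: rhole_def)
  moreover have "0 \<le> rhole s (y, j)" "rhole s (y, j) \<le> 1" "0 \<le> lhole s (y, j)"
    by (auto simp: rhole_def lhole_def)
  moreover note lhole_le[OF s, of y j]
  ultimately show "\<bar>real (nh (s - {(y, j)})) - real (nh s)\<bar> \<le> 1"
    unfolding nh_depart[OF s a] by (auto simp: of_bool_def)
qed

lemma E_drift:
  assumes B: "\<And>s. valid s \<Longrightarrow> \<bar>f s\<bar> \<le> B"
    and loc: "\<And>s y j. valid s \<Longrightarrow> (y, j) \<in> s \<Longrightarrow> x \<le> lend s y \<Longrightarrow> f (s - {(y, j)}) = f s"
  shows "E (drift r f) = 0" "\<And>s. valid s \<Longrightarrow> \<bar>drift r f s\<bar> \<le> 2 * B * r + 2 * B * M"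
proof -
  have B0: "0 \<le> B" using B[OF valid_empty] by auto
  have K: "(\<Sum>a\<in>s. \<bar>f (s - {a}) - f s\<bar>) \<le> 2 * B * M" if s: "valid s" for s
    unfolding M_def
  proof (rule local_change_le[OF s x_nonneg loc[OF s]])
    fix y j assume "(y, j) \<in> s"
    show "\<bar>f (s - {(y, j)}) - f s\<bar> \<le> 2 * B" using B[OF s] B[OF valid_depart[OF s], of "(y, j)"] by linarith
  qed (use B0 in auto)
  show "E (drift r f) = 0" by (rule stationary_drift[OF r_pos stat B K])
  show "\<bar>drift r f s\<bar> \<le> 2 * B * r + 2 * B * M" if "valid s" for s
    using drift_bound[OF B r_pos that K[OF that]] .
qed

definition d_rate :: "packing \<Rightarrow> real" where "d_rate s = r * ET (small_fill s)"

definition J_rate :: "packing \<Rightarrow> real" where "J_rate s = r * ET (nonkill s)"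

text \<open>A big arrival turns a hole into an item and a big departure turns an item into a hole,
  so this sum is nearly conserved.\<close>

definition nu :: "packing \<Rightarrow> real" where "nu s = nb s + real (nh s)"

lemma ET_small_fill: "0 \<le> ET (small_fill s)" "ET (small_fill s) \<le> 1"
  and ET_nonkill: "0 \<le> ET (nonkill s)" "ET (nonkill s) \<le> 1"
  and int_small_fill: "integrable (measure_pmf arrival_type) (small_fill s)"
  and int_nonkill: "integrable (measure_pmf arrival_type) (nonkill s)"
proof -
  have "\<bar>ET (small_fill s)\<bar> \<le> 1" "\<bar>ET (nonkill s)\<bar> \<le> 1"
    by (rule expectation_arrival_type_le, simp add: small_fill_def nonkill_def)+
  then show "ET (small_fill s) \<le> 1" "ET (nonkill s) \<le> 1" by auto
  show "0 \<le> ET (small_fill s)" "0 \<le> ET (nonkill s)"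
    by (simp_all add: small_fill_def nonkill_def)
  show "integrable (measure_pmf arrival_type) (small_fill s)" "integrable (measure_pmf arrival_type) (nonkill s)"
    by (rule integrable_arrival_type[where C = 1], simp add: small_fill_def nonkill_def)+
qed

lemma rate_bounds: "0 \<le> d_rate s" "d_rate s \<le> r" "0 \<le> J_rate s" "J_rate s \<le> r"
  unfolding d_rate_def J_rate_def using ET_small_fill[of s] ET_nonkill[of s] r_pos by (auto simp: mult_left_le)

lemma integrable_change:
  assumes f: "\<And>s. valid s \<Longrightarrow> \<bar>f s\<bar> \<le> B" and s: "valid s"
  shows "integrable (measure_pmf arrival_type) (\<lambda>j. f (arrive s j) - f s :: real)"
proof (rule integrable_arrival_type)
  fix j assume "j \<in> I"
  then show "\<bar>f (arrive s j) - f s\<bar> \<le> 2 * B"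
    using f[OF s] f[OF valid_arrive[OF s, of j]] by linarith
qed

lemma nu_bounds: "valid s \<Longrightarrow> \<bar>nu s\<bar> \<le> 2 * M"
  using nh_le_M nb_bounds by (force simp: nu_def)

text \<open>Losses come only from small items filling holes and from departures next to a hole,
  where gaps merge; each hole has at most one neighbouring item on either side, whence
  \<open>2 * real (nh s)\<close>. The gains from \<open>nonkill\<close> are kept, because their mean
  rate is to be bounded.\<close>

lemma drift_nu_ge:
  assumes s: "valid s"
  shows "J_rate s - d_rate s - 2 * real (nh s) \<le> drift r nu s"
proof -
  have "ET (nonkill s) - ET (small_fill s) = ET (\<lambda>j. nonkill s j - small_fill s j)"
    using int_small_fill int_nonkill by simp
  also have "\<dots> \<le> ET (\<lambda>j. nu (arrive s j) - nu s)"
  proof (intro integral_mono_AE AE_arrival_type)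
    fix j assume j: "j \<in> I"
    show "nonkill s j - small_fill s j \<le> nu (arrive s j) - nu s"
    proof (cases "i \<le> j")
      case True
      then show ?thesis
        using nh_arrive_large[OF s j True] by (simp add: nu_def nb_arrive[OF s j] small_fill_def)
    next
      case False
      then show ?thesis
        using nh_arrive_small(1)[OF s j] by (simp add: nu_def nb_arrive[OF s j] nonkill_def)
    qed
  next
    show "integrable (measure_pmf arrival_type) (\<lambda>j. nu (arrive s j) - nu s)"
      by (rule integrable_change[OF nu_bounds s])
  qed (use int_small_fill int_nonkill in auto)
  finally have 1: "r * (ET (nonkill s) - ET (small_fill s)) \<le> r * ET (\<lambda>j. nu (arrive s j) - nu s)"
    using r_pos by simp
  have "- (\<Sum>a\<in>s. lhole s a) - (\<Sum>a\<in>s. rhole s a) = (\<Sum>a\<in>s. - lhole s a - rhole s a)"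
    by (simp add: sum_subtractf sum_negf)
  also have "\<dots> \<le> (\<Sum>a\<in>s. nu (s - {a}) - nu s)"
  proof (rule sum_mono)
    fix a assume a: "a \<in> s"
    obtain y j where [simp]: "a = (y, j)" by (cases a)
    have a': "(y, j) \<in> s" using a by simp
    note l = lend(2)[OF s valid_item(2)[OF s a']]
    show "- lhole s a - rhole s a \<le> nu (s - {a}) - nu s"
    proof (cases "y < x \<and> i \<le> j")
      case True
      then have "fits \<alpha> (s - {(y, j)}) i (lend s y) \<and> lend s y < x"
        using fits_depart_large[OF s i_type a'] l by auto
      then show ?thesis using True nh_depart[OF s a'] nb_depart[OF s a'] by (simp add: nu_def)
    next
      case False
      then have "nb (s - {(y, j)}) = nb s" using nb_depart[OF s a'] by auto
      moreover have "real (nh (s - {(y, j)})) \<ge> real (nh s) - rhole s (y, j) - lhole s (y, j)"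
        unfolding nh_depart[OF s a'] by simp
      ultimately show ?thesis by (simp add: nu_def)
    qed
  qed
  finally show ?thesis
    using 1 sum_lhole_le[OF s] sum_rhole_le[OF s] unfolding drift_def J_rate_def d_rate_def
    by (simp add: algebra_simps)
qed

lemma E_drift_nu: "E (drift r nu) = 0" "\<exists>C. \<forall>s. valid s \<longrightarrow> \<bar>drift r nu s\<bar> \<le> C"
proof -
  have loc: "nu (s - {(y, j)}) = nu s" if "valid s" "(y, j) \<in> s" "x \<le> lend s y" for s y j
    using nh_far[OF that] by (simp add: nu_def)
  show "E (drift r nu) = 0" "\<exists>C. \<forall>s. valid s \<longrightarrow> \<bar>drift r nu s\<bar> \<le> C"
    using E_drift[OF nu_bounds loc] by blast+
qed

lemma int_basic:
  "integrable (measure_pmf \<pi>) J_rate" "integrable (measure_pmf \<pi>) d_rate"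
  "integrable (measure_pmf \<pi>) (\<lambda>s. real (nh s))" "integrable (measure_pmf \<pi>) nb"
  "integrable (measure_pmf \<pi>) (drift r nu)"
  subgoal using rate_bounds by (intro integrable_E[where C = r]) auto
  subgoal using rate_bounds by (intro integrable_E[where C = r]) auto
  subgoal using nh_le_M by (intro integrable_E[where C = M]) auto
  subgoal using nb_bounds by (intro integrable_E[where C = M]) auto
  subgoal using E_drift_nu(2) integrable_E by blast
  done

lemma E_J_le: "E J_rate \<le> E d_rate + 2 * E (\<lambda>s. real (nh s))"
proof -
  have "E (\<lambda>s. J_rate s - d_rate s - 2 * real (nh s)) \<le> E (drift r nu)"
    using drift_nu_ge int_basic
    by (intro integral_mono_AE AE_stationary[OF r_pos stat]) auto
  then show ?thesis using E_drift_nu int_basic by simp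
qed

text \<open>If \<open>X\<close> has mean zero and is at least \<open>- c\<close> with
  \<open>c\<close> nonnegative, then \<open>\<bar>X\<bar> \<le> X + 2 * c\<close>, so the mean of
  its absolute value is at most twice that of \<open>c\<close>.\<close>

lemma E_abs_drift_nu_le: "E (\<lambda>s. \<bar>drift r nu s\<bar>) \<le> 2 * (E d_rate + 2 * E (\<lambda>s. real (nh s)))"
proof -
  have "E (\<lambda>s. \<bar>drift r nu s\<bar>) \<le> E (\<lambda>s. drift r nu s + 2 * (d_rate s + 2 * real (nh s)))"
  proof (intro integral_mono_AE AE_stationary[OF r_pos stat])
    fix s assume "valid s"
    then show "\<bar>drift r nu s\<bar> \<le> drift r nu s + 2 * (d_rate s + 2 * real (nh s))"
      using drift_nu_ge[of s] rate_bounds[of s] by (simp add: abs_le_iff)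
  qed (use int_basic in auto)
  also have "\<dots> = 2 * (E d_rate + 2 * E (\<lambda>s. real (nh s)))"
    using E_drift_nu int_basic by simp
  finally show ?thesis .
qed

section \<open>Scarcity of holes\<close>

lemma drift_nb_bound: "\<exists>C. \<forall>s. valid s \<longrightarrow> \<bar>drift r nb s\<bar> \<le> C"
proof -
  have "\<And>s. valid s \<Longrightarrow> \<bar>nb s\<bar> \<le> M" using nb_bounds by auto
  from E_drift(2)[OF this nh_far(2)] show ?thesis by blast
qed

lemma drift_nu_split:
  assumes s: "valid s"
  shows "drift r nu s = drift r nb s + drift r (\<lambda>s. real (nh s)) s"
proof -
  have 1: "integrable (measure_pmf arrival_type) (\<lambda>j. nb (arrive s j) - nb s)"
    using nb_bounds by (intro integrable_change[where B = M] s) auto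
  have 2: "integrable (measure_pmf arrival_type) (\<lambda>j. real (nh (arrive s j)) - real (nh s))"
    using nh_le_M by (intro integrable_change[where B = M] s) auto
  have "ET (\<lambda>j. nu (arrive s j) - nu s) = ET (\<lambda>j. (nb (arrive s j) - nb s) + (real (nh (arrive s j)) - real (nh s)))"
    by (simp add: nu_def algebra_simps)
  also have "\<dots> = ET (\<lambda>j. nb (arrive s j) - nb s) + ET (\<lambda>j. real (nh (arrive s j)) - real (nh s))"
    using 1 2 by (rule Bochner_Integration.integral_add)
  finally have *: "ET (\<lambda>j. nu (arrive s j) - nu s) = ET (\<lambda>j. nb (arrive s j) - nb s) + ET (\<lambda>j. real (nh (arrive s j)) - real (nh s))" .
  have "(\<Sum>a\<in>s. nu (s - {a}) - nu s) = (\<Sum>a\<in>s. nb (s - {a}) - nb s) + (\<Sum>a\<in>s. real (nh (s - {a})) - real (nh s))"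
    unfolding sum.distrib[symmetric] by (intro sum.cong) (auto simp: nu_def)
  then show ?thesis unfolding drift_def * by (simp add: algebra_simps)
qed

text \<open>
  The product rule for \<open>drift\<close> applied to \<open>n * nh\<close>: \<open>n\<close> changes on a slower time scale than the
  number of holes, so the hole process equilibrates given \<open>n\<close>.
\<close>

lemma E_slow_drift_nb_le:
  fixes n :: "packing \<Rightarrow> real"
  assumes n: "\<And>s. valid s \<Longrightarrow> 0 \<le> n s \<and> n s \<le> C" and c: "0 \<le> c"
    and loc: "\<And>s y j. valid s \<Longrightarrow> (y, j) \<in> s \<Longrightarrow> x \<le> lend s y \<Longrightarrow> n (s - {(y, j)}) = n s"
    and ca: "\<And>s j. valid s \<Longrightarrow> j \<in> I \<Longrightarrow> \<bar>n (arrive s j) - n s\<bar> \<le> c"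
    and cd: "\<And>s y j. valid s \<Longrightarrow> (y, j) \<in> s \<Longrightarrow> lend s y < x \<Longrightarrow> \<bar>n (s - {(y, j)}) - n s\<bar> \<le> c"
  shows "E (\<lambda>s. n s * drift r nb s) \<le> 2 * C * (E d_rate + 2 * E (\<lambda>s. real (nh s)))
      + c * (r + M) * (E (\<lambda>s. real (nh s)) + 1)"
proof -
  let ?h = "\<lambda>s. real (nh s)"
  let ?f = "\<lambda>s. n s * ?h s"
  have C0: "0 \<le> C" using n[OF valid_empty] by auto
  have fB: "\<bar>?f s\<bar> \<le> C * M" if "valid s" for s
    using n[OF that] nh_le_M[OF that] by (auto simp: abs_mult intro!: mult_mono)
  have floc: "?f (s - {(y, j)}) = ?f s" if "valid s" "(y, j) \<in> s" "x \<le> lend s y" for s y j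
    using loc[OF that] nh_far[OF that] by simp
  have Ef: "E (drift r ?f) = 0" by (rule E_drift(1)[OF fB floc])
  have fbd: "\<bar>drift r ?f s\<bar> \<le> 2 * (C * M) * r + 2 * (C * M) * M" if "valid s" for s
    by (rule E_drift(2)[OF fB floc that])
  obtain C1 where C1: "\<And>s. valid s \<Longrightarrow> \<bar>drift r nb s\<bar> \<le> C1" using drift_nb_bound by blast
  obtain C2 where C2: "\<And>s. valid s \<Longrightarrow> \<bar>drift r nu s\<bar> \<le> C2" using E_drift_nu(2) by blast
  \<comment> \<open>The drift of \<open>nb\<close> is that of \<open>nu\<close> minus that of
    \<open>nh\<close>, and \<open>n s\<close> times the drift of \<open>nh\<close> is the drift of
    the product \<open>n * nh\<close> up to terms in which \<open>n\<close> changes by at most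
    \<open>c\<close>.\<close>
  have pt: "n s * drift r nb s \<le> C * \<bar>drift r nu s\<bar> - drift r ?f s + c * (r + M) * (?h s + 1)"
    if s: "valid s" for s
  proof -
    have hb: "\<And>s. valid s \<Longrightarrow> \<bar>?h s\<bar> \<le> M" using nh_le_M by auto
    have i1: "integrable (measure_pmf arrival_type) (\<lambda>j. ?h (arrive s j) - ?h s)"
      by (rule integrable_change[OF hb s])
    have e1b: "\<bar>?h (arrive s j) * (n (arrive s j) - n s)\<bar> \<le> (?h s + 1) * c" if j: "j \<in> I" for j
      unfolding abs_mult using ca[OF s j] nh_change_le(1)[OF s j] by (intro mult_mono) auto
    then have i2: "integrable (measure_pmf arrival_type) (\<lambda>j. ?h (arrive s j) * (n (arrive s j) - n s))"
      by (rule integrable_arrival_type)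
    have "ET (\<lambda>j. ?f (arrive s j) - ?f s) = ET (\<lambda>j. n s * (?h (arrive s j) - ?h s) + ?h (arrive s j) * (n (arrive s j) - n s))"
      by (simp add: algebra_simps)
    also have "\<dots> = n s * ET (\<lambda>j. ?h (arrive s j) - ?h s) + ET (\<lambda>j. ?h (arrive s j) * (n (arrive s j) - n s))"
      using i1 i2 by (subst Bochner_Integration.integral_add) auto
    finally have a1: "ET (\<lambda>j. ?f (arrive s j) - ?f s) =
        n s * ET (\<lambda>j. ?h (arrive s j) - ?h s) + ET (\<lambda>j. ?h (arrive s j) * (n (arrive s j) - n s))" .
    have a2: "(\<Sum>a\<in>s. ?f (s - {a}) - ?f s) = n s * (\<Sum>a\<in>s. ?h (s - {a}) - ?h s) + (\<Sum>a\<in>s. ?h (s - {a}) * (n (s - {a}) - n s))"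
      unfolding sum_distrib_left sum.distrib[symmetric] by (intro sum.cong) (auto simp: algebra_simps)
    define e1 where "e1 = ET (\<lambda>j. ?h (arrive s j) * (n (arrive s j) - n s))"
    define e2 where "e2 = (\<Sum>a\<in>s. ?h (s - {a}) * (n (s - {a}) - n s))"
    have dr: "drift r ?f s = n s * drift r ?h s + (r * e1 + e2)"
      unfolding drift_def a1 a2 e1_def e2_def by (simp add: algebra_simps)
    have "\<bar>e1\<bar> \<le> (?h s + 1) * c" unfolding e1_def using e1b by (rule expectation_arrival_type_le)
    then have "\<bar>r * e1\<bar> \<le> r * ((?h s + 1) * c)" using r_pos by (simp add: abs_mult)
    moreover have "\<bar>e2\<bar> \<le> (?h s + 1) * c * M"
    proof -
      have "e2 = (\<Sum>a\<in>near x s. ?h (s - {a}) * (n (s - {a}) - n s))"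
        unfolding e2_def using valid_finite[OF s] loc[OF s]
        by (intro sum.mono_neutral_right) (auto simp: near_def, meson not_le)
      also have "\<bar>\<dots>\<bar> \<le> (\<Sum>a\<in>near x s. \<bar>?h (s - {a}) * (n (s - {a}) - n s)\<bar>)" by (rule sum_abs)
      also have "\<dots> \<le> (\<Sum>a\<in>near x s. (?h s + 1) * c)"
      proof (rule sum_mono)
        fix a assume "a \<in> near x s"
        then obtain y j where a: "a = (y, j)" "(y, j) \<in> s" "lend s y < x" by (auto simp: near_def)
        show "\<bar>?h (s - {a}) * (n (s - {a}) - n s)\<bar> \<le> (?h s + 1) * c"
          unfolding abs_mult a(1) using cd[OF s a(2,3)] nh_change_le(2)[OF s a(2)] by (intro mult_mono) auto
      qed
      also have "\<dots> = (?h s + 1) * c * real (card (near x s))" by simp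
      also have "\<dots> \<le> (?h s + 1) * c * M"
        unfolding M_def using card_near_le[OF s x_nonneg] c by (intro mult_left_mono) auto
      finally show ?thesis .
    qed
    ultimately have e: "r * e1 + e2 \<le> c * (r + M) * (?h s + 1)" by (simp add: algebra_simps abs_le_iff)
    have "n s * drift r nu s \<le> C * \<bar>drift r nu s\<bar>"
    proof -
      have "n s * drift r nu s \<le> n s * \<bar>drift r nu s\<bar>" using n[OF s] by (intro mult_left_mono) auto
      also have "\<dots> \<le> C * \<bar>drift r nu s\<bar>" using n[OF s] by (intro mult_right_mono) auto
      finally show ?thesis .
    qed
    then show ?thesis using e dr drift_nu_split[OF s] by (simp add: algebra_simps)
  qed
  have "E (\<lambda>s. n s * drift r nb s) \<le> E (\<lambda>s. C * \<bar>drift r nu s\<bar> - drift r ?f s + c * (r + M) * (?h s + 1))"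
  proof (intro integral_mono_AE AE_stationary[OF r_pos stat] pt)
    show "integrable (measure_pmf \<pi>) (\<lambda>s. n s * drift r nb s)"
      using n C1 C0 by (intro integrable_E[where C = "C * C1"]) (auto simp: abs_mult intro!: mult_mono)
    show "integrable (measure_pmf \<pi>) (\<lambda>s. C * \<bar>drift r nu s\<bar> - drift r ?f s + c * (r + M) * (?h s + 1))"
      using int_basic integrable_E[OF fbd] by auto
  qed
  also have "\<dots> = C * E (\<lambda>s. \<bar>drift r nu s\<bar>) - E (drift r ?f) + c * (r + M) * (E ?h + 1)"
    using int_basic integrable_E[OF fbd] by simp
  also have "\<dots> \<le> C * (2 * (E d_rate + 2 * E ?h)) + c * (r + M) * (E ?h + 1)"
    unfolding Ef using mult_left_mono[OF E_abs_drift_nu_le C0] by simp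
  finally show ?thesis by (simp add: algebra_simps)
qed

lemma drift_nb: "valid s \<Longrightarrow> drift r nb s = r * ET (\<lambda>j. of_bool (pos s j < x \<and> i \<le> j)) - nb s"
  unfolding nb_def by (rule drift_wsum)

lemma nh_pos_iff: "valid s \<Longrightarrow> 0 < nh s \<longleftrightarrow> pos s i < x"
proof -
  assume s: "valid s"
  have "0 < nh s \<longleftrightarrow> holes i s \<inter> {..<x} \<noteq> {}"
    unfolding nh_def hcount_def using finite_holes[OF s] by (simp add: card_gt_0_iff)
  also have "\<dots> \<longleftrightarrow> pos s i < x"
    using pos_in_holes[OF s i_type] pos_le[OF s i_type] by force
  finally show ?thesis .
qed

lemma ET_type: "ET (\<lambda>j. of_bool (j = i)) = p i"
proof -
  have "ET (\<lambda>j. of_bool (j = i)) = ET (indicator {i})"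
    by (intro Bochner_Integration.integral_cong) (auto simp: of_bool_def split: split_indicator)
  also have "\<dots> = p i" using i_type by (simp add: measure_pmf_single pmf_arrival_type)
  finally show ?thesis .
qed

text \<open>As soon as there is a hole below \<open>x\<close>, every arriving i-item starts below
  \<open>x\<close>.\<close>

lemma drift_nb_ge:
  assumes s: "valid s"
  shows "p i * r * of_bool (0 < nh s) - nb s \<le> drift r nb s"
proof -
  have "p i * of_bool (0 < nh s) = ET (\<lambda>j. of_bool (0 < nh s) * of_bool (j = i))"
    using ET_type by simp
  also have "\<dots> \<le> ET (\<lambda>j. of_bool (pos s j < x \<and> i \<le> j))"
    using nh_pos_iff[OF s]
    by (intro integral_mono_AE AE_arrival_type integrable_arrival_type[where C = 1]) auto
  finally show ?thesis using r_pos unfolding drift_nb[OF s] by (simp add: mult.commute mult.left_commute)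
qed

text \<open>A bounded substitute for the number \<open>n\<close> of holes: it grows nearly like
  \<open>n\<close> as long as \<open>n\<close> is small against \<open>1 / (1 - \<rho>)\<close> and
  saturates there.\<close>

definition geo :: "real \<Rightarrow> nat \<Rightarrow> real" where "geo \<rho> n = (\<Sum>k<n. \<rho> ^ k)"

lemma geo_facts:
  assumes "0 \<le> \<rho>" "\<rho> < 1"
  shows "0 \<le> geo \<rho> n" "geo \<rho> n \<le> 1 / (1 - \<rho>)" "real n * \<rho> ^ (n - 1) \<le> 1 / (1 - \<rho>)"
proof -
  show "0 \<le> geo \<rho> n" unfolding geo_def using assms by (intro sum_nonneg) auto
  have "geo \<rho> n = (1 - \<rho> ^ n) / (1 - \<rho>)" unfolding geo_def using assms by (simp add: sum_gp_strict)
  also have "\<dots> \<le> 1 / (1 - \<rho>)" using assms by (intro divide_right_mono) auto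
  finally show g: "geo \<rho> n \<le> 1 / (1 - \<rho>)" .
  have "(\<Sum>k<n. \<rho> ^ (n - 1)) \<le> geo \<rho> n"
    unfolding geo_def using assms by (intro sum_mono power_decreasing) auto
  then show "real n * \<rho> ^ (n - 1) \<le> 1 / (1 - \<rho>)" using g by simp
qed

lemma geo_Suc: "geo \<rho> (Suc n) = geo \<rho> n + \<rho> ^ n" by (simp add: geo_def)


lemma geo_mono: "0 \<le> \<rho> \<Longrightarrow> m \<le> n \<Longrightarrow> geo \<rho> m \<le> geo \<rho> n"
  unfolding geo_def by (intro sum_mono2) auto

lemma geo_drop:
  assumes "0 \<le> \<rho>" "real n - B \<le> real m" "B = 0 \<or> B = (1 :: real) \<and> 0 < n"
  shows "- B * \<rho> ^ (n - 1) \<le> geo \<rho> m - geo \<rho> n"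
proof (cases "n \<le> m")
  case True
  have "0 \<le> B * \<rho> ^ (n - 1)" using assms by auto
  then show ?thesis using geo_mono[OF assms(1) True] by simp
next
  case False
  then have "B = 1" "n = Suc m" using assms(2,3) by auto
  then show ?thesis by (simp add: geo_Suc)
qed

text \<open>\<open>A\<close> and \<open>B\<close> stand for \<open>lhole\<close> and
  \<open>rhole\<close>: a big departure creates one hole and may absorb an old one on either
  side.\<close>

lemma geo_depart:
  assumes "0 \<le> \<rho>" "\<rho> \<le> 1" and m: "real m = real n + 1 - A - B"
    and "A = 0 \<or> A = 1 \<and> 0 < n" "B = 0 \<or> B = 1 \<and> 0 < n"
  shows "\<rho> ^ n - (A + B) * \<rho> ^ (n - 1) \<le> geo \<rho> m - geo \<rho> n"
proof -
  have dec: "\<rho> ^ n \<le> \<rho> ^ (n - 1)" using assms by (intro power_decreasing) auto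
  consider "A + B = 0" "m = Suc n" | "A + B = 1" "m = n" | "A + B = 2" "n = Suc m"
    using m assms(4,5) by fastforce
  then show ?thesis using dec by cases (auto simp: geo_Suc)
qed

lemma lhole_cases: "valid s \<Longrightarrow> lhole s a = 0 \<or> lhole s a = 1 \<and> 0 < nh s"
  and rhole_cases: "valid s \<Longrightarrow> rhole s a = 0 \<or> rhole s a = 1 \<and> 0 < nh s"
  and small_fill_cases: "valid s \<Longrightarrow> small_fill s j = 0 \<or> small_fill s j = 1 \<and> 0 < nh s"
  unfolding nh_def hcount_def lhole_def rhole_def small_fill_def
  by (cases a; auto simp: card_gt_0_iff finite_holes)+

text \<open>
  The geometric discount bounds the contribution of the holes to \<open>nb + geo \<rho> nh\<close> by \<open>H\<close>, while a big
  item landing in one of many holes still raises this function by almost 1.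
\<close>

lemma E_hole_tail:
  assumes H: "1 \<le> H" and \<rho>: "\<rho> = 1 - 1 / H"
  shows "E (\<lambda>s. (1 - \<rho> ^ (nh s - 1)) * (p i * r - nb s)) \<le> M / H + 2 * H + E d_rate"
proof -
  have \<rho>01: "0 \<le> \<rho>" "\<rho> < 1" using H by (auto simp: \<rho>)
  have H1: "1 / (1 - \<rho>) = H" using H by (simp add: \<rho>)
  note geo = geo_facts[OF \<rho>01, unfolded H1]
  let ?f = "\<lambda>s. nb s + geo \<rho> (nh s)"
  have fB: "\<bar>?f s\<bar> \<le> M + H" if "valid s" for s
    using nb_bounds[OF that] geo(1,2)[of "nh s"] by auto
  have floc: "?f (s - {(y, j)}) = ?f s" if "valid s" "(y, j) \<in> s" "x \<le> lend s y" for s y j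
    using nh_far[OF that] by simp
  have Ef: "E (drift r ?f) = 0" by (rule E_drift(1)[OF fB floc])
  have fbd: "\<bar>drift r ?f s\<bar> \<le> 2 * (M + H) * r + 2 * (M + H) * M" if "valid s" for s
    by (rule E_drift(2)[OF fB floc that])
  have pt: "(1 - \<rho> ^ (nh s - 1)) * (p i * r - nb s) - M / H - 2 * H - d_rate s \<le> drift r ?f s" if s: "valid s" for s
  proof -
    let ?w = "1 - \<rho> ^ (nh s - 1)"
    have w: "0 \<le> ?w" "?w \<le> 1" using \<rho>01 by (auto simp: power_le_one)
    \<comment> \<open>A big item that lands below \<open>x\<close> adds 1 to \<open>nb\<close> and
      takes at most \<open>\<rho> ^ (nh s - 1)\<close> from the geometric term.\<close>
    have a: "?w * of_bool (j = i) - small_fill s j \<le> ?f (arrive s j) - ?f s" if j: "j \<in> I" for j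
    proof (cases "i \<le> j")
      case True
      show ?thesis
      proof (cases "pos s j < x")
        case lt: True
        have "0 < nh s"
          unfolding nh_def hcount_def using pos_large_in_holes[OF s i_type j True] lt finite_holes[OF s]
          by (auto simp: card_gt_0_iff)
        moreover have "real (nh s) - 1 \<le> real (nh (arrive s j))"
          using nh_arrive_large[OF s j True] lt by (simp add: nonkill_def)
        ultimately have "- 1 * \<rho> ^ (nh s - 1) \<le> geo \<rho> (nh (arrive s j)) - geo \<rho> (nh s)"
          using \<rho>01 by (intro geo_drop) auto
        moreover have "?w * of_bool (j = i) \<le> ?w" using w by auto
        ultimately show ?thesis using True lt by (simp add: nb_arrive[OF s j] small_fill_def)
      next
        case False
        then have "nonkill s j = 0" using sizes_pos[OF j] by (simp add: nonkill_def)
        then have "nh (arrive s j) = nh s" using nh_arrive_large[OF s j True] False by simp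
        moreover have "?w = 0" if "j = i" using False nh_pos_iff[OF s] that by simp
        ultimately show ?thesis using False True by (auto simp: nb_arrive[OF s j] small_fill_def)
      qed
    next
      case False
      have "- small_fill s j * \<rho> ^ (nh s - 1) \<le> geo \<rho> (nh (arrive s j)) - geo \<rho> (nh s)"
        using \<rho>01 nh_arrive_small(1)[OF s j] False small_fill_cases[OF s] by (intro geo_drop) auto
      moreover have "small_fill s j * \<rho> ^ (nh s - 1) \<le> small_fill s j * 1"
        using \<rho>01 by (intro mult_left_mono) (auto simp: small_fill_def power_le_one)
      ultimately show ?thesis using False by (simp add: nb_arrive[OF s j])
    qed
    have int1: "integrable (measure_pmf arrival_type) (\<lambda>j. ?w * of_bool (j = i) - small_fill s j)"
      using w by (intro integrable_arrival_type[where C = 1]) (auto simp: small_fill_def)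
    have "?w * p i - ET (small_fill s) = ET (\<lambda>j. ?w * of_bool (j = i) - small_fill s j)"
    proof -
      have "integrable (measure_pmf arrival_type) (\<lambda>j. of_bool (j = i) :: real)"
        by (intro integrable_arrival_type[where C = 1]) auto
      then show ?thesis using int_small_fill ET_type by simp
    qed
    also have "\<dots> \<le> ET (\<lambda>j. ?f (arrive s j) - ?f s)"
      using a by (intro integral_mono_AE AE_arrival_type int1 integrable_change[OF fB s])
    finally have A: "r * (?w * p i - ET (small_fill s)) \<le> r * ET (\<lambda>j. ?f (arrive s j) - ?f s)"
      using r_pos by simp
    have b: "- (1 - \<rho> ^ nh s) * of_bool (y < x \<and> i \<le> j) - (lhole s (y, j) + rhole s (y, j)) * \<rho> ^ (nh s - 1)
        \<le> ?f (s - {(y, j)}) - ?f s" if yj: "(y, j) \<in> s" for y j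
    proof (cases "y < x \<and> i \<le> j")
      case True
      then have "fits \<alpha> (s - {(y, j)}) i (lend s y) \<and> lend s y < x"
        using fits_depart_large[OF s i_type yj] lend(2)[OF s valid_item(2)[OF s yj]] by auto
      then have "real (nh (s - {(y, j)})) = real (nh s) + 1 - lhole s (y, j) - rhole s (y, j)"
        using nh_depart[OF s yj] by simp
      then have "\<rho> ^ nh s - (lhole s (y, j) + rhole s (y, j)) * \<rho> ^ (nh s - 1) \<le> geo \<rho> (nh (s - {(y, j)})) - geo \<rho> (nh s)"
        using \<rho>01 lhole_cases[OF s] rhole_cases[OF s] by (intro geo_depart) auto
      then show ?thesis using True by (simp add: nb_depart[OF s yj])
    next
      case False
      have "real (nh s) - rhole s (y, j) \<le> real (nh (s - {(y, j)}))"
        using nh_depart[OF s yj] lhole_le[OF s, of y j] by simp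
      then have "- rhole s (y, j) * \<rho> ^ (nh s - 1) \<le> geo \<rho> (nh (s - {(y, j)})) - geo \<rho> (nh s)"
        using \<rho>01 rhole_cases[OF s] by (intro geo_drop) auto
      moreover have "0 \<le> lhole s (y, j) * \<rho> ^ (nh s - 1)" using \<rho>01 by (simp add: lhole_def)
      ultimately show ?thesis using False by (auto simp: nb_depart[OF s yj] algebra_simps)
    qed
    have "- (1 - \<rho> ^ nh s) * nb s - ((\<Sum>a\<in>s. lhole s a) + (\<Sum>a\<in>s. rhole s a)) * \<rho> ^ (nh s - 1)
       = (\<Sum>(y, j)\<in>s. - (1 - \<rho> ^ nh s) * of_bool (y < x \<and> i \<le> j) - (lhole s (y, j) + rhole s (y, j)) * \<rho> ^ (nh s - 1))"
      unfolding nb_def wsum_def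
      by (simp add: case_prod_beta sum_subtractf sum_distrib_left sum_distrib_right sum.distrib[symmetric] distrib_right)
    also have "\<dots> \<le> (\<Sum>a\<in>s. ?f (s - {a}) - ?f s)"
      using b by (intro sum_mono) auto
    finally have B: "- (1 - \<rho> ^ nh s) * nb s - ((\<Sum>a\<in>s. lhole s a) + (\<Sum>a\<in>s. rhole s a)) * \<rho> ^ (nh s - 1)
        \<le> (\<Sum>a\<in>s. ?f (s - {a}) - ?f s)" .
    \<comment> \<open>Here the discount pays: up to \<open>2 * nh s\<close> departures next to holes
      are weighted with a power of \<rho> that keeps the product below \<open>2 * H\<close>, however
      many holes there are.\<close>
    have C: "((\<Sum>a\<in>s. lhole s a) + (\<Sum>a\<in>s. rhole s a)) * \<rho> ^ (nh s - 1) \<le> 2 * H"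
    proof -
      have "((\<Sum>a\<in>s. lhole s a) + (\<Sum>a\<in>s. rhole s a)) * \<rho> ^ (nh s - 1) \<le> (2 * real (nh s)) * \<rho> ^ (nh s - 1)"
        using sum_lhole_le[OF s] sum_rhole_le[OF s] \<rho>01 by (intro mult_right_mono) auto
      then show ?thesis using geo(3)[of "nh s"] by simp
    qed
    \<comment> \<open>Departures carry the discount for \<open>nh s\<close>, arrivals the one for
      \<open>nh s - 1\<close>; matching them costs at most \<open>1 / H\<close> for each big
      item.\<close>
    have D: "(1 - \<rho> ^ nh s) * nb s \<le> ?w * nb s + M / H"
    proof -
      have "\<rho> ^ (nh s - 1) - \<rho> ^ nh s \<le> 1 / H"
      proof (cases "nh s")
        case (Suc k)
        have "\<rho> ^ k * (1 - \<rho>) \<le> 1 * (1 - \<rho>)" using \<rho>01 by (intro mult_right_mono) (auto simp: power_le_one)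
        then show ?thesis using Suc by (simp add: algebra_simps \<rho>)
      qed (use H in simp)
      then have "(\<rho> ^ (nh s - 1) - \<rho> ^ nh s) * nb s \<le> 1 / H * M"
        using nb_bounds[OF s] H by (intro mult_mono) auto
      then show ?thesis by (simp add: algebra_simps)
    qed
    show ?thesis using A B C D unfolding drift_def d_rate_def by (simp add: algebra_simps)
  qed
  have int: "integrable (measure_pmf \<pi>) (\<lambda>s. (1 - \<rho> ^ (nh s - 1)) * (p i * r - nb s))"
  proof (rule integrable_E)
    fix s assume s: "valid s"
    have "\<bar>1 - \<rho> ^ (nh s - 1)\<bar> \<le> 1" using \<rho>01 by (auto simp: power_le_one)
    moreover have "\<bar>p i * r - nb s\<bar> \<le> \<bar>p i * r\<bar> + M" using nb_bounds[OF s] by auto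
    ultimately show "\<bar>(1 - \<rho> ^ (nh s - 1)) * (p i * r - nb s)\<bar> \<le> 1 * (\<bar>p i * r\<bar> + M)"
      unfolding abs_mult by (intro mult_mono) auto
  qed
  have "E (\<lambda>s. (1 - \<rho> ^ (nh s - 1)) * (p i * r - nb s) - M / H - 2 * H - d_rate s) \<le> E (drift r ?f)"
    using int int_basic integrable_E[OF fbd]
    by (intro integral_mono_AE AE_stationary[OF r_pos stat] pt) auto
  then show ?thesis unfolding Ef using int int_basic by simp
qed

text \<open>\<open>Z\<close> is the random slack in the assertion that big items cannot fill \<open>{0..<x}\<close>.\<close>

lemma E_holes_le:
  assumes H: "1 \<le> H" and \<delta>: "0 < \<delta>"
    and Z: "\<And>s. valid s \<Longrightarrow> 0 \<le> Z s" "\<And>s. valid s \<Longrightarrow> Z s \<le> CZ"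
    and nbZ: "\<And>s. valid s \<Longrightarrow> nb s \<le> (p i - \<delta>) * r + Z s"
  shows "E (\<lambda>s. real (nh s)) \<le> H + 1 + 2 * M / (\<delta> * r) * (M / H + 2 * H + E d_rate + E Z)"
proof -
  define \<rho> where "\<rho> = 1 - 1 / H"
  have \<rho>01: "0 \<le> \<rho>" "\<rho> < 1" using H by (auto simp: \<rho>_def)
  let ?w = "\<lambda>s. 1 - \<rho> ^ (nh s - 1)"
  have w: "0 \<le> ?w s" "?w s \<le> 1" for s using \<rho>01 by (auto simp: power_le_one)
  have intZ: "integrable (measure_pmf \<pi>) Z"
    using Z by (intro integrable_E[where C = CZ]) auto
  have intw: "integrable (measure_pmf \<pi>) ?w"
    using w by (intro integrable_E[where C = 1]) auto
  have "\<delta> * r * E ?w - E Z = E (\<lambda>s. \<delta> * r * ?w s - Z s)" using intZ intw by simp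
  also have "\<dots> \<le> E (\<lambda>s. ?w s * (p i * r - nb s))"
  proof (intro integral_mono_AE AE_stationary[OF r_pos stat])
    fix s assume s: "valid s"
    have "?w s * (\<delta> * r - Z s) \<le> ?w s * (p i * r - nb s)"
      using nbZ[OF s] w by (intro mult_left_mono) (auto simp: algebra_simps)
    moreover have "?w s * Z s \<le> 1 * Z s" using w Z[OF s] by (intro mult_right_mono) auto
    ultimately show "\<delta> * r * ?w s - Z s \<le> ?w s * (p i * r - nb s)" by (simp add: algebra_simps)
  next
    show "integrable (measure_pmf \<pi>) (\<lambda>s. ?w s * (p i * r - nb s))"
    proof (rule integrable_E)
      fix s assume s: "valid s"
      have "\<bar>p i * r - nb s\<bar> \<le> \<bar>p i * r\<bar> + M" using nb_bounds[OF s] by auto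
      then show "\<bar>?w s * (p i * r - nb s)\<bar> \<le> 1 * (\<bar>p i * r\<bar> + M)"
        unfolding abs_mult using w[of s] by (intro mult_mono) auto
    qed
  qed (use intZ intw in auto)
  also have "\<dots> \<le> M / H + 2 * H + E d_rate" by (rule E_hole_tail[OF H \<rho>_def])
  finally have main: "E ?w \<le> (M / H + 2 * H + E d_rate + E Z) / (\<delta> * r)"
    using \<delta> r_pos by (simp add: field_simps)
  have "E (\<lambda>s. real (nh s)) \<le> E (\<lambda>s. (H + 1) + 2 * M * ?w s)"
  proof (intro integral_mono_AE AE_stationary[OF r_pos stat])
    fix s assume s: "valid s"
    show "real (nh s) \<le> (H + 1) + 2 * M * ?w s"
    proof (cases "real (nh s) \<le> H + 1")
      case True
      moreover have "0 \<le> 2 * M * ?w s" using w M_ge_1 by simp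
      ultimately show ?thesis by linarith
    next
      case False
      then have k: "H \<le> real (nh s - 1)" by (simp add: of_nat_diff)
      \<comment> \<open>Since \<rho> and \<open>1 + 1 / H\<close> have a product of at most 1, it is
        enough that the power of the latter reaches 2, and by Bernoulli's inequality an exponent of
        at least \<open>H\<close> achieves this.\<close>
      have "1 + real (nh s - 1) * (1 / H) \<le> (1 + 1 / H) ^ (nh s - 1)"
        using H by (intro Bernoulli_inequality) (auto intro: order_trans[of _ 0])
      moreover have "1 \<le> real (nh s - 1) * (1 / H)" using k H by (simp add: le_divide_eq)
      ultimately have "2 \<le> (1 + 1 / H) ^ (nh s - 1)" by linarith
      then have "\<rho> ^ (nh s - 1) * 2 \<le> \<rho> ^ (nh s - 1) * (1 + 1 / H) ^ (nh s - 1)"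
        using \<rho>01 by (intro mult_left_mono) auto
      also have "\<dots> = (\<rho> * (1 + 1 / H)) ^ (nh s - 1)" by (simp add: power_mult_distrib)
      also have "\<dots> \<le> 1"
      proof (rule power_le_one)
        have "\<rho> * (1 + 1 / H) = 1 - 1 / H * (1 / H)" by (simp add: \<rho>_def algebra_simps)
        then show "\<rho> * (1 + 1 / H) \<le> 1" by simp
        show "0 \<le> \<rho> * (1 + 1 / H)" using \<rho>01 H by simp
      qed
      finally have "1 / 2 \<le> ?w s" by simp
      then have "2 * M * (1 / 2) \<le> 2 * M * ?w s" using M_ge_1 by (intro mult_left_mono) auto
      then show ?thesis using nh_le_M[OF s] H by simp
    qed
  qed (use int_basic intw in auto)
  also have "\<dots> = H + 1 + 2 * M * E ?w" using intw by simp
  also have "\<dots> \<le> H + 1 + 2 * M * ((M / H + 2 * H + E d_rate + E Z) / (\<delta> * r))"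
    using main M_ge_1 by (intro add_left_mono mult_left_mono) auto
  finally show ?thesis by simp
qed

text \<open>When a hole is present, the drift of \<open>nb\<close> is at least
  \<open>\<delta> * r - Z\<close>. Weighting it with a slow function \<open>n\<close> and applying
  \<open>E_slow_drift_nb_le\<close> leaves the states without holes as the main term.\<close>

lemma E_slow_le:
  fixes n :: "packing \<Rightarrow> real"
  assumes n: "\<And>s. valid s \<Longrightarrow> 0 \<le> n s \<and> n s \<le> C" and c: "0 \<le> c"
    and loc: "\<And>s y j. valid s \<Longrightarrow> (y, j) \<in> s \<Longrightarrow> x \<le> lend s y \<Longrightarrow> n (s - {(y, j)}) = n s"
    and ca: "\<And>s j. valid s \<Longrightarrow> j \<in> I \<Longrightarrow> \<bar>n (arrive s j) - n s\<bar> \<le> c"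
    and cd: "\<And>s y j. valid s \<Longrightarrow> (y, j) \<in> s \<Longrightarrow> lend s y < x \<Longrightarrow> \<bar>n (s - {(y, j)}) - n s\<bar> \<le> c"
    and Z: "\<And>s. valid s \<Longrightarrow> 0 \<le> Z s" "\<And>s. valid s \<Longrightarrow> Z s \<le> CZ"
    and nbZ: "\<And>s. valid s \<Longrightarrow> nb s \<le> (p i - \<delta>) * r + Z s"
  shows "\<delta> * r * E n \<le> p i * r * E (\<lambda>s. n s * of_bool (nh s = 0)) + C * E Z
      + 2 * C * (E d_rate + 2 * E (\<lambda>s. real (nh s))) + c * (r + M) * (E (\<lambda>s. real (nh s)) + 1)"
proof -
  have C0: "0 \<le> C" using n[OF valid_empty] by auto
  obtain C1 where C1: "\<And>s. valid s \<Longrightarrow> \<bar>drift r nb s\<bar> \<le> C1" using drift_nb_bound by blast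
  have int_n: "integrable (measure_pmf \<pi>) n" using n by (intro integrable_E[where C = C]) auto
  have int_n0: "integrable (measure_pmf \<pi>) (\<lambda>s. n s * of_bool (nh s = 0))"
    using n by (intro integrable_E[where C = C]) (auto simp: of_bool_def C0)
  have int_Z: "integrable (measure_pmf \<pi>) Z" using Z by (intro integrable_E[where C = CZ]) auto
  have "\<delta> * r * E n - p i * r * E (\<lambda>s. n s * of_bool (nh s = 0)) - C * E Z
     = E (\<lambda>s. \<delta> * r * n s - p i * r * (n s * of_bool (nh s = 0)) - C * Z s)"
    using int_n int_n0 int_Z by simp
  also have "\<dots> \<le> E (\<lambda>s. n s * drift r nb s)"
  proof (intro integral_mono_AE AE_stationary[OF r_pos stat])
    fix s assume s: "valid s"
    have "n s * (p i * r * of_bool (0 < nh s) - ((p i - \<delta>) * r + Z s)) \<le> n s * drift r nb s"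
      using drift_nb_ge[OF s] nbZ[OF s] n[OF s] by (intro mult_left_mono) auto
    moreover have "n s * Z s \<le> C * Z s" using n[OF s] Z[OF s] by (intro mult_right_mono) auto
    ultimately show "\<delta> * r * n s - p i * r * (n s * of_bool (nh s = 0)) - C * Z s \<le> n s * drift r nb s"
      by (cases "nh s = 0") (simp_all add: algebra_simps)
  next
    show "integrable (measure_pmf \<pi>) (\<lambda>s. n s * drift r nb s)"
      using n C1 C0 by (intro integrable_E[where C = "C * C1"]) (auto simp: abs_mult intro!: mult_mono)
  qed (use int_n int_n0 int_Z in auto)
  also have "\<dots> \<le> 2 * C * (E d_rate + 2 * E (\<lambda>s. real (nh s))) + c * (r + M) * (E (\<lambda>s. real (nh s)) + 1)"
    by (rule E_slow_drift_nb_le[OF n c loc ca cd])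
  finally show ?thesis by simp
qed

end

section \<open>Loose windows\<close>

lemma card_diff_le:
  assumes "finite A" "finite B"
  shows "real (card A) - real (card B) \<le> real (card (A - B))"
proof -
  have "card A \<le> card (B \<union> (A - B))" using assms by (intro card_mono) auto
  also have "\<dots> \<le> card B + card (A - B)" by (rule card_Un_le)
  finally show ?thesis by simp
qed

lemma card_le_oneI: "(\<And>a b. a \<in> A \<Longrightarrow> b \<in> A \<Longrightarrow> a = b) \<Longrightarrow> card A \<le> 1"
proof (cases "A = {}")
  case False
  assume *: "\<And>a b. a \<in> A \<Longrightarrow> b \<in> A \<Longrightarrow> a = b"
  from False obtain a where "a \<in> A" by blast
  then have "A = {a}" using * by blast
  then show ?thesis by simp
qed simp

locale windowed_first_fit = stationary_first_fit +
  fixes m :: nat and x1 :: real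
  assumes m_pos: "0 < m" and x1_nonneg: "0 \<le> x1"
begin

definition L :: real where "L = real m * \<alpha> i"

text \<open>
  Smaller items have weight \<open>m\<close>, so a loose window contains none of them.
\<close>

definition load :: "packing \<Rightarrow> real \<Rightarrow> real" where
  "load s y = wsum (\<lambda>z k. of_bool (y \<le> z \<and> z < y + L) * (if k < i then real m else 1)) s
     + real (hcount i {y..<y + L} s)"

text \<open>Only \<open>loose 0\<close> enters the cover argument; positive \<open>l\<close> serves
  the downward induction that bounds it.\<close>

definition loose :: "nat \<Rightarrow> packing \<Rightarrow> real set" where
  "loose l s = {y \<in> ends s. x1 \<le> y \<and> y + L \<le> x \<and> (\<forall>k<l. (y + real k * \<alpha> i, i) \<in> s) \<and> load s y < real m}"

definition nloose :: "nat \<Rightarrow> packing \<Rightarrow> nat" where "nloose l s = card (loose l s)"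

text \<open>Bounds the number of item ends within distance \<open>L\<close> of a given
  point.\<close>

definition cE :: real where "cE = 2 * L / \<alpha> 1 + 1"

definition small_far :: "packing \<Rightarrow> nat \<Rightarrow> real" where
  "small_far s j = of_bool (j < i \<and> x1 \<le> pos s j)"

text \<open>The next \<open>i\<close>-item will extend the run of \<open>l\<close> items at the beginning of a loose window.\<close>

definition primed :: "nat \<Rightarrow> packing \<Rightarrow> bool" where
  "primed l s \<longleftrightarrow> pos s i - real l * \<alpha> i \<in> loose l s"

lemma size_i_pos: "0 < \<alpha> i" using i_type by (rule sizes_pos)

lemma L_pos: "0 < L" using m_pos size_i_pos by (simp add: L_def)

lemma cE_ge_1: "1 \<le> cE" using L_pos first_size_pos by (simp add: cE_def)

lemma run_lt_L: "k < m \<Longrightarrow> real k * \<alpha> i + \<alpha> i \<le> L"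
proof -
  assume "k < m"
  then have "(real k + 1) * \<alpha> i \<le> real m * \<alpha> i" using size_i_pos by (intro mult_right_mono) auto
  then show ?thesis by (simp add: L_def algebra_simps)
qed

lemma finite_loose: "valid s \<Longrightarrow> finite (loose l s)"
  using ends_finite by (simp add: loose_def)

lemma loose_subset: "valid s \<Longrightarrow> loose l s \<subseteq> ends s \<inter> {0..<x}"
  using L_pos ends_nonneg by (auto simp: loose_def)

lemma nloose_le_M: "valid s \<Longrightarrow> real (nloose l s) \<le> M"
proof -
  assume s: "valid s"
  have "nloose l s \<le> card (ends s \<inter> {0..<x})"
    unfolding nloose_def using ends_finite[OF s] loose_subset[OF s] by (intro card_mono) auto
  then show ?thesis using card_ends_le[OF s x_nonneg] by (simp add: M_def)
qed

text \<open>A run of \<open>m\<close> items alone has load \<open>m\<close>.\<close>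

lemma loose_m_empty: "valid s \<Longrightarrow> loose m s = {}"
proof (rule ccontr)
  assume s: "valid s" and "loose m s \<noteq> {}"
  then obtain y where y: "\<And>k. k < m \<Longrightarrow> (y + real k * \<alpha> i, i) \<in> s" "load s y < real m"
    by (auto simp: loose_def)
  let ?g = "\<lambda>k. (y + real k * \<alpha> i, i)"
  have inj: "inj_on ?g {..<m}" using size_i_pos by (auto simp: inj_on_def)
  have "real m = (\<Sum>a\<in>?g ` {..<m}. 1)" by (simp add: card_image[OF inj])
  also have "\<dots> \<le> (\<Sum>a\<in>?g ` {..<m}. case a of (z, k) \<Rightarrow> of_bool (y \<le> z \<and> z < y + L) * (if k < i then real m else 1))"
  proof (rule sum_mono)
    fix a assume "a \<in> ?g ` {..<m}"
    then obtain k where k: "k < m" "a = ?g k" by auto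
    then have "y + real k * \<alpha> i < y + L" using run_lt_L[OF k(1)] size_i_pos by simp
    then show "1 \<le> (case a of (z, k) \<Rightarrow> of_bool (y \<le> z \<and> z < y + L) * (if k < i then real m else 1))"
      using k size_i_pos by simp
  qed
  also have "\<dots> \<le> wsum (\<lambda>z k. of_bool (y \<le> z \<and> z < y + L) * (if k < i then real m else 1)) s"
    unfolding wsum_def using y(1) valid_finite[OF s] by (intro sum_mono2) auto
  finally show False using y(2) by (simp add: load_def)
qed

lemma mem_arrive: "a \<in> arrive s j \<longleftrightarrow> a = (pos s j, j) \<or> a \<in> s"
  by (simp add: arrive_def)

section \<open>Effect of one event on loose windows\<close>

definition win :: "real \<Rightarrow> real \<Rightarrow> bool" where "win y c \<longleftrightarrow> y \<le> c \<and> c < y + L"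

text \<open>A hole counts as much as an item of type \<ge> i, so a big item that lands in a hole and
  leaves no other hole behind it inside the window does not change the load; this lets a loose
  window survive the refilling of a gap.\<close>

lemma load_arrive:
  assumes s: "valid s" and j: "j \<in> I"
  shows "load (arrive s j) y = load s y
    + of_bool (win y (pos s j)) * ((if j < i then real m else 1) - of_bool (pos s j \<in> holes i s))
    + of_bool (win y (pos s j + \<alpha> j)) * of_bool (fits \<alpha> s i (pos s j + \<alpha> j))"
  unfolding load_def hcount_arrive[OF s i_type j] wsum_arrive[OF s j] win_def by auto

lemma load_depart:
  assumes s: "valid s" and a: "(z, j) \<in> s"
  shows "load (s - {(z, j)}) y = load s y
    - of_bool (win y z) * (if j < i then real m else 1)
    - of_bool (win y (z + \<alpha> j)) * of_bool (z + \<alpha> j \<in> holes i s)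
    + of_bool (win y (lend s z)) * (of_bool (fits \<alpha> (s - {(z, j)}) i (lend s z)) - of_bool (lend s z \<in> holes i s))"
  unfolding load_def hcount_depart[OF s i_type a] wsum_depart[OF s a] win_def by auto

lemma outside_window: "y \<notin> {c - L..<c + L} \<Longrightarrow> \<not> win y c"
  using L_pos by (auto simp: win_def)

lemma loose_arrive_local:
  assumes s: "valid s" and j: "j \<in> I" and l: "l \<le> m"
    and y: "y \<notin> {pos s j - L..<pos s j + L}" "y \<notin> {pos s j + \<alpha> j - L..<pos s j + \<alpha> j + L}"
  shows "y \<in> loose l (arrive s j) \<longleftrightarrow> y \<in> loose l s"
proof -
  have "load (arrive s j) y = load s y"
    unfolding load_arrive[OF s j] using outside_window[OF y(1)] outside_window[OF y(2)] by simp
  moreover have "y \<noteq> pos s j + \<alpha> j" using y(2) L_pos by auto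
  moreover have "y + real k * \<alpha> i \<noteq> pos s j" if "k < l" for k
  proof
    assume e: "y + real k * \<alpha> i = pos s j"
    have "real k * \<alpha> i + \<alpha> i \<le> L" using run_lt_L[of k] that l by simp
    moreover have "0 \<le> real k * \<alpha> i" using size_i_pos by simp
    ultimately have "win y (pos s j)" using e size_i_pos unfolding win_def by linarith
    then show False using outside_window[OF y(1)] by simp
  qed
  ultimately show ?thesis by (auto simp: loose_def ends_arrive mem_arrive)
qed

lemma loose_depart_local:
  assumes s: "valid s" and a: "(z, j) \<in> s" and l: "l \<le> m"
    and y: "y \<notin> {z - L..<z + L}" "y \<notin> {z + \<alpha> j - L..<z + \<alpha> j + L}" "y \<notin> {lend s z - L..<lend s z + L}"
  shows "y \<in> loose l (s - {(z, j)}) \<longleftrightarrow> y \<in> loose l s"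
proof -
  have "load (s - {(z, j)}) y = load s y"
    unfolding load_depart[OF s a]
    using outside_window[OF y(1)] outside_window[OF y(2)] outside_window[OF y(3)] by simp
  moreover have "y \<noteq> z + \<alpha> j" using y(2) L_pos by auto
  moreover have "y + real k * \<alpha> i \<noteq> z" if "k < l" for k
  proof
    assume e: "y + real k * \<alpha> i = z"
    have "real k * \<alpha> i + \<alpha> i \<le> L" using run_lt_L[of k] that l by simp
    moreover have "0 \<le> real k * \<alpha> i" using size_i_pos by simp
    ultimately have "win y (z)" using e size_i_pos unfolding win_def by linarith
    then show False using outside_window[OF y(1)] by simp
  qed
  ultimately show ?thesis by (auto simp: loose_def ends_depart[OF s a])
qed

lemma card_ends_window: "valid s \<Longrightarrow> real (card (ends s \<inter> {c - L..<c + L})) \<le> cE"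
  using card_ends_le[of s "c - L" "c + L"] L_pos by (simp add: cE_def)

lemma card_three_windows:
  assumes s: "valid s" and A: "A \<subseteq> ends s" "A \<subseteq> {c1 - L..<c1 + L} \<union> {c2 - L..<c2 + L} \<union> {c3 - L..<c3 + L}"
  shows "real (card A) \<le> 3 * cE"
proof -
  let ?W = "\<lambda>c. ends s \<inter> {c - L..<c + L}"
  have "card A \<le> card (?W c1 \<union> ?W c2 \<union> ?W c3)"
    using A ends_finite[OF s] by (intro card_mono) auto
  also have "\<dots> \<le> card (?W c1) + card (?W c2) + card (?W c3)"
    by (meson add_mono_thms_linordered_semiring(3) card_Un_le le_trans)
  finally show ?thesis
    using card_ends_window[OF s, of c1] card_ends_window[OF s, of c2] card_ends_window[OF s, of c3] by linarith
qed

text \<open>An event affects only windows that start near at most three points, so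
  \<open>nloose\<close> is slow in the sense of \<open>E_slow_le\<close> with the constant
  \<open>3 * cE\<close>.\<close>

lemma nloose_arrive_change:
  assumes s: "valid s" and j: "j \<in> I" and l: "l \<le> m"
  shows "\<bar>real (nloose l (arrive s j)) - real (nloose l s)\<bar> \<le> 3 * cE"
proof -
  note s' = valid_arrive[OF s j]
  let ?V = "{pos s j - L..<pos s j + L} \<union> {pos s j + \<alpha> j - L..<pos s j + \<alpha> j + L} \<union> {pos s j - L..<pos s j + L}"
  have "loose l (arrive s j) - loose l s \<subseteq> ?V" "loose l s - loose l (arrive s j) \<subseteq> ?V"
    using loose_arrive_local[OF s j l] by blast+
  then have "real (card (loose l (arrive s j) - loose l s)) \<le> 3 * cE"
    using loose_subset[OF s', of l] by (intro card_three_windows[OF s']) auto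
  moreover have "real (card (loose l s - loose l (arrive s j))) \<le> 3 * cE"
    using \<open>loose l s - loose l (arrive s j) \<subseteq> ?V\<close> loose_subset[OF s, of l] by (intro card_three_windows[OF s]) auto
  ultimately show ?thesis
    using card_diff_le[OF finite_loose[OF s'] finite_loose[OF s], of l l]
      card_diff_le[OF finite_loose[OF s] finite_loose[OF s'], of l l]
    unfolding nloose_def by linarith
qed

lemma nloose_depart_change:
  assumes s: "valid s" and a: "(z, j) \<in> s" and l: "l \<le> m"
  shows "\<bar>real (nloose l (s - {(z, j)})) - real (nloose l s)\<bar> \<le> 3 * cE"
proof -
  note s' = valid_depart[OF s, of "(z, j)"]
  let ?V = "{z - L..<z + L} \<union> {z + \<alpha> j - L..<z + \<alpha> j + L} \<union> {lend s z - L..<lend s z + L}"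
  have "loose l (s - {(z, j)}) - loose l s \<subseteq> ?V" "loose l s - loose l (s - {(z, j)}) \<subseteq> ?V"
    using loose_depart_local[OF s a l] by blast+
  then have "real (card (loose l (s - {(z, j)}) - loose l s)) \<le> 3 * cE"
    using loose_subset[OF s', of l] by (intro card_three_windows[OF s']) auto
  moreover have "real (card (loose l s - loose l (s - {(z, j)}))) \<le> 3 * cE"
    using \<open>loose l s - loose l (s - {(z, j)}) \<subseteq> ?V\<close> loose_subset[OF s, of l] by (intro card_three_windows[OF s]) auto
  ultimately show ?thesis
    using card_diff_le[OF finite_loose[OF s'] finite_loose[OF s], of l l]
      card_diff_le[OF finite_loose[OF s] finite_loose[OF s'], of l l]
    unfolding nloose_def by linarith
qed

lemma loose_far:
  assumes s: "valid s" and a: "(z, j) \<in> s" and far: "x \<le> lend s z" and l: "l \<le> m"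
  shows "loose l (s - {(z, j)}) = loose l s"
proof -
  have "x \<le> z" by (rule depart_far(3)[OF s i_type a far])
  moreover have "0 < \<alpha> j" by (rule valid_item(3)[OF s a])
  ultimately have ld: "load (s - {(z, j)}) y = load s y" if "y + L \<le> x" for y
    using that far \<open>x \<le> z\<close> by (simp add: load_depart[OF s a] win_def)
  have "y + real k * \<alpha> i \<noteq> z" if "k < l" "y + L \<le> x" for k y
    using run_lt_L[of k] that l \<open>x \<le> z\<close> size_i_pos by auto
  then show ?thesis
    using ld \<open>x \<le> z\<close> \<open>0 < \<alpha> j\<close> L_pos by (auto simp: loose_def ends_depart[OF s a])
qed

text \<open>The departure of an item that starts inside the window lowers the load at least as much
  as the hole it opens raises it. What remains is the loss of the end \<open>y\<close>, the loss of
  an item of the run, and the first item beyond the right border, which may open a hole inside the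
  window without having been counted in it.\<close>

lemma loose_depart_harm:
  assumes s: "valid s" and a: "(z, j) \<in> s" and y: "y \<in> loose l s" "y \<notin> loose l (s - {(z, j)})"
  shows "z + \<alpha> j = y \<or> (\<exists>k<l. z = y + real k * \<alpha> i \<and> j = i) \<or> (lend s z < y + L \<and> y + L \<le> z)"
proof (rule ccontr)
  assume n: "\<not> ?thesis"
  note l = lend[OF s valid_item(2)[OF s a]]
  have m1: "1 \<le> (if j < i then real m else 1)" using m_pos by auto
  have "load (s - {(z, j)}) y \<le> load s y"
  proof (cases "win y (lend s z)")
    case True
    then have "win y z" using l(2) n by (auto simp: win_def)
    then show ?thesis using m1 True m_pos by (simp add: load_depart[OF s a])
  next
    case False
    have "0 \<le> of_bool (win y z) * (if j < i then real m else 1)" by simp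
    then show ?thesis using False by (simp add: load_depart[OF s a])
  qed
  then have "y \<in> loose l (s - {(z, j)})"
    using y(1) n by (auto simp: loose_def ends_depart[OF s a])
  then show False using y(2) by simp
qed

text \<open>Ends and runs survive an arrival, so only an increased load does harm. It comes from a
  small item beyond \<open>x1\<close> or from a big one that leaves a hole behind it; their rates
  are \<open>small_rate\<close> and \<open>J_rate\<close>.\<close>

lemma loose_arrive_harm:
  assumes s: "valid s" and j: "j \<in> I" and y: "y \<in> loose l s" "y \<notin> loose l (arrive s j)"
  shows "y \<le> pos s j \<and> pos s j < y + L" "1 \<le> nonkill s j + small_far s j"
proof -
  let ?u = "pos s j"
  have ye: "y \<in> ends s" "x1 \<le> y" "y + L \<le> x" "load s y < real m" using y(1) by (auto simp: loose_def)
  have gt: "load s y < load (arrive s j) y"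
  proof -
    have "y \<in> ends (arrive s j)" using ye(1) by (simp add: ends_arrive)
    moreover have "\<forall>k<l. (y + real k * \<alpha> i, i) \<in> arrive s j" using y(1) by (simp add: loose_def arrive_def)
    ultimately show ?thesis using y(2) ye by (auto simp: loose_def)
  qed
  \<comment> \<open>Since \<open>y\<close> is an item end, an item that starts to the left of
    \<open>y\<close> cannot end in the window.\<close>
  have "win y ?u"
  proof (rule ccontr)
    assume n: "\<not> ?thesis"
    then have "win y (?u + \<alpha> j)"
      using gt by (cases "win y (?u + \<alpha> j)") (auto simp: load_arrive[OF s j])
    then have w: "y \<le> ?u + \<alpha> j \<and> ?u + \<alpha> j < y + L" by (simp add: win_def)
    then have lt: "?u < y" using n sizes_pos[OF j] by (auto simp: win_def)
    from ye(1) show False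
    proof (cases rule: endsE)
      case 1
      then show ?thesis using lt pos_nonneg[OF s j] by simp
    next
      case (2 z k)
      then have "?u + \<alpha> j \<le> z" using pos_fits[OF s j] lt by (fastforce simp: fits_iff[OF s j])
      then show ?thesis using w 2 valid_item(3)[OF s 2(1)] by simp
    qed
  qed
  then show win: "y \<le> ?u \<and> ?u < y + L" by (simp add: win_def)
  show "1 \<le> nonkill s j + small_far s j"
  proof (cases "j < i")
    case True
    then show ?thesis using win ye by (simp add: small_far_def nonkill_def)
  next
    case False
    then have "?u \<in> holes i s" using pos_large_in_holes[OF s i_type j] by simp
    then have "win y (?u + \<alpha> j) \<and> fits \<alpha> s i (?u + \<alpha> j)"
      using gt \<open>win y ?u\<close> False
      by (cases "win y (?u + \<alpha> j)"; cases "fits \<alpha> s i (?u + \<alpha> j)") (auto simp: load_arrive[OF s j])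
    then show ?thesis using False ye(3) by (simp add: win_def nonkill_def small_far_def)
  qed
qed

lemma nloose_arrive_harm:
  assumes s: "valid s" and j: "j \<in> I"
  shows "real (card (loose l s - loose l (arrive s j))) \<le> cE * (nonkill s j + small_far s j)"
proof (cases "loose l s - loose l (arrive s j) = {}")
  case True
  have "0 \<le> cE * (nonkill s j + small_far s j)" using cE_ge_1 by (simp add: nonkill_def small_far_def)
  then show ?thesis unfolding True by simp
next
  case False
  then have one: "1 \<le> nonkill s j + small_far s j" using loose_arrive_harm(2)[OF s j] by blast
  have "loose l s - loose l (arrive s j) \<subseteq> ends s \<inter> {pos s j - L..<pos s j + L}"
    using loose_arrive_harm(1)[OF s j] loose_subset[OF s] L_pos by force
  then have "card (loose l s - loose l (arrive s j)) \<le> card (ends s \<inter> {pos s j - L..<pos s j + L})"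
    using ends_finite[OF s] by (intro card_mono) auto
  then have "real (card (loose l s - loose l (arrive s j))) \<le> cE * 1" using card_ends_window[OF s, of "pos s j"] by simp
  also have "\<dots> \<le> cE * (nonkill s j + small_far s j)" using one cE_ge_1 by (intro mult_left_mono) auto
  finally show ?thesis .
qed

text \<open>Double counting: by \<open>loose_depart_harm\<close> a given window can be destroyed by
  the departure of at most \<open>l + 2\<close> items.\<close>

lemma nloose_depart_harm:
  assumes s: "valid s"
  shows "(\<Sum>a\<in>s. real (card (loose l s - loose l (s - {a})))) \<le> (real l + 2) * real (nloose l s)"
proof -
  have fin: "finite s" by (rule valid_finite[OF s])
  have fl: "finite (loose l s)" by (rule finite_loose[OF s])
  have "(\<Sum>a\<in>s. real (card (loose l s - loose l (s - {a})))) = (\<Sum>a\<in>s. \<Sum>y\<in>loose l s. of_bool (y \<notin> loose l (s - {a})))"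
  proof (intro sum.cong refl)
    fix a
    have "(\<Sum>y\<in>loose l s. of_bool (y \<notin> loose l (s - {a})) :: real) = (\<Sum>y\<in>loose l s - loose l (s - {a}). 1)"
      using fl by (intro sum.mono_neutral_cong_right) auto
    then show "real (card (loose l s - loose l (s - {a}))) = (\<Sum>y\<in>loose l s. of_bool (y \<notin> loose l (s - {a})))" by simp
  qed
  also have "\<dots> = (\<Sum>y\<in>loose l s. \<Sum>a\<in>s. of_bool (y \<notin> loose l (s - {a})))" by (rule sum.swap)
  also have "\<dots> \<le> (\<Sum>y\<in>loose l s. real l + 2)"
  proof (rule sum_mono)
    fix y assume y: "y \<in> loose l s"
    let ?A = "{a \<in> s. y \<notin> loose l (s - {a})}"
    let ?A1 = "{(z, j) \<in> s. z + \<alpha> j = y}" and ?A2 = "(\<lambda>k. (y + real k * \<alpha> i, i)) ` {..<l}"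
      and ?A3 = "{(z, j) \<in> s. lend s z < y + L \<and> y + L \<le> z}"
    have sub: "?A \<subseteq> ?A1 \<union> ?A2 \<union> ?A3"
      using loose_depart_harm[OF s _ y] by (auto simp: image_iff)
    have c1: "card ?A1 \<le> 1"
    proof -
      have "a = b" if ab: "a \<in> ?A1" "b \<in> ?A1" for a b
        using end_inj[OF s, of "fst a" "snd a" "fst b" "snd b"] ab by (cases a; cases b) auto
      then show ?thesis by (rule card_le_oneI)
    qed
    have c3: "card ?A3 \<le> 1"
    proof -
      have "a = b" if ab: "a \<in> ?A3" "b \<in> ?A3" for a b
      proof -
        obtain z j w k where ab': "a = (z, j)" "b = (w, k)" by (cases a, cases b) auto
        have z: "(z, j) \<in> s" "lend s z < y + L" "y + L \<le> z" and w: "(w, k) \<in> s" "lend s w < y + L" "y + L \<le> w"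
          using ab unfolding ab' by blast+
        have "\<not> z < w" using lend_mono_strict[OF s z(1) valid_item(2)[OF s z(1)] w(1)] z w by linarith
        moreover have "\<not> w < z" using lend_mono_strict[OF s w(1) valid_item(2)[OF s w(1)] z(1)] z w by linarith
        ultimately have "z = w" by simp
        then show ?thesis using valid_same_start[OF s z(1), of k] w(1) unfolding ab' by simp
      qed
      then show ?thesis by (rule card_le_oneI)
    qed
    have "finite ?A1" "finite ?A3" using fin by (rule finite_subset[rotated], auto)+
    then have "card ?A \<le> card (?A1 \<union> ?A2 \<union> ?A3)"
      using sub by (intro card_mono) auto
    also have "\<dots> \<le> card ?A1 + card ?A2 + card ?A3"
      by (meson add_mono_thms_linordered_semiring(3) card_Un_le le_trans)
    also have "\<dots> \<le> 1 + l + 1" using c1 c3 card_image_le[of "{..<l}" "\<lambda>k. (y + real k * \<alpha> i, i)"] by simp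
    finally have "real (card ?A) \<le> real l + 2" by simp
    moreover have "(\<Sum>a\<in>s. of_bool (y \<notin> loose l (s - {a})) :: real) = (\<Sum>a\<in>?A. 1)"
      using fin by (intro sum.mono_neutral_cong_right) auto
    ultimately show "(\<Sum>a\<in>s. of_bool (y \<notin> loose l (s - {a})) :: real) \<le> real l + 2" by simp
  qed
  finally show ?thesis by (simp add: nloose_def mult.commute)
qed

section \<open>Extending the run of a loose window\<close>

lemma load_ge_item:
  assumes s: "valid s" and z: "(z, k) \<in> s" "win y z"
  shows "(if k < i then real m else 1) \<le> load s y"
proof -
  let ?g = "\<lambda>z k. of_bool (y \<le> z \<and> z < y + L) * (if k < i then real m else 1)"
  have "(case (z, k) of (z, k) \<Rightarrow> ?g z k) \<le> wsum ?g s"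
    unfolding wsum_def using z valid_finite[OF s] by (intro member_le_sum) auto
  then show ?thesis using z(2) by (simp add: load_def win_def)
qed

lemma run_end_in_ends:
  assumes "y \<in> loose l s"
  shows "y + real l * \<alpha> i \<in> ends s"
proof (cases l)
  case (Suc k)
  then have "(y + real k * \<alpha> i, i) \<in> s" using assms by (simp add: loose_def)
  then show ?thesis using end_in_ends[of "y + real k * \<alpha> i" i s] Suc by (simp add: algebra_simps)
qed (use assms in \<open>simp add: loose_def\<close>)

lemma no_holes: "valid s \<Longrightarrow> nh s = 0 \<Longrightarrow> u \<in> holes i s \<Longrightarrow> x \<le> u"
  using finite_holes[of s i] by (auto simp: nh_def hcount_def not_le[symmetric])

text \<open>The witness is the first item that starts at or beyond \<open>u\<close>: no other item
  ends between \<open>u\<close> and its start, so its gap begins at \<open>u\<close>.\<close>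

lemma next_item:
  assumes s: "valid s" and e: "u \<in> ends s" and nf: "u \<notin> holes i s"
  obtains z j where "(z, j) \<in> s" "u \<le> z" "z < u + \<alpha> i" "lend s z = u"
proof -
  let ?Q = "{z \<in> fst ` s. u \<le> z}"
  have fin: "finite ?Q" using valid_finite[OF s] by simp
  have "\<not> fits \<alpha> s i u" using nf e by (simp add: holes_def)
  then obtain w k where w: "(w, k) \<in> s" "w < u + \<alpha> i" "u < w + \<alpha> k"
    using ends_nonneg[OF s e] by (fastforce simp: fits_iff[OF s i_type])
  then have "u \<le> w" using item_before_end[OF s e w(1)] by force
  then have wQ: "w \<in> ?Q" using w(1) by force
  have "Min ?Q \<in> ?Q" using fin wQ Min_in by blast
  then obtain j where j: "(Min ?Q, j) \<in> s" "u \<le> Min ?Q" by auto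
  have "Min ?Q \<le> w" using fin wQ by (rule Min_le)
  moreover have "lend s (Min ?Q) = u"
  proof (rule antisym)
    note l = lend[OF s valid_item(2)[OF s j(1)]]
    show "u \<le> lend s (Min ?Q)" using l(3)[OF e j(2)] .
    from l(1) show "lend s (Min ?Q) \<le> u"
    proof (cases rule: endsE)
      case 1
      then show ?thesis using ends_nonneg[OF s e] by simp
    next
      case (2 v k')
      show ?thesis
      proof (rule ccontr)
        assume n: "\<not> ?thesis"
        then have "u \<le> v" using item_before_end[OF s e 2(1)] 2 by force
        then have "Min ?Q \<le> v" using fin 2(1) by (intro Min_le) force+
        then show False using 2 l(2) valid_item(3)[OF s 2(1)] by simp
      qed
    qed
  qed
  ultimately show thesis using that[OF j] w(2) by simp
qed

text \<open>The end of the run is not a hole, so an item starts less than \<alpha> i beyond it. It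
  starts inside the window and therefore has type \<ge> i, a smaller one having weight
  \<open>m\<close>. Its departure makes the end of the run the only hole below \<open>x\<close>, and
  this hole replaces the item in the load.\<close>

lemma primed_after_departure:
  assumes s: "valid s" and A: "nh s = 0" and y: "y \<in> loose l s" and l: "l < m"
  obtains a where "a \<in> s" "lend s (fst a) = y + real l * \<alpha> i" "primed l (s - {a})"
proof -
  let ?u = "y + real l * \<alpha> i"
  have y': "y \<in> ends s" "x1 \<le> y" "y + L \<le> x" "load s y < real m" using y by (auto simp: loose_def)
  have uL: "?u + \<alpha> i \<le> y + L" using run_lt_L[OF l] by simp
  then have ux: "?u < x" using y'(3) size_i_pos by simp
  have yu: "y \<le> ?u" using size_i_pos by simp
  have ue: "?u \<in> ends s" by (rule run_end_in_ends[OF y])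
  have "?u \<notin> holes i s" using no_holes[OF s A] ux by force
  then obtain z j where z: "(z, j) \<in> s" "?u \<le> z" "z < ?u + \<alpha> i" "lend s z = ?u"
    using next_item[OF s ue] by blast
  have wz: "win y z" using z(2,3) uL yu unfolding win_def by linarith
  have ij: "i \<le> j"
  proof (rule ccontr)
    assume "\<not> i \<le> j"
    then show False using load_ge_item[OF s z(1) wz] y'(4) by simp
  qed
  let ?s = "s - {(z, j)}"
  have s': "valid ?s" by (rule valid_depart[OF s])
  have fit: "fits \<alpha> ?s i ?u" using fits_depart_large[OF s i_type z(1) ij] z(4) by simp
  have H: "holes i ?s = holes i s - {z + \<alpha> j, ?u} \<union> {?u}"
    using holes_depart[OF s i_type z(1)] fit z(4) by simp
  have pos: "pos ?s i = ?u"
  proof -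
    have "pos ?s i \<le> ?u" using H by (intro pos_le[OF s' i_type]) simp
    moreover have "pos ?s i \<in> holes i ?s" by (rule pos_in_holes[OF s' i_type])
    ultimately show ?thesis using H no_holes[OF s A, of "pos ?s i"] ux by auto
  qed
  have "load ?s y = load s y"
  proof -
    have "\<not> (win y (z + \<alpha> j) \<and> z + \<alpha> j \<in> holes i s)"
      using no_holes[OF s A, of "z + \<alpha> j"] y'(3) by (auto simp: win_def)
    moreover have "win y ?u" using yu uL size_i_pos by (simp add: win_def)
    moreover have "?u \<notin> holes i s" by fact
    ultimately show ?thesis using wz ij fit unfolding load_depart[OF s z(1)] z(4) by auto
  qed
  moreover have "y \<noteq> z + \<alpha> j" using z(2) yu valid_item(3)[OF s z(1)] by simp
  moreover have "y + real k * \<alpha> i \<noteq> z" if "k < l" for k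
  proof -
    have "real k * \<alpha> i < real l * \<alpha> i" using that size_i_pos by simp
    then show ?thesis using z(2) by simp
  qed
  ultimately have "y \<in> loose l ?s" using y by (auto simp: loose_def ends_depart[OF s z(1)])
  then have "primed l ?s" by (simp add: primed_def pos)
  then show thesis using that[of "(z, j)"] z by simp
qed

lemma primed_near:
  assumes "primed l s" "l < m"
  shows "pos s i < x"
proof -
  have "pos s i - real l * \<alpha> i + L \<le> x" using assms(1) by (simp add: primed_def loose_def)
  then show ?thesis using run_lt_L[OF assms(2)] size_i_pos by simp
qed

lemma primed_far:
  assumes s: "valid s" and a: "(z, j) \<in> s" and far: "x \<le> lend s z" and l: "l < m"
  shows "primed l (s - {(z, j)}) \<longleftrightarrow> primed l s"
proof -
  let ?s = "s - {(z, j)}"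
  have s': "valid ?s" by (rule valid_depart[OF s])
  note far' = depart_far(2)[OF s i_type a far]
  have lo: "loose l ?s = loose l s" using loose_far[OF s a far] l by simp
  have "pos ?s i = pos s i" if lt: "pos s i < x \<or> pos ?s i < x"
  proof -
    have "pos s i \<in> holes i ?s" if "pos s i < x" using far' pos_in_holes[OF s i_type] that by blast
    moreover have "pos ?s i \<in> holes i s" if "pos ?s i < x" using far' pos_in_holes[OF s' i_type] that by blast
    ultimately show ?thesis
      using lt pos_le[OF s i_type] pos_le[OF s' i_type] by (meson antisym le_less_trans)
  qed
  note eq = this
  show ?thesis
  proof (cases "pos s i < x \<or> pos ?s i < x")
    case True
    show ?thesis unfolding primed_def lo eq[OF True] ..
  next
    case False
    then show ?thesis using primed_near[OF _ l, of s] primed_near[OF _ l, of ?s] by blast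
  qed
qed

text \<open>The arriving i-item replaces, in the load, the hole that it fills at the end of the run,
  and by assumption it leaves no new hole behind it below \<open>x\<close>.\<close>

lemma primed_arrive:
  assumes s: "valid s" and B: "primed l s" and l: "l < m" and nk: "nonkill s i = 0"
  shows "pos s i - real l * \<alpha> i \<in> loose (Suc l) (arrive s i) - loose (Suc l) s"
proof -
  let ?y = "pos s i - real l * \<alpha> i"
  have y: "?y \<in> ends s" "x1 \<le> ?y" "?y + L \<le> x" "load s ?y < real m" "\<forall>k<l. (?y + real k * \<alpha> i, i) \<in> s"
    using B by (auto simp: primed_def loose_def)
  have w: "win ?y (pos s i)" using run_lt_L[OF l] size_i_pos by (simp add: win_def)
  have "\<not> (win ?y (pos s i + \<alpha> i) \<and> fits \<alpha> s i (pos s i + \<alpha> i))"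
    using nk y(3) by (auto simp: nonkill_def win_def)
  then have "load (arrive s i) ?y = load s ?y"
    using w pos_in_holes[OF s i_type] by (auto simp: load_arrive[OF s i_type])
  moreover have "(?y + real k * \<alpha> i, i) \<in> arrive s i" if "k < Suc l" for k
    using y(5) that by (cases "k = l") (auto simp: arrive_def)
  ultimately have "?y \<in> loose (Suc l) (arrive s i)"
    using y by (auto simp: loose_def ends_arrive)
  moreover have "(pos s i, i) \<notin> s" by (rule arrive_new[OF s i_type])
  then have "?y \<notin> loose (Suc l) s" by (auto simp: loose_def)
  ultimately show ?thesis by blast
qed

definition small_rate :: "packing \<Rightarrow> real" where "small_rate s = r * ET (small_far s)"

lemma ET_small_far: "0 \<le> ET (small_far s)" "ET (small_far s) \<le> 1"
  and int_small_far: "integrable (measure_pmf arrival_type) (small_far s)"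
proof -
  have "\<bar>ET (small_far s)\<bar> \<le> 1"
    by (rule expectation_arrival_type_le, simp add: small_far_def)
  then show "ET (small_far s) \<le> 1" by auto
  show "0 \<le> ET (small_far s)" by (simp add: small_far_def)
  show "integrable (measure_pmf arrival_type) (small_far s)"
    by (rule integrable_arrival_type[where C = 1], simp add: small_far_def)
qed

lemma small_rate_bounds: "0 \<le> small_rate s" "small_rate s \<le> r"
  unfolding small_rate_def using ET_small_far[of s] r_pos by (auto simp: mult_left_le)

lemma int_small_rate: "integrable (measure_pmf \<pi>) small_rate"
  using small_rate_bounds by (intro integrable_E[where C = r]) auto

lemma int_nloose: "integrable (measure_pmf \<pi>) (\<lambda>s. real (nloose l s))"
  using nloose_le_M by (intro integrable_E[where C = M]) auto

lemma int_primed: "integrable (measure_pmf \<pi>) (\<lambda>s. of_bool (primed l s) :: real)"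
  by (intro integrable_E[where C = 1]) auto

text \<open>
  In the absence of holes the item that blocks the continuation of a run exists, and its departure
  primes the window.
\<close>

lemma E_nloose_le_primed:
  assumes l: "l < m"
  shows "E (\<lambda>s. real (nloose l s) * of_bool (nh s = 0)) \<le> (r + M) * E (\<lambda>s. of_bool (primed l s))"
proof -
  let ?f = "\<lambda>s. of_bool (primed l s) :: real"
  have fB: "\<bar>?f s\<bar> \<le> 1" if "valid s" for s by simp
  have floc: "?f (s - {(y, j)}) = ?f s" if "valid s" "(y, j) \<in> s" "x \<le> lend s y" for s y j
    using primed_far[OF that l] by simp
  have Ef: "E (drift r ?f) = 0" by (rule E_drift(1)[OF fB floc])
  have fbd: "\<bar>drift r ?f s\<bar> \<le> 2 * 1 * r + 2 * 1 * M" if "valid s" for s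
    by (rule E_drift(2)[OF fB floc that])
  have pt: "real (nloose l s) * of_bool (nh s = 0) - (r + M) * ?f s \<le> drift r ?f s" if s: "valid s" for s
  proof (cases "nh s = 0")
    case True
    have np: "\<not> primed l s" using primed_near[OF _ l] nh_pos_iff[OF s] True by auto
    let ?A = "{a \<in> s. primed l (s - {a})}"
    have fin: "finite ?A" using valid_finite[OF s] by simp
    have "loose l s \<subseteq> (\<lambda>a. lend s (fst a) - real l * \<alpha> i) ` ?A"
    proof
      fix y assume "y \<in> loose l s"
      then obtain a where "a \<in> s" "lend s (fst a) = y + real l * \<alpha> i" "primed l (s - {a})"
        using primed_after_departure[OF s True _ l] by blast
      then show "y \<in> (\<lambda>a. lend s (fst a) - real l * \<alpha> i) ` ?A" by (intro image_eqI[of _ _ a]) auto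
    qed
    then have "nloose l s \<le> card ?A" unfolding nloose_def using fin by (rule surj_card_le[rotated])
    also have "real (card ?A) = (\<Sum>a\<in>s. ?f (s - {a}) - ?f s)"
    proof -
      have "(\<Sum>a\<in>s. ?f (s - {a}) - ?f s) = (\<Sum>a\<in>?A. 1)"
        using np valid_finite[OF s] by (intro sum.mono_neutral_cong_right) auto
      then show ?thesis by simp
    qed
    finally have "real (nloose l s) \<le> (\<Sum>a\<in>s. ?f (s - {a}) - ?f s)" by simp
    moreover have "0 \<le> r * ET (\<lambda>j. ?f (arrive s j) - ?f s)" using np r_pos by simp
    ultimately show ?thesis using True np unfolding drift_def by simp
  next
    case False
    \<comment> \<open>With holes around it suffices that a primed state is left at rate at most
      \<open>r + M\<close>: by arrivals and by the departures that matter below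
      \<open>x\<close>.\<close>
    have "- ?f s = ET (\<lambda>j. - ?f s)" by simp
    also have "\<dots> \<le> ET (\<lambda>j. ?f (arrive s j) - ?f s)"
      by (intro integral_mono_AE AE_arrival_type integrable_arrival_type[where C = 1]) auto
    finally have "r * - ?f s \<le> r * ET (\<lambda>j. ?f (arrive s j) - ?f s)" using r_pos by (intro mult_left_mono) auto
    moreover have "- M * ?f s \<le> (\<Sum>a\<in>s. ?f (s - {a}) - ?f s)"
    proof -
      have "M * - ?f s \<le> real (card (near x s)) * - ?f s"
        unfolding M_def using card_near_le[OF s x_nonneg] by (intro mult_right_mono_neg) auto
      also have "\<dots> = (\<Sum>a\<in>near x s. - ?f s)" by simp
      also have "\<dots> \<le> (\<Sum>a\<in>near x s. ?f (s - {a}) - ?f s)" by (intro sum_mono) auto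
      also have "\<dots> = (\<Sum>a\<in>s. ?f (s - {a}) - ?f s)"
        using valid_finite[OF s] floc[OF s]
        by (intro sum.mono_neutral_left) (auto simp: near_def, (meson not_le)+)
      finally show ?thesis by simp
    qed
    ultimately show ?thesis using False unfolding drift_def by (simp add: algebra_simps)
  qed
  have int0: "integrable (measure_pmf \<pi>) (\<lambda>s. real (nloose l s) * of_bool (nh s = 0))"
    using nloose_le_M M_ge_1 by (intro integrable_E[where C = M]) auto
  have "E (\<lambda>s. real (nloose l s) * of_bool (nh s = 0) - (r + M) * ?f s) \<le> E (drift r ?f)"
    using int0 int_primed integrable_E[OF fbd]
    by (intro integral_mono_AE AE_stationary[OF r_pos stat] pt) auto
  then show ?thesis unfolding Ef using int0 int_primed by simp
qed

text \<open>In a primed state the next i-item, at rate \<open>p i * r\<close>, creates a window with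
  a run of length \<open>l + 1\<close> unless it leaves a hole behind. In equilibrium these
  creations are balanced by destructions: at most \<open>l + 3\<close> departures for each window,
  and the rare harmful arrivals.\<close>

lemma E_primed_le:
  assumes l: "l < m"
  shows "p i * r * E (\<lambda>s. of_bool (primed l s)) \<le> (real l + 3) * E (\<lambda>s. real (nloose (Suc l) s))
     + (cE + 1) * (E J_rate + E small_rate)"
proof -
  let ?f = "\<lambda>s. real (nloose (Suc l) s)"
  have fB: "\<bar>?f s\<bar> \<le> M" if "valid s" for s using nloose_le_M[OF that] by simp
  have floc: "?f (s - {(y, j)}) = ?f s" if "valid s" "(y, j) \<in> s" "x \<le> lend s y" for s y j
    using loose_far[OF that, of "Suc l"] l by (simp add: nloose_def)
  have Ef: "E (drift r ?f) = 0" by (rule E_drift(1)[OF fB floc])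
  have fbd: "\<bar>drift r ?f s\<bar> \<le> 2 * M * r + 2 * M * M" if "valid s" for s
    by (rule E_drift(2)[OF fB floc that])
  have pt: "p i * r * of_bool (primed l s) - (cE + 1) * (J_rate s + small_rate s) - (real l + 3) * ?f s \<le> drift r ?f s"
    if s: "valid s" for s
  proof -
    \<comment> \<open>The coefficient \<open>cE + 1\<close> covers the at most \<open>cE\<close>
      windows that a harmful arrival destroys and the one extension that fails when the i-item
      leaves a hole behind it.\<close>
    have a: "of_bool (primed l s) * of_bool (j = i) - (cE + 1) * (nonkill s j + small_far s j) \<le> ?f (arrive s j) - ?f s"
      if j: "j \<in> I" for j
    proof -
      note s' = valid_arrive[OF s j]
      have nn: "0 \<le> nonkill s j" "0 \<le> small_far s j" by (auto simp: nonkill_def small_far_def)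
      have h: "?f s - ?f (arrive s j) \<le> cE * (nonkill s j + small_far s j)"
        using card_diff_le[OF finite_loose[OF s] finite_loose[OF s'], of "Suc l" "Suc l"] nloose_arrive_harm[OF s j, of "Suc l"]
        unfolding nloose_def by linarith
      show ?thesis
      proof (cases "primed l s \<and> j = i \<and> nonkill s j = 0")
        case True
        then have z: "nonkill s j + small_far s j = 0" by (auto simp: small_far_def)
        then have "loose (Suc l) s \<subseteq> loose (Suc l) (arrive s j)"
          using loose_arrive_harm(2)[OF s j, of _ "Suc l"] by force
        then have "loose (Suc l) s \<subset> loose (Suc l) (arrive s j)"
          using primed_arrive[OF s _ l] True by (metis Diff_iff psubsetI)
        then have "nloose (Suc l) s < nloose (Suc l) (arrive s j)"
          unfolding nloose_def using finite_loose[OF s'] by (rule psubset_card_mono[rotated])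
        then show ?thesis using z True by simp
      next
        case False
        have "of_bool (primed l s) * of_bool (j = i) \<le> nonkill s j + small_far s j"
          using False nn by (auto simp: nonkill_def)
        then show ?thesis using h by (simp add: algebra_simps)
      qed
    qed
    have "p i * of_bool (primed l s) - (cE + 1) * (ET (nonkill s) + ET (small_far s))
       = ET (\<lambda>j. of_bool (primed l s) * of_bool (j = i) - (cE + 1) * (nonkill s j + small_far s j))"
    proof -
      have "integrable (measure_pmf arrival_type) (\<lambda>j. of_bool (j = i) :: real)"
        by (intro integrable_arrival_type[where C = 1]) auto
      then show ?thesis using int_nonkill int_small_far ET_type by simp
    qed
    also have "\<dots> \<le> ET (\<lambda>j. ?f (arrive s j) - ?f s)"
    proof (intro integral_mono_AE AE_arrival_type a integrable_change[OF fB s])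
      have "integrable (measure_pmf arrival_type) (\<lambda>j. of_bool (j = i) :: real)"
        by (intro integrable_arrival_type[where C = 1]) auto
      then show "integrable (measure_pmf arrival_type)
        (\<lambda>j. of_bool (primed l s) * of_bool (j = i) - (cE + 1) * (nonkill s j + small_far s j))"
        using int_nonkill int_small_far by simp
    qed
    finally have "r * (p i * of_bool (primed l s) - (cE + 1) * (ET (nonkill s) + ET (small_far s))) \<le> r * ET (\<lambda>j. ?f (arrive s j) - ?f s)"
      using r_pos by (intro mult_left_mono) auto
    moreover have "- ((real l + 3) * ?f s) \<le> (\<Sum>a\<in>s. ?f (s - {a}) - ?f s)"
    proof -
      have "(\<Sum>a\<in>s. - real (card (loose (Suc l) s - loose (Suc l) (s - {a})))) \<le> (\<Sum>a\<in>s. ?f (s - {a}) - ?f s)"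
      proof (rule sum_mono)
        fix a
        show "- real (card (loose (Suc l) s - loose (Suc l) (s - {a}))) \<le> ?f (s - {a}) - ?f s"
          using card_diff_le[OF finite_loose[OF s] finite_loose[OF valid_depart[OF s, of a]], of "Suc l" "Suc l"]
          unfolding nloose_def by linarith
      qed
      then show ?thesis using nloose_depart_harm[OF s, of "Suc l"] by (simp add: sum_negf add.commute)
    qed
    ultimately show ?thesis unfolding drift_def J_rate_def small_rate_def by (simp add: algebra_simps)
  qed
  have "E (\<lambda>s. p i * r * of_bool (primed l s) - (cE + 1) * (J_rate s + small_rate s) - (real l + 3) * ?f s) \<le> E (drift r ?f)"
    using int_basic int_small_rate int_primed int_nloose integrable_E[OF fbd]
    by (intro integral_mono_AE AE_stationary[OF r_pos stat] pt) auto
  then show ?thesis unfolding Ef using int_basic int_small_rate int_primed int_nloose by simp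
qed

section \<open>Greedy cover\<close>

definition ni :: "real \<Rightarrow> packing \<Rightarrow> real" where
  "ni y = wsum (\<lambda>z k. of_bool (y \<le> z \<and> z < x \<and> k = i))"

definition bad :: "packing \<Rightarrow> real set" where
  "bad s = {y \<in> ends s. lend s x1 \<le> y \<and> y < x \<and>
     (y = lend s x1 \<or> y \<in> loose 0 s \<or> (\<exists>(z, k)\<in>s. k < i \<and> win y z) \<or> x < y + L)}"

text \<open>From a bad end the cover jumps over the next item. Without holes this wastes a gap
  shorter than \<alpha> i and the item itself, of which no more than \<open>x\<close> matters below
  the level \<open>x\<close>.\<close>

definition bad_cost :: "real \<Rightarrow> packing \<Rightarrow> real" where
  "bad_cost y s = wsum (\<lambda>z k. of_bool (lend s z \<in> bad s \<and> y \<le> lend s z) * (\<alpha> i + of_bool (z < x) * min (\<alpha> k) x)) s"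

definition smalls :: "packing \<Rightarrow> real" where
  "smalls = wsum (\<lambda>z k. of_bool (x1 \<le> z \<and> z < x \<and> k < i))"

text \<open>Truncation at \<open>x\<close> makes this functional bounded; its mean is controlled by
  the finite mean item size.\<close>

definition tail :: "nat \<Rightarrow> packing \<Rightarrow> real" where
  "tail J = wsum (\<lambda>z k. of_bool (z < x \<and> J < k) * min (\<alpha> k) x)"

lemma ni_antimono: "y \<le> y' \<Longrightarrow> ni y' s \<le> ni y s"
  unfolding ni_def by (intro wsum_mono) auto

lemma ni_nonneg: "0 \<le> ni y s"
  unfolding ni_def by (intro wsum_nonneg) auto

lemma cost_nonneg: "(z, k) \<in> s \<Longrightarrow> valid s \<Longrightarrow> 0 \<le> of_bool A * (\<alpha> i + of_bool (z < x) * min (\<alpha> k) x)"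
  using size_i_pos valid_item(3)[of s z k] x_nonneg by (auto intro!: mult_nonneg_nonneg add_nonneg_nonneg)

lemma bad_cost_antimono: "valid s \<Longrightarrow> y \<le> y' \<Longrightarrow> bad_cost y' s \<le> bad_cost y s"
  unfolding bad_cost_def using cost_nonneg[of _ _ s True] by (intro wsum_mono) auto

lemma bad_cost_nonneg: "valid s \<Longrightarrow> 0 \<le> bad_cost y s"
  unfolding bad_cost_def using cost_nonneg[of _ _ s] by (intro wsum_nonneg) auto

lemma bad_cost_step:
  assumes s: "valid s" and z: "(z, k) \<in> s" "lend s z \<in> bad s" "lend s z < y'"
  shows "bad_cost y' s + (\<alpha> i + of_bool (z < x) * min (\<alpha> k) x) \<le> bad_cost (lend s z) s"
proof -
  let ?c = "\<lambda>z k. \<alpha> i + of_bool (z < x) * min (\<alpha> k) x"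
  have fin: "finite s" by (rule valid_finite[OF s])
  have "?c z k = (\<Sum>a\<in>{(z, k)}. case a of (w, l) \<Rightarrow> ?c w l)" by simp
  also have "\<dots> = (\<Sum>a\<in>s. case a of (w, l) \<Rightarrow> of_bool ((w, l) = (z, k)) * ?c w l)"
    using fin z(1) by (intro sum.mono_neutral_cong_left) auto
  finally have "bad_cost y' s + ?c z k = (\<Sum>a\<in>s. case a of (w, l) \<Rightarrow>
      of_bool (lend s w \<in> bad s \<and> y' \<le> lend s w) * ?c w l + of_bool ((w, l) = (z, k)) * ?c w l)"
    by (simp add: bad_cost_def wsum_def sum.distrib case_prod_beta)
  also have "\<dots> \<le> bad_cost (lend s z) s"
    unfolding bad_cost_def wsum_def
  proof (intro sum_mono, clarify)
    fix w l assume w: "(w, l) \<in> s"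
    have "0 \<le> ?c w l" using cost_nonneg[OF w s, of True] by simp
    moreover have "(of_bool (lend s w \<in> bad s \<and> y' \<le> lend s w) + of_bool ((w, l) = (z, k)) :: real)
        \<le> of_bool (lend s w \<in> bad s \<and> lend s z \<le> lend s w)"
      using z by auto
    ultimately show "of_bool (lend s w \<in> bad s \<and> y' \<le> lend s w) * ?c w l + of_bool ((w, l) = (z, k)) * ?c w l
      \<le> of_bool (lend s w \<in> bad s \<and> lend s z \<le> lend s w) * ?c w l"
      unfolding distrib_right[symmetric] by (rule mult_right_mono[rotated])
  qed
  finally show ?thesis .
qed

text \<open>
  A window that is not bad has at least \<open>m\<close> items of types \<open>\<ge> i\<close> starting in it. Since its length is
  \<open>m * \<alpha> i\<close>, at most about \<open>\<alpha> i / \<Delta>\<close> of them are not \<open>i\<close>-items.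
\<close>

lemma good_step:
  assumes s: "valid s" and A: "nh s = 0" and m2: "2 \<le> m" and \<Delta>: "0 < \<Delta>"
    and gap: "\<And>j. j \<in> I \<Longrightarrow> i < j \<Longrightarrow> \<alpha> i + \<Delta> \<le> \<alpha> j"
    and y: "y \<in> ends s" "lend s x1 \<le> y" "y < x" "y \<notin> bad s"
  obtains y' where "y' \<in> ends s" "y < y'" "y' < x" "(real m - 1) * \<alpha> i \<le> y' - y"
    "y' - y - \<alpha> i * (ni y s - ni y' s) \<le> \<alpha> i + \<alpha> i * (\<alpha> i / \<Delta>)"
proof -
  have fin: "finite s" by (rule valid_finite[OF s])
  have yL: "y + L \<le> x" "y \<notin> loose 0 s" "\<And>z k. (z, k) \<in> s \<Longrightarrow> win y z \<Longrightarrow> i \<le> k" "y \<noteq> lend s x1"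
    using y by (force simp: bad_def)+
  have "x1 \<le> y" using lend(3)[OF s x1_nonneg y(1)] y(2) yL(4) by force
  then have ld: "real m \<le> load s y" using y(1) yL(1,2) by (auto simp: loose_def)
  let ?B = "{(z, k) \<in> s. win y z}"
  have "hcount i {y..<y + L} s = 0"
    using no_holes[OF s A] yL(1) finite_holes[OF s] by (fastforce simp: hcount_def)
  then have "load s y = wsum (\<lambda>z k. of_bool (win y z) * (if k < i then real m else 1)) s"
    by (simp add: load_def win_def)
  also have "\<dots> = (\<Sum>a\<in>?B. 1)"
    unfolding wsum_def using fin yL(3)
    by (intro sum.mono_neutral_cong_right) (auto simp: not_less[symmetric])
  finally have cardB: "m \<le> card ?B" using ld by simp
  let ?E = "ends s \<inter> {..<y + L}"
  \<comment> \<open>The cover advances to the last item end inside the window; at most one item that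
    starts in the window reaches beyond it.\<close>
  define y' where "y' = Max ?E"
  have finE: "finite ?E" using ends_finite[OF s] by simp
  have yE: "y \<in> ?E" using y(1) L_pos by simp
  have y'E: "y' \<in> ?E" unfolding y'_def using finE yE by (intro Max_in) auto
  have y'max: "e \<le> y'" if "e \<in> ends s" "e < y + L" for e
    unfolding y'_def using finE that by (intro Max_ge) auto
  let ?B' = "{(z, k) \<in> s. win y z \<and> z + \<alpha> k \<le> y'}"
  have finB: "finite ?B" "finite ?B'" using fin by (rule finite_subset[rotated], auto)+
  have "card (?B - ?B') \<le> 1"
  proof (rule card_le_oneI)
    fix a b assume ab: "a \<in> ?B - ?B'" "b \<in> ?B - ?B'"
    obtain z k w l where ab': "a = (z, k)" "b = (w, l)" by (cases a, cases b) auto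
    have z: "(z, k) \<in> s" "win y z" "y + L \<le> z + \<alpha> k" and w: "(w, l) \<in> s" "win y w" "y + L \<le> w + \<alpha> l"
      using ab y'max[OF end_in_ends[of z k s]] y'max[OF end_in_ends[of w l s]] unfolding ab' by force+
    have "\<not> z < w" using valid_less[OF s z(1) w(1)] z w by (auto simp: win_def)
    moreover have "\<not> w < z" using valid_less[OF s w(1) z(1)] z w by (auto simp: win_def)
    ultimately have "z = w" by simp
    then show "a = b" using valid_same_start[OF s z(1), of l] w(1) unfolding ab' by simp
  qed
  moreover have "card ?B \<le> card ?B' + card (?B - ?B')"
  proof -
    have "card ?B \<le> card (?B' \<union> (?B - ?B'))" using finB by (intro card_mono) auto
    then show ?thesis using card_Un_le[of ?B' "?B - ?B'"] by linarith
  qed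
  ultimately have cardB': "m - 1 \<le> card ?B'" using cardB by linarith
  let ?Q = "{(z, k) \<in> s. win y z \<and> z + \<alpha> k \<le> y' \<and> k = i}" and ?R = "{(z, k) \<in> s. win y z \<and> z + \<alpha> k \<le> y' \<and> k \<noteq> i}"
  have finQ: "finite ?Q" "finite ?R" using fin by (rule finite_subset[rotated], auto)+
  have split: "?B' = ?Q \<union> ?R" "?Q \<inter> ?R = {}" by auto
  have cQR: "real m - 1 \<le> real (card ?Q) + real (card ?R)"
    using cardB' m2 unfolding split(1) by (subst (asm) card_Un_disjoint) (use finQ split(2) in auto)
  have yy': "y \<le> y'" using y'max[OF y(1)] L_pos by simp
  have len: "(\<Sum>(z, k)\<in>?B'. \<alpha> k) \<le> y' - y"
    using yy' valid_item(3)[OF s] by (intro packed_sum_le[OF s]) (auto simp: win_def less_imp_le)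
  have "(\<Sum>(z, k)\<in>?B'. \<alpha> k) = (\<Sum>(z, k)\<in>?Q. \<alpha> k) + (\<Sum>(z, k)\<in>?R. \<alpha> k)"
    unfolding split(1) using finQ split(2) by (rule sum.union_disjoint)
  moreover have "(\<Sum>(z, k)\<in>?Q. \<alpha> k) = real (card ?Q) * \<alpha> i"
  proof -
    have "(\<Sum>(z, k)\<in>?Q. \<alpha> k) = (\<Sum>a\<in>?Q. \<alpha> i)" by (intro sum.cong) auto
    then show ?thesis by simp
  qed
  moreover have "real (card ?R) * (\<alpha> i + \<Delta>) \<le> (\<Sum>(z, k)\<in>?R. \<alpha> k)"
  proof -
    have "(\<Sum>a\<in>?R. \<alpha> i + \<Delta>) \<le> (\<Sum>(z, k)\<in>?R. \<alpha> k)"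
    proof (rule sum_mono, clarify)
      fix z k assume "(z, k) \<in> s" "win y z" "k \<noteq> i"
      then show "\<alpha> i + \<Delta> \<le> \<alpha> k" using gap valid_item(1)[OF s] yL(3) by force
    qed
    then show ?thesis by simp
  qed
  ultimately have tot: "(real (card ?Q) + real (card ?R)) * \<alpha> i + real (card ?R) * \<Delta> \<le> y' - y"
    using len by (simp add: algebra_simps)
  have lt: "y' - y < real m * \<alpha> i" using y'E by (simp add: L_def)
  have step: "(real m - 1) * \<alpha> i \<le> (real (card ?Q) + real (card ?R)) * \<alpha> i"
    using cQR size_i_pos by (intro mult_right_mono) auto
  have R0: "0 \<le> real (card ?R) * \<Delta>" using \<Delta> by simp
  have far: "(real m - 1) * \<alpha> i \<le> y' - y" using tot step R0 by linarith
  \<comment> \<open>At least \<open>m - 1\<close> items fit into less than \<open>m\<close> lengths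
    \<alpha> i, so the excess \<Delta> of each item of another type comes out of one length \<alpha>
    i.\<close>
  have "real (card ?R) * \<Delta> \<le> \<alpha> i" using tot step lt by (simp add: algebra_simps)
  then have R: "real (card ?R) \<le> \<alpha> i / \<Delta>" using \<Delta> by (simp add: field_simps)
  have Q: "real (card ?Q) \<le> ni y s - ni y' s"
  proof -
    have "ni y s - ni y' s = (\<Sum>(z, k)\<in>s. of_bool (y \<le> z \<and> z < x \<and> k = i) - of_bool (y' \<le> z \<and> z < x \<and> k = i))"
      unfolding ni_def wsum_def by (simp add: sum_subtractf[symmetric] case_prod_beta)
    also have "\<dots> \<ge> (\<Sum>(z, k)\<in>s. of_bool ((z, k) \<in> ?Q))"
    proof (rule sum_mono, clarify)
      fix z k assume zk: "(z, k) \<in> s"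
      show "(of_bool ((z, k) \<in> ?Q) :: real) \<le> of_bool (y \<le> z \<and> z < x \<and> k = i) - of_bool (y' \<le> z \<and> z < x \<and> k = i)"
        using yy' yL(1) valid_item(3)[OF s zk] by (auto simp: win_def)
    qed
    also have "(\<Sum>(z, k)\<in>s. of_bool ((z, k) \<in> ?Q)) = (\<Sum>a\<in>?Q. 1 :: real)"
      using fin by (intro sum.mono_neutral_cong_right) auto
    finally show ?thesis by simp
  qed
  have "y' - y - \<alpha> i * (ni y s - ni y' s) \<le> y' - y - \<alpha> i * real (card ?Q)"
    using Q size_i_pos by simp
  also have "\<dots> = (y' - y) - (real (card ?Q) + real (card ?R)) * \<alpha> i + real (card ?R) * \<alpha> i"
    by (simp add: algebra_simps)
  also have "\<dots> \<le> real m * \<alpha> i - (real m - 1) * \<alpha> i + \<alpha> i / \<Delta> * \<alpha> i"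
    using lt step mult_right_mono[OF R, of "\<alpha> i"] size_i_pos by linarith
  finally have c: "y' - y - \<alpha> i * (ni y s - ni y' s) \<le> \<alpha> i + \<alpha> i * (\<alpha> i / \<Delta>)"
    by (simp add: algebra_simps)
  have "0 < (real m - 1) * \<alpha> i" using m2 size_i_pos by simp
  then have "y < y'" using far by simp
  moreover have "y' < x" using y'E yL(1) by simp
  ultimately show thesis using that y'E far c by blast
qed

text \<open>Induction on the number of ends ahead. A good end allows an advance of at least
  \<open>(real m - 1) * \<alpha> i\<close> with bounded waste, and \<kappa> is this waste per unit
  of length. At a bad end one item is skipped and charged to \<open>bad_cost\<close>, each bad end
  only once.\<close>

lemma greedy_cover:
  assumes s: "valid s" and A: "nh s = 0" and m2: "2 \<le> m" and \<Delta>: "0 < \<Delta>"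
    and gap: "\<And>j. j \<in> I \<Longrightarrow> i < j \<Longrightarrow> \<alpha> i + \<Delta> \<le> \<alpha> j"
    and \<kappa>: "\<kappa> = (\<alpha> i + \<alpha> i * (\<alpha> i / \<Delta>)) / ((real m - 1) * \<alpha> i)"
    and y: "y \<in> ends s" "lend s x1 \<le> y" "y < x"
  shows "x - y - \<alpha> i * ni y s \<le> \<kappa> * (x - y) + bad_cost y s"
  using y
proof (induction "card (ends s \<inter> {y..<x})" arbitrary: y rule: less_induct)
  case less
  have m1: "0 < (real m - 1) * \<alpha> i" using m2 size_i_pos by simp
  have \<kappa>0: "0 \<le> \<kappa>" unfolding \<kappa> using size_i_pos \<Delta> m1 by simp
  have smaller: "card (ends s \<inter> {y'..<x}) < card (ends s \<inter> {y..<x})" if "y < y'" for y'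
  proof (rule psubset_card_mono)
    have "y \<in> ends s \<inter> {y..<x}" "y \<notin> ends s \<inter> {y'..<x}" "ends s \<inter> {y'..<x} \<subseteq> ends s \<inter> {y..<x}"
      using that less.prems by auto
    then show "ends s \<inter> {y'..<x} \<subset> ends s \<inter> {y..<x}" by blast
  qed (use ends_finite[OF s] in simp)
  show ?case
  proof (cases "y \<in> bad s")
    case False
    obtain y' where y': "y' \<in> ends s" "y < y'" "y' < x" "(real m - 1) * \<alpha> i \<le> y' - y"
      "y' - y - \<alpha> i * (ni y s - ni y' s) \<le> \<alpha> i + \<alpha> i * (\<alpha> i / \<Delta>)"
      using good_step[OF s A m2 \<Delta> gap less.prems False] by blast
    have "x - y' - \<alpha> i * ni y' s \<le> \<kappa> * (x - y') + bad_cost y' s"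
      using less.hyps[OF smaller[OF y'(2)] y'(1)] y' less.prems by simp
    moreover have "\<alpha> i + \<alpha> i * (\<alpha> i / \<Delta>) \<le> \<kappa> * (y' - y)"
    proof -
      have "(real m - 1) * \<alpha> i \<noteq> 0" using m1 by (rule less_imp_neq[symmetric])
      then have "\<kappa> * ((real m - 1) * \<alpha> i) = \<alpha> i + \<alpha> i * (\<alpha> i / \<Delta>)"
        unfolding \<kappa> times_divide_eq_left by (rule nonzero_mult_div_cancel_right)
      then show ?thesis using mult_left_mono[OF y'(4) \<kappa>0] by simp
    qed
    moreover have "bad_cost y' s \<le> bad_cost y s" using y'(2) by (intro bad_cost_antimono[OF s]) simp
    ultimately show ?thesis using y'(5) by (simp add: algebra_simps)
  next
    case True
    have "y \<notin> holes i s" using no_holes[OF s A] less.prems(3) by force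
    then obtain z k where z: "(z, k) \<in> s" "y \<le> z" "z < y + \<alpha> i" "lend s z = y"
      using next_item[OF s less.prems(1)] by blast
    have ak: "0 < \<alpha> k" by (rule valid_item(3)[OF s z(1)])
    let ?c = "\<alpha> i + of_bool (z < x) * min (\<alpha> k) x"
    have step: "bad_cost y' s + ?c \<le> bad_cost y s" if "y < y'" for y'
      using bad_cost_step[OF s z(1), of y'] z(4) True that by simp
    show ?thesis
    proof (cases "z + \<alpha> k < x")
      case lt: True
      let ?y' = "z + \<alpha> k"
      have yy: "y < ?y'" using z(2) ak by simp
      have "x - ?y' - \<alpha> i * ni ?y' s \<le> \<kappa> * (x - ?y') + bad_cost ?y' s"
        using less.hyps[OF smaller[OF yy] end_in_ends[OF z(1)]] lt yy less.prems by simp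
      moreover have "\<alpha> i * ni ?y' s \<le> \<alpha> i * ni y s"
        using ni_antimono[of y ?y' s] yy size_i_pos by simp
      moreover have "\<kappa> * (x - ?y') \<le> \<kappa> * (x - y)" using \<kappa>0 yy by (intro mult_left_mono) auto
      moreover have "?c = \<alpha> i + \<alpha> k" using lt ak valid_item(2)[OF s z(1)] by simp
      ultimately show ?thesis using step[OF yy] z(3) by linarith
    next
      case False
      have "x - y \<le> ?c"
      proof (cases "z < x")
        case True
        have "x - z \<le> min (\<alpha> k) x" using False valid_item(2)[OF s z(1)] by simp
        moreover have "?c = \<alpha> i + min (\<alpha> k) x" using True by simp
        ultimately show ?thesis using z(3) by linarith
      qed (use z(3) in simp)
      moreover have "0 \<le> \<alpha> i * ni y s" using size_i_pos ni_nonneg by simp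
      moreover have "0 \<le> \<kappa> * (x - y)" using \<kappa>0 less.prems by simp
      \<comment> \<open>The point \<open>y + 1\<close> stands for any point to the right of
        \<open>y\<close>; it serves to split off the charge of \<open>y\<close>.\<close>
      moreover have "0 \<le> bad_cost (y + 1) s" by (rule bad_cost_nonneg[OF s])
      ultimately show ?thesis using step[of "y + 1"] by linarith
    qed
  qed
qed

text \<open>One end near \<open>x1\<close>, the loose ones, and at most \<open>cE\<close> ends
  around each small item beyond \<open>x1\<close> and around the level \<open>x\<close>.\<close>

lemma card_bad_le:
  assumes s: "valid s"
  shows "real (card (bad s)) \<le> 1 + real (nloose 0 s) + cE * smalls s + cE"
proof -
  let ?W = "\<lambda>c. ends s \<inter> {c - L..<c + L}"
  let ?S = "{(z, k) \<in> s. x1 \<le> z \<and> z < x \<and> k < i}"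
  have finS: "finite ?S" using valid_finite[OF s] by (rule finite_subset[rotated]) auto
  have fe: "finite (ends s)" by (rule ends_finite[OF s])
  have "bad s \<subseteq> {lend s x1} \<union> loose 0 s \<union> (\<Union>a\<in>?S. ?W (fst a)) \<union> ?W x"
  proof
    fix y assume "y \<in> bad s"
    then have y: "y \<in> ends s" "lend s x1 \<le> y" "y < x"
      "y = lend s x1 \<or> y \<in> loose 0 s \<or> (\<exists>(z, k)\<in>s. k < i \<and> win y z) \<or> x < y + L"
      by (auto simp: bad_def)
    have ge: "x1 \<le> y" if "y \<noteq> lend s x1" using lend(3)[OF s x1_nonneg y(1)] y(2) that by force
    show "y \<in> {lend s x1} \<union> loose 0 s \<union> (\<Union>a\<in>?S. ?W (fst a)) \<union> ?W x"
    proof (cases "y = lend s x1 \<or> y \<in> loose 0 s \<or> x < y + L")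
      case True
      then show ?thesis using y L_pos by auto
    next
      case False
      then obtain z k where z: "(z, k) \<in> s" "k < i" "win y z" using y(4) by blast
      then have "(z, k) \<in> ?S" using False ge by (auto simp: win_def)
      moreover have "y \<in> ?W z" using z(3) y(1) L_pos by (auto simp: win_def)
      ultimately show ?thesis by force
    qed
  qed
  then have "card (bad s) \<le> card ({lend s x1} \<union> loose 0 s \<union> (\<Union>a\<in>?S. ?W (fst a)) \<union> ?W x)"
    using finS fe finite_loose[OF s] by (intro card_mono) auto
  also have "\<dots> \<le> card ({lend s x1} \<union> loose 0 s \<union> (\<Union>a\<in>?S. ?W (fst a))) + card (?W x)" by (rule card_Un_le)
  also have "card ({lend s x1} \<union> loose 0 s \<union> (\<Union>a\<in>?S. ?W (fst a))) \<le> card ({lend s x1} \<union> loose 0 s) + card (\<Union>a\<in>?S. ?W (fst a))"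
    by (rule card_Un_le)
  also have "card ({lend s x1} \<union> loose 0 s) \<le> card {lend s x1} + card (loose 0 s)" by (rule card_Un_le)
  also have "card (\<Union>a\<in>?S. ?W (fst a)) \<le> (\<Sum>a\<in>?S. card (?W (fst a)))" by (rule card_UN_le[OF finS])
  finally have "real (card (bad s)) \<le> real (card {lend s x1} + card (loose 0 s) + (\<Sum>a\<in>?S. card (?W (fst a))) + card (?W x))"
    by (simp only: of_nat_le_iff)
  also have "\<dots> = 1 + real (nloose 0 s) + (\<Sum>a\<in>?S. real (card (?W (fst a)))) + real (card (?W x))"
    by (simp add: nloose_def)
  also have "(\<Sum>a\<in>?S. real (card (?W (fst a)))) \<le> (\<Sum>a\<in>?S. cE)"
    by (intro sum_mono card_ends_window[OF s])
  also have "(\<Sum>a\<in>?S. cE) = cE * smalls s"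
  proof -
    have "smalls s = (\<Sum>a\<in>?S. 1)"
      unfolding smalls_def wsum_def using valid_finite[OF s] by (intro sum.mono_neutral_cong_right) auto
    then show ?thesis by simp
  qed
  also have "real (card (?W x)) \<le> cE" by (rule card_ends_window[OF s])
  finally show ?thesis by simp
qed

text \<open>Items up to type \<open>J\<close> cost a bounded amount for each bad end; the longer
  ones are charged to \<open>tail J\<close> wherever they lie.\<close>

lemma bad_cost_le:
  assumes s: "valid s" and J: "J \<in> I"
  shows "bad_cost y s \<le> (\<alpha> i + \<alpha> J) * real (card (bad s)) + tail J s"
proof -
  have fin: "finite s" by (rule valid_finite[OF s])
  let ?A = "{(z, k) \<in> s. lend s z \<in> bad s}"
  have "bad_cost y s \<le> (\<Sum>(z, k)\<in>s. of_bool (lend s z \<in> bad s) * (\<alpha> i + \<alpha> J) + of_bool (z < x \<and> J < k) * min (\<alpha> k) x)"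
    unfolding bad_cost_def wsum_def
  proof (rule sum_mono, clarify)
    fix z k assume zk: "(z, k) \<in> s"
    note it = valid_item[OF s zk]
    have "\<alpha> k \<le> \<alpha> J" if "\<not> J < k" using size_mono[OF it(1) J] that by simp
    moreover have "0 < \<alpha> J" using J by (rule sizes_pos)
    ultimately show "of_bool (lend s z \<in> bad s \<and> y \<le> lend s z) * (\<alpha> i + of_bool (z < x) * min (\<alpha> k) x)
       \<le> of_bool (lend s z \<in> bad s) * (\<alpha> i + \<alpha> J) + of_bool (z < x \<and> J < k) * min (\<alpha> k) x"
      using it(3) size_i_pos x_nonneg by (cases "J < k") (auto simp: min_def)
  qed
  also have "\<dots> = (\<Sum>(z, k)\<in>s. of_bool (lend s z \<in> bad s)) * (\<alpha> i + \<alpha> J) + tail J s"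
    by (simp add: tail_def wsum_def sum.distrib case_prod_beta sum_distrib_right)
  also have "(\<Sum>(z, k)\<in>s. of_bool (lend s z \<in> bad s)) = real (card ?A)"
  proof -
    have "(\<Sum>(z, k)\<in>s. of_bool (lend s z \<in> bad s) :: real) = (\<Sum>a\<in>?A. 1)"
      using fin by (intro sum.mono_neutral_cong_right) auto
    then show ?thesis by simp
  qed
  also have "real (card ?A) \<le> real (card (bad s))"
  proof -
    have inj: "inj_on (\<lambda>(z, k). lend s z) ?A"
      using inj_on_lend[OF s] by (rule inj_on_subset) auto
    have "card ?A = card ((\<lambda>(z, k). lend s z) ` ?A)" by (rule card_image[OF inj, symmetric])
    also have "\<dots> \<le> card (bad s)"
      using ends_finite[OF s] by (intro card_mono) (auto simp: bad_def)
    finally show ?thesis by simp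
  qed
  finally show ?thesis
    using sizes_pos[OF J] size_i_pos by (simp add: mult.commute mult_left_mono)
qed

lemma waste_le:
  assumes s: "valid s" and A: "nh s = 0" and m2: "2 \<le> m" and \<Delta>: "0 < \<Delta>"
    and gap: "\<And>j. j \<in> I \<Longrightarrow> i < j \<Longrightarrow> \<alpha> i + \<Delta> \<le> \<alpha> j"
    and J: "J \<in> I" and x1x: "x1 < x"
  shows "x - x1 - \<alpha> i * ni 0 s \<le> (1 + \<alpha> i / \<Delta>) / (real m - 1) * x
     + (\<alpha> i + \<alpha> J) * (1 + real (nloose 0 s) + cE * smalls s + cE) + tail J s"
proof -
  define \<kappa> where "\<kappa> = (\<alpha> i + \<alpha> i * (\<alpha> i / \<Delta>)) / ((real m - 1) * \<alpha> i)"
  let ?y = "lend s x1"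
  note l = lend[OF s x1_nonneg]
  have y0: "0 \<le> ?y" using ends_nonneg[OF s l(1)] .
  have "x - ?y - \<alpha> i * ni ?y s \<le> \<kappa> * (x - ?y) + bad_cost ?y s"
    using l x1x by (intro greedy_cover[OF s A m2 \<Delta> gap \<kappa>_def]) auto
  moreover have "\<alpha> i * ni ?y s \<le> \<alpha> i * ni 0 s"
    using ni_antimono[OF y0] size_i_pos by simp
  moreover have eq: "(1 + \<alpha> i / \<Delta>) / (real m - 1) = \<kappa>"
  proof -
    have "\<alpha> i + \<alpha> i * (\<alpha> i / \<Delta>) = (1 + \<alpha> i / \<Delta>) * \<alpha> i" by (simp add: algebra_simps)
    then show ?thesis unfolding \<kappa>_def using size_i_pos by (simp only:) simp
  qed
  moreover have "\<kappa> * (x - ?y) \<le> \<kappa> * x"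
    using y0 m2 size_i_pos \<Delta> unfolding \<kappa>_def by (intro mult_left_mono) auto
  moreover have "bad_cost ?y s \<le> (\<alpha> i + \<alpha> J) * (1 + real (nloose 0 s) + cE * smalls s + cE) + tail J s"
  proof -
    have "(\<alpha> i + \<alpha> J) * real (card (bad s)) \<le> (\<alpha> i + \<alpha> J) * (1 + real (nloose 0 s) + cE * smalls s + cE)"
      using card_bad_le[OF s] size_i_pos sizes_pos[OF J] by (intro mult_left_mono) auto
    then show ?thesis using bad_cost_le[OF s J, of ?y] by linarith
  qed
  ultimately show ?thesis using l(2) unfolding eq by linarith
qed

end

section \<open>Items of a single type\<close>

context stationary_first_fit
begin

definition cnt :: "packing \<Rightarrow> real" where
  "cnt = wsum (\<lambda>z k. of_bool (z < x \<and> k = i))"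

lemma cnt_bounds: "valid s \<Longrightarrow> 0 \<le> cnt s" "valid s \<Longrightarrow> cnt s \<le> nb s" "valid s \<Longrightarrow> cnt s \<le> M"
proof -
  assume s: "valid s"
  show "0 \<le> cnt s" unfolding cnt_def by (rule wsum_nonneg) simp
  show "cnt s \<le> nb s" unfolding cnt_def nb_def by (rule wsum_mono) auto
  then show "cnt s \<le> M" using nb_bounds[OF s] by simp
qed

lemma cnt_arrive: "valid s \<Longrightarrow> j \<in> I \<Longrightarrow> cnt (arrive s j) = cnt s + of_bool (pos s j < x \<and> j = i)"
  by (simp add: cnt_def wsum_arrive)

lemma cnt_depart: "valid s \<Longrightarrow> (y, j) \<in> s \<Longrightarrow> cnt (s - {(y, j)}) = cnt s - of_bool (y < x \<and> j = i)"
  by (simp add: cnt_def wsum_depart)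

lemma cnt_far:
  assumes "valid s" "(y, j) \<in> s" "x \<le> lend s y"
  shows "cnt (s - {(y, j)}) = cnt s"
  using depart_far(3)[OF assms(1) i_type assms(2,3)] by (simp add: cnt_depart[OF assms(1,2)])

lemma ET_pos_type: "ET (\<lambda>j. of_bool (pos s j < x \<and> j = i)) = p i * of_bool (pos s i < x)"
proof -
  have "ET (\<lambda>j. of_bool (pos s j < x \<and> j = i)) = ET (\<lambda>j. of_bool (pos s i < x) * of_bool (j = i))"
    by (intro Bochner_Integration.integral_cong) auto
  also have "\<dots> = of_bool (pos s i < x) * ET (\<lambda>j. of_bool (j = i))" by simp
  finally show ?thesis using ET_type by simp
qed

definition reach :: real where "reach = E (\<lambda>s. of_bool (pos s i < x))"

lemma reach_bounds: "0 \<le> reach" "reach \<le> 1"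
proof -
  show "0 \<le> reach" unfolding reach_def by (rule E_nonneg) simp
  have "reach \<le> E (\<lambda>_. 1)" unfolding reach_def by (rule E_mono[where C = 1 and C' = 1]) auto
  then show "reach \<le> 1" by simp
qed

text \<open>Little's law: an i-item is counted exactly if it finds a place below \<open>x\<close> on
  arrival.\<close>

lemma E_cnt: "E cnt = p i * r * reach"
proof -
  have "E cnt = r * E (\<lambda>s. ET (\<lambda>j. of_bool (pos s j < x \<and> j = i)))"
    unfolding cnt_def using cnt_bounds(3) unfolding cnt_def
    by (intro stationary_wsum[OF r_pos stat]) auto
  then show ?thesis by (simp add: ET_pos_type reach_def)
qed

text \<open>The balance equation of the squared count. Dropping the indicator from its mixed term
  leaves a bound that is attained by a Poisson variable of mean \<open>p i * r\<close>.\<close>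

lemma E_cnt_sq: "E (\<lambda>s. (cnt s)\<^sup>2) \<le> (p i * r + 1) * E cnt"
proof -
  let ?f = "\<lambda>s. (cnt s)\<^sup>2"
  have fB: "\<bar>?f s\<bar> \<le> M\<^sup>2" if "valid s" for s
    using cnt_bounds[OF that] by (simp add: power_mono)
  have floc: "?f (s - {(y, j)}) = ?f s" if "valid s" "(y, j) \<in> s" "x \<le> lend s y" for s y j
    using cnt_far[OF that] by simp
  have Ef: "E (drift r ?f) = 0" by (rule E_drift(1)[OF fB floc])
  have dr: "drift r ?f s = p i * r * (2 * cnt s * of_bool (pos s i < x)) + p i * r * of_bool (pos s i < x) + cnt s - 2 * (cnt s)\<^sup>2"
    if s: "valid s" for s
  proof -
    have "ET (\<lambda>j. ?f (arrive s j) - ?f s) = ET (\<lambda>j. (2 * cnt s + 1) * of_bool (pos s j < x \<and> j = i))"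
      by (intro integral_cong_AE AE_arrival_type) (auto simp: cnt_arrive[OF s] power2_eq_square algebra_simps)
    also have "\<dots> = (2 * cnt s + 1) * (p i * of_bool (pos s i < x))" by (simp add: ET_pos_type)
    finally have a: "ET (\<lambda>j. ?f (arrive s j) - ?f s) = (2 * cnt s + 1) * (p i * of_bool (pos s i < x))" .
    have "(\<Sum>a\<in>s. ?f (s - {a}) - ?f s) = (\<Sum>(y, j)\<in>s. (1 - 2 * cnt s) * of_bool (y < x \<and> j = i))"
    proof (intro sum.cong refl, clarify)
      fix y j assume "(y, j) \<in> s"
      then show "(cnt (s - {(y, j)}))\<^sup>2 - (cnt s)\<^sup>2 = (1 - 2 * cnt s) * of_bool (y < x \<and> j = i)"
        by (auto simp: cnt_depart[OF s] power2_eq_square algebra_simps)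
    qed
    also have "\<dots> = (1 - 2 * cnt s) * cnt s"
      unfolding cnt_def wsum_def by (simp add: sum_distrib_left case_prod_beta)
    finally show ?thesis unfolding drift_def a by (simp add: power2_eq_square algebra_simps)
  qed
  have ic: "integrable (measure_pmf \<pi>) cnt" using cnt_bounds by (intro integrable_E[where C = M]) auto
  have ic2: "integrable (measure_pmf \<pi>) ?f" using fB by (rule integrable_E)
  have ip: "integrable (measure_pmf \<pi>) (\<lambda>s. of_bool (pos s i < x) :: real)"
    by (intro integrable_E[where C = 1]) auto
  have icp: "integrable (measure_pmf \<pi>) (\<lambda>s. cnt s * of_bool (pos s i < x))"
    using cnt_bounds M_ge_1 by (intro integrable_E[where C = M]) (auto simp: abs_mult)
  have pi0: "0 \<le> p i" using probs_pos[OF i_type] by simp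
  have "0 = E (\<lambda>s. p i * r * (2 * (cnt s * of_bool (pos s i < x))) + p i * r * of_bool (pos s i < x) + cnt s - 2 * (cnt s)\<^sup>2)"
    unfolding Ef[symmetric] using dr by (intro E_cong) (simp add: mult.assoc)
  also have "\<dots> = p i * r * (2 * E (\<lambda>s. cnt s * of_bool (pos s i < x))) + p i * r * reach + E cnt - 2 * E ?f"
    using ic ic2 ip icp by (simp add: reach_def)
  finally have "2 * E ?f = 2 * (p i * r) * E (\<lambda>s. cnt s * of_bool (pos s i < x)) + 2 * E cnt"
    by (simp add: E_cnt algebra_simps)
  moreover have "E (\<lambda>s. cnt s * of_bool (pos s i < x)) \<le> E cnt"
    using cnt_bounds M_ge_1 by (intro E_mono[where C = M and C' = M]) (auto simp: abs_mult)
  then have "p i * r * E (\<lambda>s. cnt s * of_bool (pos s i < x)) \<le> p i * r * E cnt"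
    using pi0 r_pos by (intro mult_left_mono) auto
  ultimately show ?thesis by (simp add: algebra_simps)
qed

text \<open>The mean absolute deviation is at most the root of the mean square. The latter is of
  order \<open>r\<close>, plus a multiple of the square of \<open>r\<close> that vanishes when
  \<open>reach\<close> tends to 1.\<close>

lemma E_abs_dev: "E (\<lambda>s. \<bar>cnt s - p i * r\<bar>) \<le> sqrt (p i * r + (p i * r)\<^sup>2 * (1 - reach))"
proof -
  let ?g = "\<lambda>s. cnt s - p i * r"
  have pr: "0 \<le> p i * r" using probs_pos[OF i_type] r_pos by simp
  have ic: "integrable (measure_pmf \<pi>) cnt" using cnt_bounds by (intro integrable_E[where C = M]) auto
  have ic2: "integrable (measure_pmf \<pi>) (\<lambda>s. (cnt s)\<^sup>2)"
    using cnt_bounds by (intro integrable_E[where C = "M\<^sup>2"]) (simp add: power_mono)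
  have iabs: "integrable (measure_pmf \<pi>) (\<lambda>s. \<bar>?g s\<bar>)" using ic by simp
  have sq: "(\<lambda>s. \<bar>?g s\<bar>\<^sup>2) = (\<lambda>s. (cnt s)\<^sup>2 - 2 * (p i * r) * cnt s + (p i * r)\<^sup>2)"
    by (auto simp: power2_eq_square algebra_simps)
  have i2: "integrable (measure_pmf \<pi>) (\<lambda>s. \<bar>?g s\<bar>\<^sup>2)" unfolding sq using ic ic2 by simp
  have "(E (\<lambda>s. \<bar>?g s\<bar>))\<^sup>2 \<le> E (\<lambda>s. \<bar>?g s\<bar>\<^sup>2)"
  proof -
    have "0 \<le> E (\<lambda>s. (\<bar>?g s\<bar> - E (\<lambda>s. \<bar>?g s\<bar>))\<^sup>2)" by (rule E_nonneg) simp
    also have "\<dots> = E (\<lambda>s. \<bar>?g s\<bar>\<^sup>2) - (E (\<lambda>s. \<bar>?g s\<bar>))\<^sup>2"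
      by (rule measure_pmf.variance_eq[OF iabs i2])
    finally show ?thesis by simp
  qed
  also have "E (\<lambda>s. \<bar>?g s\<bar>\<^sup>2) = E (\<lambda>s. (cnt s)\<^sup>2) - 2 * (p i * r) * E cnt + (p i * r)\<^sup>2"
    unfolding sq using ic ic2 by simp
  also have "\<dots> \<le> (p i * r + 1) * E cnt - 2 * (p i * r) * E cnt + (p i * r)\<^sup>2"
    using E_cnt_sq by simp
  also have "\<dots> = p i * r * reach + (p i * r)\<^sup>2 * (1 - reach)"
    unfolding E_cnt by (simp add: power2_eq_square algebra_simps)
  also have "\<dots> \<le> p i * r + (p i * r)\<^sup>2 * (1 - reach)"
    using reach_bounds pr by (simp add: mult_left_le)
  finally show ?thesis by (intro real_le_rsqrt)
qed

end

section \<open>Balance of the uncovered demand\<close>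

context windowed_first_fit
begin

text \<open>Little's law with the truncated sizes as weights. Replacing these by the full sizes
  makes the bound proportional to \<open>r\<close>, with a factor that is small for large
  \<open>J\<close>.\<close>

lemma E_tail_le:
  assumes sm: "(\<lambda>j. \<alpha> j * p j) summable_on I"
  shows "E (tail J) \<le> r * (\<Sum>\<^sub>\<infinity>j\<in>{j \<in> I. J < j}. \<alpha> j * p j)"
proof -
  have tb: "tail J s \<le> 2 * x" if s: "valid s" for s
  proof -
    have "tail J s \<le> wsum (\<lambda>y j. of_bool (0 \<le> y \<and> y < x) * min (\<alpha> j) x) s"
      unfolding tail_def using valid_item[OF s] x_nonneg
      by (intro wsum_mono) (auto intro: less_imp_le simp: min_def)
    also have "\<dots> \<le> x - 0 + x" by (rule wsum_min_le[OF s x_nonneg x_nonneg])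
    finally show ?thesis by simp
  qed
  have "E (tail J) = r * E (\<lambda>s. ET (\<lambda>j. of_bool (pos s j < x \<and> J < j) * min (\<alpha> j) x))"
    unfolding tail_def
  proof (rule stationary_wsum[OF r_pos stat])
    show "0 \<le> of_bool (y < x \<and> J < j) * min (\<alpha> j) x" if "j \<in> I" for y j
      using sizes_pos[OF that] x_nonneg by simp
    show "wsum (\<lambda>z k. of_bool (z < x \<and> J < k) * min (\<alpha> k) x) s \<le> 2 * x" if "valid s" for s
      using tb[OF that] by (simp add: tail_def)
  qed
  also have "\<dots> \<le> r * (\<Sum>\<^sub>\<infinity>j\<in>{j \<in> I. J < j}. \<alpha> j * p j)"
  proof -
    let ?t = "\<Sum>\<^sub>\<infinity>j\<in>{j \<in> I. J < j}. \<alpha> j * p j"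
    have sub: "(\<lambda>j. \<alpha> j * p j) summable_on {j \<in> I. J < j}"
      using sm by (rule summable_on_subset_banach) auto
    have nn: "0 \<le> \<alpha> j * p j" if "j \<in> I" for j using sizes_pos[OF that] probs_pos[OF that] by simp
    have t0: "0 \<le> ?t" using nn by (intro infsum_nonneg) auto
    have inner: "ET (\<lambda>j. of_bool (pos s j < x \<and> J < j) * min (\<alpha> j) x) \<le> ?t" for s
    proof -
      have bd: "\<bar>of_bool (pos s j < x \<and> J < j) * min (\<alpha> j) x\<bar> \<le> x" if "j \<in> I" for j
        using sizes_pos[OF that] x_nonneg by (auto simp: abs_mult)
      have "ennreal (ET (\<lambda>j. of_bool (pos s j < x \<and> J < j) * min (\<alpha> j) x))
          = (\<integral>\<^sup>+j. ennreal (of_bool (pos s j < x \<and> J < j) * min (\<alpha> j) x) \<partial>measure_pmf arrival_type)"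
        using sizes_pos x_nonneg
        by (intro nn_integral_eq_integral[symmetric] integrable_arrival_type[OF bd] AE_arrival_type) (auto simp: less_imp_le)
      also have "\<dots> = (\<integral>\<^sup>+j. ennreal (p j) * ennreal (of_bool (pos s j < x \<and> J < j) * min (\<alpha> j) x) \<partial>count_space I)"
        by (simp add: arrival_type_nn_integral)
      also have "\<dots> \<le> (\<integral>\<^sup>+j. ennreal (\<alpha> j * p j) * indicator {j \<in> I. J < j} j \<partial>count_space I)"
      proof (rule nn_integral_mono)
        fix j assume "j \<in> space (count_space I)"
        then have j: "j \<in> I" "0 < \<alpha> j" "0 < p j" using sizes_pos probs_pos by auto
        have "p j * (of_bool (pos s j < x \<and> J < j) * min (\<alpha> j) x) \<le> \<alpha> j * p j * of_bool (J < j)"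
          using j by (auto simp: mult.commute)
        then show "ennreal (p j) * ennreal (of_bool (pos s j < x \<and> J < j) * min (\<alpha> j) x)
            \<le> ennreal (\<alpha> j * p j) * indicator {j \<in> I. J < j} j"
          using j x_nonneg by (cases "J < j") (auto simp: ennreal_mult[symmetric] intro!: ennreal_leI)
      qed
      also have "\<dots> = (\<integral>\<^sup>+j. ennreal (\<alpha> j * p j) \<partial>count_space {j \<in> I. J < j})"
        by (subst nn_integral_count_space_eq[where A = I and B = "{j \<in> I. J < j}"])
           (auto intro!: nn_integral_cong split: split_indicator)
      also have "\<dots> = ennreal ?t"
      proof -
        have "Infinite_Sum.abs_summable_on (\<lambda>j. \<alpha> j * p j) {j \<in> I. J < j}"
          using sub summable_on_iff_abs_summable_on_real[of "\<lambda>j. \<alpha> j * p j" "{j \<in> I. J < j}"] by blast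
        then have a: "Infinite_Set_Sum.abs_summable_on (\<lambda>j. \<alpha> j * p j) {j \<in> I. J < j}"
          by (rule abs_summable_equivalent[THEN iffD1])
        show ?thesis using nn_integral_conv_infsetsum[OF a] nn infsetsum_infsum[OF a] by simp
      qed
      finally show ?thesis using t0 by (simp add: ennreal_le_iff)
    qed
    have "E (\<lambda>s. ET (\<lambda>j. of_bool (pos s j < x \<and> J < j) * min (\<alpha> j) x)) \<le> E (\<lambda>_. ?t)"
    proof (rule E_mono[where C = x and C' = ?t])
      fix s
      show "\<bar>ET (\<lambda>j. of_bool (pos s j < x \<and> J < j) * min (\<alpha> j) x)\<bar> \<le> x"
        using sizes_pos x_nonneg by (intro expectation_arrival_type_le) (auto simp: abs_mult less_imp_le min_def)
    qed (use inner t0 in auto)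
    then show ?thesis using r_pos by simp
  qed
  finally show ?thesis .
qed

lemma E_smalls_le: "E smalls \<le> E small_rate"
proof -
  have sb: "smalls s \<le> M" if s: "valid s" for s
  proof -
    have "smalls s \<le> wsum (\<lambda>y j. of_bool (0 \<le> y \<and> y < x)) s"
      unfolding smalls_def using x1_nonneg by (intro wsum_mono) auto
    then show ?thesis using wsum_count_le[OF s x_nonneg] by (simp add: M_def)
  qed
  have "E smalls = r * E (\<lambda>s. ET (\<lambda>j. of_bool (x1 \<le> pos s j \<and> pos s j < x \<and> j < i)))"
    unfolding smalls_def using sb unfolding smalls_def by (intro stationary_wsum[OF r_pos stat]) auto
  also have "\<dots> \<le> r * E (\<lambda>s. ET (small_far s))"
  proof (intro mult_left_mono E_mono[where C = 1 and C' = 1])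
    fix s
    show "ET (\<lambda>j. of_bool (x1 \<le> pos s j \<and> pos s j < x \<and> j < i)) \<le> ET (small_far s)"
      using int_small_far by (intro integral_mono_AE AE_arrival_type integrable_arrival_type[where C = 1]) (auto simp: small_far_def)
    show "\<bar>ET (\<lambda>j. of_bool (x1 \<le> pos s j \<and> pos s j < x \<and> j < i))\<bar> \<le> 1"
      by (rule expectation_arrival_type_le) simp
    show "\<bar>ET (small_far s)\<bar> \<le> 1" using ET_small_far[of s] by simp
  qed (use r_pos in simp)
  also have "\<dots> = E small_rate" unfolding small_rate_def by simp
  finally show ?thesis .
qed

lemma ni_eq_cnt: "valid s \<Longrightarrow> ni 0 s = cnt s"
  unfolding ni_def cnt_def wsum_def using valid_item(2) by (intro sum.cong) auto

text \<open>\<open>E_slow_le\<close> for the number of i-items that are missing from the capacity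
  \<open>(x - x1) / \<alpha> i\<close>. One event changes this number by at most 1, and in the
  absence of holes it is bounded by \<open>waste_le\<close>. The positive part makes it an
  admissible weight.\<close>

lemma E_deficit_le:
  assumes Z: "\<And>s. valid s \<Longrightarrow> 0 \<le> Z s" "\<And>s. valid s \<Longrightarrow> Z s \<le> CZ"
    and nbZ: "\<And>s. valid s \<Longrightarrow> nb s \<le> (p i - \<delta>) * r + Z s"
    and m2: "2 \<le> m" and \<Delta>: "0 < \<Delta>"
    and gap: "\<And>j. j \<in> I \<Longrightarrow> i < j \<Longrightarrow> \<alpha> i + \<Delta> \<le> \<alpha> j"
    and J: "J \<in> I" and x1x: "x1 < x"
    and sm: "(\<lambda>j. \<alpha> j * p j) summable_on I" and \<delta>: "0 < \<delta>"
  shows "\<delta> * r * ((x - x1) / \<alpha> i - p i * r * reach) \<le>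
     p i * r * (((1 + \<alpha> i / \<Delta>) / (real m - 1) * x + (\<alpha> i + \<alpha> J) * (1 + E (\<lambda>s. real (nloose 0 s)) + cE * E small_rate + cE)
        + r * (\<Sum>\<^sub>\<infinity>j\<in>{j \<in> I. J < j}. \<alpha> j * p j)) / \<alpha> i)
     + M * E Z + 2 * M * (E d_rate + 2 * E (\<lambda>s. real (nh s))) + 1 * (r + M) * (E (\<lambda>s. real (nh s)) + 1)"
proof -
  let ?K = "(x - x1) / \<alpha> i"
  let ?n = "\<lambda>s. max 0 (?K - cnt s)"
  let ?t = "\<Sum>\<^sub>\<infinity>j\<in>{j \<in> I. J < j}. \<alpha> j * p j"
  have K: "0 \<le> ?K" "?K \<le> M"
  proof -
    show "0 \<le> ?K" using x1x size_i_pos by simp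
    have "?K \<le> x / \<alpha> 1"
      using x1_nonneg x1x size_ge_first[OF i_type] first_size_pos size_i_pos by (intro frac_le) auto
    then show "?K \<le> M" by (simp add: M_def)
  qed
  have nb: "0 \<le> ?n s \<and> ?n s \<le> M" if "valid s" for s using cnt_bounds[OF that] K by auto
  have int_n: "integrable (measure_pmf \<pi>) ?n" using nb by (intro integrable_E[where C = M]) auto
  have int_c: "integrable (measure_pmf \<pi>) cnt" using cnt_bounds by (intro integrable_E[where C = M]) auto
  have slow: "\<delta> * r * E ?n \<le> p i * r * E (\<lambda>s. ?n s * of_bool (nh s = 0)) + M * E Z
      + 2 * M * (E d_rate + 2 * E (\<lambda>s. real (nh s))) + 1 * (r + M) * (E (\<lambda>s. real (nh s)) + 1)"
  proof (rule E_slow_le[OF nb _ _ _ _ Z nbZ])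
    fix s y j assume s: "valid s" and a: "(y, j) \<in> s"
    show "x \<le> lend s y \<Longrightarrow> ?n (s - {(y, j)}) = ?n s" using cnt_far[OF s a] by simp
    show "\<bar>?n (s - {(y, j)}) - ?n s\<bar> \<le> 1" using cnt_depart[OF s a] by (auto simp: max_def)
  next
    fix s j assume "valid s" "j \<in> I"
    then show "\<bar>?n (arrive s j) - ?n s\<bar> \<le> 1" using cnt_arrive[of s j] by (auto simp: max_def)
  qed auto
  let ?b = "\<lambda>s. ((1 + \<alpha> i / \<Delta>) / (real m - 1) * x
     + (\<alpha> i + \<alpha> J) * (1 + real (nloose 0 s) + cE * smalls s + cE) + tail J s) / \<alpha> i"
  have int_s: "integrable (measure_pmf \<pi>) smalls"
  proof (rule integrable_E)
    fix s assume s: "valid s"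
    have "smalls s \<le> wsum (\<lambda>y j. of_bool (0 \<le> y \<and> y < x)) s"
      unfolding smalls_def using x1_nonneg by (intro wsum_mono) auto
    moreover have "0 \<le> smalls s" unfolding smalls_def by (rule wsum_nonneg) simp
    ultimately show "\<bar>smalls s\<bar> \<le> M" using wsum_count_le[OF s x_nonneg] by (simp add: M_def)
  qed
  have int_t: "integrable (measure_pmf \<pi>) (tail J)"
  proof (rule integrable_E)
    fix s assume s: "valid s"
    have "tail J s \<le> wsum (\<lambda>y j. of_bool (0 \<le> y \<and> y < x) * min (\<alpha> j) x) s"
      unfolding tail_def using valid_item[OF s] x_nonneg
      by (intro wsum_mono) (auto intro: less_imp_le simp: min_def)
    moreover have "0 \<le> tail J s" unfolding tail_def using valid_item(3)[OF s] x_nonneg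
      by (intro wsum_nonneg) (auto intro!: mult_nonneg_nonneg less_imp_le)
    ultimately show "\<bar>tail J s\<bar> \<le> x - 0 + x" using wsum_min_le[OF s x_nonneg x_nonneg] by simp
  qed
  have "E (\<lambda>s. ?n s * of_bool (nh s = 0)) \<le> E ?b"
  proof (intro integral_mono_AE AE_stationary[OF r_pos stat])
    fix s assume s: "valid s"
    have b0: "0 \<le> ?b s"
    proof -
      have "0 \<le> tail J s" unfolding tail_def using valid_item(3)[OF s] x_nonneg
        by (intro wsum_nonneg) (auto intro!: mult_nonneg_nonneg less_imp_le)
      moreover have "0 \<le> smalls s" unfolding smalls_def by (rule wsum_nonneg) simp
      ultimately show ?thesis
        using size_i_pos \<Delta> m2 x_nonneg sizes_pos[OF J] cE_ge_1
        by (intro divide_nonneg_pos add_nonneg_nonneg mult_nonneg_nonneg) auto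
    qed
    show "?n s * of_bool (nh s = 0) \<le> ?b s"
    proof (cases "nh s = 0")
      case True
      have "?K - cnt s = (x - x1 - \<alpha> i * ni 0 s) / \<alpha> i"
        using size_i_pos by (simp add: ni_eq_cnt[OF s] diff_divide_distrib)
      also have "\<dots> \<le> ?b s"
        using waste_le[OF s True m2 \<Delta> gap J x1x] size_i_pos by (intro divide_right_mono) auto
      finally show ?thesis using b0 True by simp
    qed (use b0 in simp)
  next
    show "integrable (measure_pmf \<pi>) (\<lambda>s. ?n s * of_bool (nh s = 0))"
      using nb M_ge_1 by (intro integrable_E[where C = M]) (auto simp: abs_mult)
  qed (use int_s int_t int_nloose in auto)
  also have "E ?b = ((1 + \<alpha> i / \<Delta>) / (real m - 1) * x + (\<alpha> i + \<alpha> J) * (1 + E (\<lambda>s. real (nloose 0 s)) + cE * E smalls + cE)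
        + E (tail J)) / \<alpha> i"
    using int_s int_t int_nloose by simp
  also have "\<dots> \<le> ((1 + \<alpha> i / \<Delta>) / (real m - 1) * x + (\<alpha> i + \<alpha> J) * (1 + E (\<lambda>s. real (nloose 0 s)) + cE * E small_rate + cE)
        + r * ?t) / \<alpha> i"
    using E_smalls_le E_tail_le[OF sm, of J] size_i_pos sizes_pos[OF J] cE_ge_1
    by (intro divide_right_mono add_mono mult_left_mono order_refl) auto
  finally have "p i * r * E (\<lambda>s. ?n s * of_bool (nh s = 0)) \<le> p i * r * (((1 + \<alpha> i / \<Delta>) / (real m - 1) * x
     + (\<alpha> i + \<alpha> J) * (1 + E (\<lambda>s. real (nloose 0 s)) + cE * E small_rate + cE) + r * ?t) / \<alpha> i)"
    using probs_pos[OF i_type] r_pos by (intro mult_left_mono) auto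
  moreover have "?K - p i * r * reach \<le> E ?n"
  proof -
    have "?K - p i * r * reach = E (\<lambda>s. ?K - cnt s)" using int_c by (simp add: E_cnt)
    also have "\<dots> \<le> E ?n" using int_c int_n by (intro integral_mono_AE AE_stationary[OF r_pos stat]) auto
    finally show ?thesis .
  qed
  then have "\<delta> * r * (?K - p i * r * reach) \<le> \<delta> * r * E ?n" using \<delta> r_pos by (intro mult_left_mono) auto
  ultimately show ?thesis using slow by linarith
qed

text \<open>All error terms are measured against one quantity \<open>w\<close>, which will be \<open>o(r)\<close>.\<close>

lemma E_nloose_bound:
  assumes Z: "\<And>s. valid s \<Longrightarrow> 0 \<le> Z s" "\<And>s. valid s \<Longrightarrow> Z s \<le> CZ"
    and nbZ: "\<And>s. valid s \<Longrightarrow> nb s \<le> (p i - \<delta>) * r + Z s" and \<delta>: "0 < \<delta>"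
    and C: "M \<le> C * r" "0 \<le> C" and w: "1 \<le> w" "E Z \<le> w" "E small_rate \<le> w"
    and K: "0 \<le> K" "E d_rate \<le> K * w" "E (\<lambda>s. real (nh s)) \<le> K * w"
    and A: "A = (1 + C) * (real m + 3) / \<delta>"
    and D: "D = ((1 + C) * (cE + 1) * (3 * K + 1) + C + 6 * C * K + 3 * cE * (1 + C) * (K + 1)) / \<delta>"
    and l: "l \<le> m"
  shows "E (\<lambda>s. real (nloose l s)) \<le> (\<Sum>t<m - l. A ^ t) * D * w"
  using l
proof (induction "m - l" arbitrary: l)
  case 0
  then have lm: "l = m" by simp
  have "E (\<lambda>s. real (nloose m s)) = E (\<lambda>_. 0)"
    by (intro E_cong) (simp add: nloose_def loose_m_empty)
  then show ?case unfolding lm by simp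
next
  case (Suc k)
  then have lm: "l < m" "m - Suc l = k" by auto
  let ?n = "\<lambda>l. E (\<lambda>s. real (nloose l s))"
  let ?B = "\<lambda>k. (\<Sum>t<k. A ^ t) * D * w"
  have c1: "0 \<le> 1 + C" "0 \<le> cE" using C cE_ge_1 by auto
  have IH: "?n (Suc l) \<le> ?B k" using Suc.hyps(1)[of "Suc l"] lm Suc.hyps(2) by simp
  have J: "E J_rate \<le> 3 * K * w" using E_J_le K by simp
  have slow: "\<delta> * r * ?n l \<le> p i * r * E (\<lambda>s. real (nloose l s) * of_bool (nh s = 0)) + M * E Z
      + 2 * M * (E d_rate + 2 * E (\<lambda>s. real (nh s))) + 3 * cE * (r + M) * (E (\<lambda>s. real (nh s)) + 1)"
  proof (rule E_slow_le[OF _ _ _ _ _ Z nbZ])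
    fix s assume s: "valid s"
    show "0 \<le> real (nloose l s) \<and> real (nloose l s) \<le> M" using nloose_le_M[OF s] by simp
    fix y j assume a: "(y, j) \<in> s"
    show "x \<le> lend s y \<Longrightarrow> real (nloose l (s - {(y, j)})) = real (nloose l s)"
      using loose_far[OF s a] lm by (simp add: nloose_def)
    show "\<bar>real (nloose l (s - {(y, j)})) - real (nloose l s)\<bar> \<le> 3 * cE"
      using nloose_depart_change[OF s a] lm by simp
  next
    fix s j assume "valid s" "j \<in> I"
    then show "\<bar>real (nloose l (arrive s j)) - real (nloose l s)\<bar> \<le> 3 * cE"
      using nloose_arrive_change lm by simp
  qed (use cE_ge_1 in auto)
  have rM: "r + M \<le> (1 + C) * r" using C by (simp add: algebra_simps)
  have h0: "0 \<le> E (\<lambda>s. real (nh s))" by (rule E_nonneg) simp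
  have d0: "0 \<le> E d_rate" using rate_bounds by (intro E_nonneg) auto
  have Z0: "0 \<le> E Z" using Z by (intro E_nonneg) auto
  \<comment> \<open>One step of the induction: a window in a state without holes gets primed at the
    cost of \<open>r + M\<close> by \<open>E_nloose_le_primed\<close>, and a primed one acquires a
    longer run by \<open>E_primed_le\<close>. Together they give the factor
    \<open>(1 + C) * (real m + 3)\<close> in \<open>A\<close>; the division by \<delta> comes from
    \<open>E_slow_le\<close>.\<close>
  have t1: "p i * r * E (\<lambda>s. real (nloose l s) * of_bool (nh s = 0)) \<le> (1 + C) * r * ((real m + 3) * ?B k + (cE + 1) * (3 * K + 1) * w)"
  proof -
    have pr0: "0 \<le> p i * r" using probs_pos[OF i_type] r_pos by simp
    have "p i * r * E (\<lambda>s. real (nloose l s) * of_bool (nh s = 0)) \<le> p i * r * ((r + M) * E (\<lambda>s. of_bool (primed l s)))"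
      by (intro mult_left_mono E_nloose_le_primed[OF lm(1)] pr0)
    also have "\<dots> = (r + M) * (p i * r * E (\<lambda>s. of_bool (primed l s)))" by (simp only: mult_ac)
    also have "\<dots> \<le> (r + M) * ((real l + 3) * ?n (Suc l) + (cE + 1) * (E J_rate + E small_rate))"
      using E_primed_le[OF lm(1)] r_pos M_ge_1 by (intro mult_left_mono) auto
    also have "\<dots> \<le> (r + M) * ((real m + 3) * ?B k + (cE + 1) * ((3 * K + 1) * w))"
    proof (intro mult_left_mono add_mono)
      have n0: "0 \<le> ?n (Suc l)" by (rule E_nonneg) simp
      have "(real l + 3) * ?n (Suc l) \<le> (real m + 3) * ?n (Suc l)" using lm n0 by (intro mult_right_mono) auto
      also have "\<dots> \<le> (real m + 3) * ?B k" using IH by (intro mult_left_mono) auto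
      finally show "(real l + 3) * ?n (Suc l) \<le> (real m + 3) * ?B k" .
      show "E J_rate + E small_rate \<le> (3 * K + 1) * w" using J w(3) by (simp add: algebra_simps)
    qed (use c1 r_pos M_ge_1 in auto)
    also have "\<dots> \<le> (1 + C) * r * ((real m + 3) * ?B k + (cE + 1) * ((3 * K + 1) * w))"
    proof (rule mult_right_mono[OF rM])
      have "0 \<le> ?n (Suc l)" by (rule E_nonneg) simp
      then have "0 \<le> ?B k" using IH by (rule order_trans)
      then have "0 \<le> (real m + 3) * ?B k" by (rule mult_nonneg_nonneg[rotated]) simp
      moreover have "0 \<le> (cE + 1) * ((3 * K + 1) * w)" using c1 K w by simp
      ultimately show "0 \<le> (real m + 3) * ?B k + (cE + 1) * ((3 * K + 1) * w)" by (rule add_nonneg_nonneg)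
    qed
    finally show ?thesis by (simp only: mult.assoc)
  qed
  have t2: "M * E Z \<le> C * r * w" using C w Z0 M_ge_1 r_pos by (intro mult_mono) auto
  have t3: "2 * M * (E d_rate + 2 * E (\<lambda>s. real (nh s))) \<le> 2 * (C * r) * (3 * K * w)"
    using C K d0 h0 M_ge_1 r_pos w by (intro mult_mono) auto
  have e1: "E (\<lambda>s. real (nh s)) + 1 \<le> (K + 1) * w" using K w by (simp add: distrib_right)
  have t4: "3 * cE * (r + M) * (E (\<lambda>s. real (nh s)) + 1) \<le> 3 * cE * ((1 + C) * r) * ((K + 1) * w)"
    by (intro mult_mono order_refl e1 rM) (use c1 C K h0 M_ge_1 r_pos w in auto)
  have "\<delta> * r * ?n l \<le> (1 + C) * r * ((real m + 3) * ?B k + (cE + 1) * (3 * K + 1) * w) + C * r * w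
     + 2 * (C * r) * (3 * K * w) + 3 * cE * ((1 + C) * r) * ((K + 1) * w)"
    using slow t1 t2 t3 t4 by linarith
  also have "\<dots> = r * ((1 + C) * (real m + 3) * ?B k
     + ((1 + C) * (cE + 1) * (3 * K + 1) + C + 6 * C * K + 3 * cE * (1 + C) * (K + 1)) * w)"
    by (simp add: algebra_simps)
  also have "\<dots> = r * (\<delta> * A * ?B k + \<delta> * D * w)"
  proof -
    have "\<delta> * A = (1 + C) * (real m + 3)" "\<delta> * D = (1 + C) * (cE + 1) * (3 * K + 1) + C + 6 * C * K + 3 * cE * (1 + C) * (K + 1)"
      using \<delta> by (simp_all add: A D)
    then show ?thesis by simp
  qed
  finally have "r * (\<delta> * ?n l) \<le> r * (\<delta> * (A * ?B k + D * w))" by (simp add: algebra_simps)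
  then have "?n l \<le> A * ?B k + D * w" using r_pos \<delta> by simp
  \<comment> \<open>The recursion with factor \<open>A\<close>, increment \<open>D * w\<close> and
    value 0 at \<open>l = m\<close> unrolls to a geometric sum.\<close>
  also have "\<dots> = ?B (Suc k)"
  proof -
    have "(\<Sum>t<Suc k. A ^ t) = 1 + A * (\<Sum>t<k. A ^ t)"
      unfolding sum.lessThan_Suc_shift by (simp add: sum_distrib_left)
    then show ?thesis by (simp add: algebra_simps)
  qed
  finally show ?case unfolding Suc.hyps(2)[symmetric] .
qed

text \<open>Combines \<open>E_deficit_le\<close> with \<open>E_nloose_bound\<close> at
  \<open>l = 0\<close>. Of the two terms on the right, the first is of order \<open>r\<close> but
  with a factor that is small for large \<open>m\<close> and \<open>J\<close>; the second is a
  constant times \<open>w\<close>.\<close>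

lemma reach_bound:
  assumes Z: "\<And>s. valid s \<Longrightarrow> 0 \<le> Z s" "\<And>s. valid s \<Longrightarrow> Z s \<le> CZ"
    and nbZ: "\<And>s. valid s \<Longrightarrow> nb s \<le> (p i - \<delta>) * r + Z s" and \<delta>: "0 < \<delta>"
    and C: "M \<le> C * r" "0 \<le> C" and w: "1 \<le> w" "E Z \<le> w" "E small_rate \<le> w"
    and K: "0 \<le> K" "E d_rate \<le> K * w" "E (\<lambda>s. real (nh s)) \<le> K * w"
    and B: "B = (\<Sum>t<m. ((1 + C) * (real m + 3) / \<delta>) ^ t) *
      (((1 + C) * (cE + 1) * (3 * K + 1) + C + 6 * C * K + 3 * cE * (1 + C) * (K + 1)) / \<delta>)"
    and m2: "2 \<le> m" and \<Delta>: "0 < \<Delta>"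
    and gap: "\<And>j. j \<in> I \<Longrightarrow> i < j \<Longrightarrow> \<alpha> i + \<Delta> \<le> \<alpha> j"
    and J: "J \<in> I" and x1x: "x1 < x"
    and sm: "(\<lambda>j. \<alpha> j * p j) summable_on I"
  shows "\<delta> * ((x - x1) / \<alpha> i - p i * r * reach) \<le>
     p i * (((1 + \<alpha> i / \<Delta>) / (real m - 1) * x + r * (\<Sum>\<^sub>\<infinity>j\<in>{j \<in> I. J < j}. \<alpha> j * p j)) / \<alpha> i)
     + (p i * (\<alpha> i + \<alpha> J) * (1 + B + 2 * cE) / \<alpha> i + C + 6 * C * K + (1 + C) * (K + 1)) * w"
proof -
  let ?t = "\<Sum>\<^sub>\<infinity>j\<in>{j \<in> I. J < j}. \<alpha> j * p j" and ?h = "E (\<lambda>s. real (nh s))"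
  let ?k = "(1 + \<alpha> i / \<Delta>) / (real m - 1) * x"
  have n: "E (\<lambda>s. real (nloose 0 s)) \<le> B * w"
    using E_nloose_bound[OF Z nbZ \<delta> C w K refl refl, of 0] by (simp add: B)
  have c1: "0 \<le> 1 + C" "0 \<le> cE" using C cE_ge_1 by auto
  have rM: "r + M \<le> (1 + C) * r" using C by (simp add: algebra_simps)
  have h0: "0 \<le> ?h" by (rule E_nonneg) simp
  have d0: "0 \<le> E d_rate" using rate_bounds by (intro E_nonneg) auto
  have Z0: "0 \<le> E Z" using Z by (intro E_nonneg) auto
  have pp: "0 < p i" by (rule probs_pos[OF i_type])
  have t1: "p i * r * ((?k + (\<alpha> i + \<alpha> J) * (1 + E (\<lambda>s. real (nloose 0 s)) + cE * E small_rate + cE) + r * ?t) / \<alpha> i)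
     \<le> p i * r * ((?k + (\<alpha> i + \<alpha> J) * ((1 + B + 2 * cE) * w) + r * ?t) / \<alpha> i)"
  proof (intro mult_left_mono divide_right_mono add_mono order_refl)
    have "cE * E small_rate \<le> cE * w" "cE * 1 \<le> cE * w"
      by (rule mult_left_mono[OF w(3) c1(2)], rule mult_left_mono[OF w(1) c1(2)])
    then show "1 + E (\<lambda>s. real (nloose 0 s)) + cE * E small_rate + cE \<le> (1 + B + 2 * cE) * w"
      using n w by (simp add: algebra_simps)
  qed (use pp r_pos size_i_pos sizes_pos[OF J] m2 \<Delta> in auto)
  have t2: "M * E Z \<le> C * r * w" using C w Z0 M_ge_1 r_pos by (intro mult_mono) auto
  have t3: "2 * M * (E d_rate + 2 * ?h) \<le> 2 * (C * r) * (3 * K * w)"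
    using C K d0 h0 M_ge_1 r_pos w by (intro mult_mono) auto
  have t4: "1 * (r + M) * (?h + 1) \<le> 1 * ((1 + C) * r) * ((K + 1) * w)"
    using c1 rM K h0 M_ge_1 r_pos w by (intro mult_mono) (auto simp: algebra_simps)
  have "\<delta> * r * ((x - x1) / \<alpha> i - p i * r * reach) \<le>
     p i * r * ((?k + (\<alpha> i + \<alpha> J) * ((1 + B + 2 * cE) * w) + r * ?t) / \<alpha> i)
     + C * r * w + 2 * (C * r) * (3 * K * w) + 1 * ((1 + C) * r) * ((K + 1) * w)"
    using E_deficit_le[OF Z nbZ m2 \<Delta> gap J x1x sm \<delta>] t1 t2 t3 t4 by linarith
  also have "\<dots> = r * (p i * ((?k + r * ?t) / \<alpha> i)
     + (p i * (\<alpha> i + \<alpha> J) * (1 + B + 2 * cE) / \<alpha> i + C + 6 * C * K + (1 + C) * (K + 1)) * w)"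
    by (simp add: algebra_simps add_divide_distrib)
  finally have "r * (\<delta> * ((x - x1) / \<alpha> i - p i * r * reach)) \<le> r * (p i * ((?k + r * ?t) / \<alpha> i)
     + (p i * (\<alpha> i + \<alpha> J) * (1 + B + 2 * cE) / \<alpha> i + C + 6 * C * K + (1 + C) * (K + 1)) * w)"
    by (simp only: mult_ac)
  then show ?thesis using r_pos by simp
qed

end

section \<open>The limit of large \<open>r\<close>\<close>

context first_fit_model
begin

definition beta :: "nat \<Rightarrow> real" where "beta i = (\<Sum>j = 1..i. \<alpha> j * p j)"

text \<open>This is \<open>beta (i - 1)\<close>, written with a half-open range to avoid the
  subtraction.\<close>

definition beta0 :: "nat \<Rightarrow> real" where "beta0 i = (\<Sum>j\<in>{1..<i}. \<alpha> j * p j)"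

definition started :: "nat \<Rightarrow> real \<Rightarrow> packing \<Rightarrow> real" where
  "started j y = wsum (\<lambda>z k. of_bool (z < y \<and> k = j))"

text \<open>The concrete slack \<open>Z\<close>, measured in lengths \<alpha> i: the summand
  \<alpha> i allows for an item across the border \<open>x\<close>, and the others for the
  deviations of the smaller types from their expected numbers.\<close>

definition surplus :: "nat \<Rightarrow> real \<Rightarrow> packing \<Rightarrow> real" where
  "surplus i r s = (\<alpha> i + (\<Sum>j\<in>{1..<i}. \<alpha> j * \<bar>started j (r * beta j) s - p j * r\<bar>)) / \<alpha> i"

lemma size_prob_nonneg: "j \<in> I \<Longrightarrow> 0 \<le> \<alpha> j * p j"
  using sizes_pos probs_pos by (simp add: less_imp_le)

lemma beta_nonneg: "i \<in> I \<Longrightarrow> 0 \<le> beta i"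
  unfolding beta_def using types_down by (intro sum_nonneg size_prob_nonneg) auto

lemma beta0_nonneg: "i \<in> I \<Longrightarrow> 0 \<le> beta0 i"
  unfolding beta0_def using types_down by (intro sum_nonneg size_prob_nonneg) auto

lemma beta_eq: "i \<in> I \<Longrightarrow> beta i = beta0 i + \<alpha> i * p i"
  using types_ge_1[of i] unfolding beta_def beta0_def
  by (simp add: atLeastLessThanSuc_atLeastAtMost[symmetric])

lemma beta_le_beta0:
  assumes "i \<in> I" "j \<in> {1..<i}"
  shows "beta j \<le> beta0 i"
  unfolding beta_def beta0_def using assms types_down[OF assms(1)]
  by (intro sum_mono2) (auto intro!: size_prob_nonneg)

lemma started_bounds:
  assumes "valid s" "0 \<le> y"
  shows "0 \<le> started j y s" "started j y s \<le> y / \<alpha> 1 + 1"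
proof -
  show "0 \<le> started j y s" unfolding started_def by (rule wsum_nonneg) simp
  have "started j y s \<le> wsum (\<lambda>z k. of_bool (0 \<le> z \<and> z < y)) s"
    unfolding started_def using valid_item(2)[OF assms(1)] by (intro wsum_mono) auto
  then show "started j y s \<le> y / \<alpha> 1 + 1" using wsum_count_le[OF assms] by simp
qed

text \<open>All items counted start below \<open>x\<close>, because \<open>r * beta j\<close> is at
  most \<open>r * beta0 i\<close> for \<open>j < i\<close>, and each enters with its size truncated
  at \<alpha> i; so the overhang beyond \<open>x\<close> is at most \<alpha> i.\<close>

lemma packed_big_small:
  assumes s: "valid s" and i: "i \<in> I" and r: "0 \<le> r" and x: "r * beta0 i \<le> x"
  shows "\<alpha> i * wsum (\<lambda>y k. of_bool (y < x \<and> i \<le> k)) s + (\<Sum>j\<in>{1..<i}. \<alpha> j * started j (r * beta j) s) \<le> x + \<alpha> i"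
proof -
  have x0: "0 \<le> x" using x r beta0_nonneg[OF i] by (meson mult_nonneg_nonneg order_trans)
  have ai: "0 < \<alpha> i" using i by (rule sizes_pos)
  have "\<alpha> i * wsum (\<lambda>y k. of_bool (y < x \<and> i \<le> k)) s + (\<Sum>j\<in>{1..<i}. \<alpha> j * started j (r * beta j) s)
    = (\<Sum>(y, k)\<in>s. \<alpha> i * of_bool (y < x \<and> i \<le> k) + (\<Sum>j\<in>{1..<i}. \<alpha> j * of_bool (y < r * beta j \<and> k = j)))"
    unfolding wsum_def started_def case_prod_beta sum.distrib sum_distrib_left
    by (subst sum.swap) (rule refl)
  also have "\<dots> \<le> wsum (\<lambda>y k. of_bool (0 \<le> y \<and> y < x) * min (\<alpha> k) (\<alpha> i)) s"
    unfolding wsum_def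
  proof (rule sum_mono, clarify)
    fix y k assume yk: "(y, k) \<in> s"
    note it = valid_item[OF s yk]
    show "\<alpha> i * of_bool (y < x \<and> i \<le> k) + (\<Sum>j\<in>{1..<i}. \<alpha> j * of_bool (y < r * beta j \<and> k = j))
       \<le> of_bool (0 \<le> y \<and> y < x) * min (\<alpha> k) (\<alpha> i)"
    proof (cases "i \<le> k")
      case True
      have "(\<Sum>j\<in>{1..<i}. \<alpha> j * of_bool (y < r * beta j \<and> k = j)) = 0"
        using True by (intro sum.neutral) auto
      then show ?thesis using True it size_mono[OF i it(1) True] by (simp add: min_absorb2)
    next
      case False
      then have k: "k \<in> {1..<i}" using types_ge_1[OF it(1)] by simp
      have "(\<Sum>j\<in>{1..<i}. \<alpha> j * of_bool (y < r * beta j \<and> k = j)) = (\<Sum>j\<in>{k}. \<alpha> j * of_bool (y < r * beta j \<and> k = j))"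
        using k by (intro sum.mono_neutral_right) auto
      then have eq: "(\<Sum>j\<in>{1..<i}. \<alpha> j * of_bool (y < r * beta j \<and> k = j)) = \<alpha> k * of_bool (y < r * beta k)"
        by (simp del: sum_mult_of_bool_eq sum_of_bool_mult_eq)
      have "r * beta k \<le> x" using beta_le_beta0[OF i k] r x by (meson mult_left_mono order_trans)
      moreover have "\<alpha> k \<le> \<alpha> i" using size_mono[OF it(1) i] False by simp
      ultimately show ?thesis unfolding eq using False it by (cases "y < r * beta k") (auto simp: min_absorb1)
    qed
  qed
  also have "\<dots> \<le> x - 0 + \<alpha> i" using ai x0 by (intro wsum_min_le[OF s]) auto
  finally show ?thesis by simp
qed

lemma big_le_surplus:
  assumes s: "valid s" and i: "i \<in> I" and r: "0 \<le> r" and x: "r * beta0 i \<le> x"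
  shows "wsum (\<lambda>y k. of_bool (y < x \<and> i \<le> k)) s \<le> (x - r * beta0 i) / \<alpha> i + surplus i r s"
proof -
  have ai: "0 < \<alpha> i" using i by (rule sizes_pos)
  have "(\<Sum>j\<in>{1..<i}. \<alpha> j * (p j * r)) \<le> (\<Sum>j\<in>{1..<i}. \<alpha> j * started j (r * beta j) s + \<alpha> j * \<bar>started j (r * beta j) s - p j * r\<bar>)"
  proof (rule sum_mono)
    fix j assume "j \<in> {1..<i}"
    then have "0 < \<alpha> j" using sizes_pos types_down[OF i] by auto
    then show "\<alpha> j * (p j * r) \<le> \<alpha> j * started j (r * beta j) s + \<alpha> j * \<bar>started j (r * beta j) s - p j * r\<bar>"
      unfolding distrib_left[symmetric] by (intro mult_left_mono) auto
  qed
  also have "(\<Sum>j\<in>{1..<i}. \<alpha> j * (p j * r)) = r * beta0 i"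
    unfolding beta0_def sum_distrib_left by (intro sum.cong) auto
  finally have "\<alpha> i * wsum (\<lambda>y k. of_bool (y < x \<and> i \<le> k)) s \<le> (x - r * beta0 i) + \<alpha> i * surplus i r s"
    using packed_big_small[OF assms] ai by (simp add: surplus_def sum.distrib)
  also have "\<dots> = \<alpha> i * ((x - r * beta0 i) / \<alpha> i + surplus i r s)" using ai by (simp add: distrib_left)
  finally show ?thesis using ai by simp
qed

lemma surplus_bounds:
  assumes i: "i \<in> I" and r: "0 \<le> r"
  obtains CZ where "\<And>s. valid s \<Longrightarrow> 0 \<le> surplus i r s" "\<And>s. valid s \<Longrightarrow> surplus i r s \<le> CZ"
proof -
  have ai: "0 < \<alpha> i" using i by (rule sizes_pos)
  have jI: "j \<in> I" if "j \<in> {1..<i}" for j using types_down[OF i] that by auto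
  have 1: "0 \<le> surplus i r s" for s
    unfolding surplus_def using ai sizes_pos[OF jI]
    by (intro divide_nonneg_pos add_nonneg_nonneg sum_nonneg mult_nonneg_nonneg) (auto intro: less_imp_le)
  have 2: "surplus i r s \<le> (\<alpha> i + (\<Sum>j\<in>{1..<i}. \<alpha> j * ((r * beta j / \<alpha> 1 + 1) + p j * r))) / \<alpha> i" if s: "valid s" for s
    unfolding surplus_def
  proof (intro divide_right_mono add_left_mono sum_mono mult_left_mono)
    fix j assume j: "j \<in> {1..<i}"
    have "0 \<le> r * beta j" using r beta_nonneg[OF jI[OF j]] by simp
    moreover have "0 \<le> p j * r" using r probs_pos[OF jI[OF j]] by simp
    ultimately show "\<bar>started j (r * beta j) s - p j * r\<bar> \<le> (r * beta j / \<alpha> 1 + 1) + p j * r"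
      using started_bounds[OF s, of "r * beta j" j] by auto
    show "0 \<le> \<alpha> j" using sizes_pos[OF jI[OF j]] by simp
  qed (use ai in simp)
  show thesis using that 1 2 by blast
qed

end

section \<open>Induction over the item types\<close>

locale first_fit_family = first_fit_model +
  fixes \<pi> :: "real \<Rightarrow> packing pmf"
  assumes finite_mean: "(\<lambda>j. \<alpha> j * p j) summable_on I"
    and stationary_family: "\<And>r. 0 < r \<Longrightarrow> stationary_distribution (first_fit_rate I \<alpha> p r) {} (\<pi> r)"
begin

definition miss :: "nat \<Rightarrow> real \<Rightarrow> real" where
  "miss j r = measure_pmf.expectation (\<pi> r) (\<lambda>s. of_bool (r * beta j \<le> pos s j))"

definition dev :: "nat \<Rightarrow> real \<Rightarrow> real" where
  "dev j r = measure_pmf.expectation (\<pi> r) (\<lambda>s. \<bar>started j (r * beta j) s - p j * r\<bar>)"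

definition slack :: "nat \<Rightarrow> real \<Rightarrow> real" where
  "slack i r = (\<alpha> i + (\<Sum>j\<in>{1..<i}. \<alpha> j * dev j r)) / \<alpha> i"

text \<open>The error \<open>w\<close> of the window bounds divided by \<open>r\<close>. The summand
  \<open>1 / sqrt r\<close> stems from the choice \<open>H = sqrt r\<close> in
  \<open>E_holes_le\<close>, which balances \<open>M / H\<close> against
  \<open>2 * H\<close>.\<close>

definition omega :: "nat \<Rightarrow> real \<Rightarrow> real" where
  "omega i r = 1 / sqrt r + slack i r / r + (\<Sum>j\<in>{1..<i}. miss j r)"

lemma stationary_locale: "0 < r \<Longrightarrow> j \<in> I \<Longrightarrow> 0 \<le> y \<Longrightarrow> stationary_first_fit I \<alpha> p r (\<pi> r) j y"
  by unfold_locales (use stationary_family in auto)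

lemma miss_nonneg: "0 \<le> miss j r"
  unfolding miss_def by simp

lemma dev_nonneg: "0 \<le> dev j r"
  unfolding dev_def by simp

lemma dev_le:
  assumes r: "0 < r" and j: "j \<in> I"
  shows "dev j r \<le> sqrt (p j * r + (p j * r)\<^sup>2 * miss j r)"
proof -
  have y: "0 \<le> r * beta j" using r beta_nonneg[OF j] by simp
  interpret W: stationary_first_fit I \<alpha> p r "\<pi> r" j "r * beta j" by (rule stationary_locale[OF r j y])
  have "miss j r = W.E (\<lambda>s. 1 - of_bool (pos s j < r * beta j))"
    unfolding miss_def by (intro Bochner_Integration.integral_cong) auto
  also have "\<dots> = 1 - W.reach"
    unfolding W.reach_def using W.integrable_E[of "\<lambda>s. of_bool (pos s j < r * beta j)" 1] by simp
  finally have m: "miss j r = 1 - W.reach" .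
  have c: "W.cnt = started j (r * beta j)" by (simp add: W.cnt_def started_def)
  show ?thesis using W.E_abs_dev unfolding dev_def m c .
qed

lemma E_surplus:
  assumes i: "i \<in> I" and r: "0 < r"
  shows "measure_pmf.expectation (\<pi> r) (surplus i r) = slack i r"
proof -
  interpret W: stationary_first_fit I \<alpha> p r "\<pi> r" i 0 by (rule stationary_locale[OF r i]) simp
  have "integrable (measure_pmf (\<pi> r)) (\<lambda>s. \<bar>started j (r * beta j) s - p j * r\<bar>)" if j: "j \<in> {1..<i}" for j
  proof (rule W.integrable_E)
    fix s assume s: "valid s"
    have jI: "j \<in> I" using types_down[OF i] j by auto
    have "0 \<le> r * beta j" "0 \<le> p j * r" using r beta_nonneg[OF jI] probs_pos[OF jI] by auto
    then show "\<bar>\<bar>started j (r * beta j) s - p j * r\<bar>\<bar> \<le> (r * beta j / \<alpha> 1 + 1) + p j * r"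
      using started_bounds[OF s, of "r * beta j" j] by auto
  qed
  then have int: "integrable (measure_pmf (\<pi> r)) (\<lambda>s. \<alpha> j * \<bar>started j (r * beta j) s - p j * r\<bar>)" if "j \<in> {1..<i}" for j
    using that by (intro integrable_mult_right) blast
  have "W.E (\<lambda>s. \<Sum>j\<in>{1..<i}. \<alpha> j * \<bar>started j (r * beta j) s - p j * r\<bar>) = (\<Sum>j\<in>{1..<i}. \<alpha> j * dev j r)"
    unfolding dev_def by (subst Bochner_Integration.integral_sum[OF int]) (auto intro!: sum.cong)
  moreover have "integrable (measure_pmf (\<pi> r)) (\<lambda>s. \<Sum>j\<in>{1..<i}. \<alpha> j * \<bar>started j (r * beta j) s - p j * r\<bar>)"
    using int by (rule Bochner_Integration.integrable_sum)
  ultimately show ?thesis unfolding surplus_def slack_def by simp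
qed

text \<open>\<open>reach_bound\<close> at the level
  \<open>r * (beta i - \<alpha> i * \<delta>)\<close>. The constant \<open>G\<close> depends on
  \<delta>, \<open>m\<close> and \<open>J\<close> but not on \<open>r\<close>, so that
  \<open>omega i r\<close> can tend to 0 while these are fixed.\<close>

lemma miss_bound:
  assumes i: "i \<in> I" and \<delta>: "0 < \<delta>" "\<delta> < p i" and m2: "2 \<le> m" and \<Delta>: "0 < \<Delta>"
    and gap: "\<And>j. j \<in> I \<Longrightarrow> i < j \<Longrightarrow> \<alpha> i + \<Delta> \<le> \<alpha> j" and J: "J \<in> I"
  shows "\<exists>G. \<forall>r\<ge>1. p i * miss i r \<le> \<delta> + (p i * (((1 + \<alpha> i / \<Delta>) / (real m - 1) * beta i
     + (\<Sum>\<^sub>\<infinity>j\<in>{j \<in> I. J < j}. \<alpha> j * p j)) / \<alpha> i) + G * omega i r) / \<delta>"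
proof -
  define C where "C = beta i / \<alpha> 1 + 1"
  define cE where "cE = 2 * (real m * \<alpha> i) / \<alpha> 1 + 1"
  define Kd where "Kd = 1 + 1 / p i"
  define Kh where "Kh = 2 + 2 * C / \<delta> * (C + 2 + Kd + 1)"
  define K where "K = Kd + Kh"
  define B where "B = (\<Sum>t<m. ((1 + C) * (real m + 3) / \<delta>) ^ t) *
      (((1 + C) * (cE + 1) * (3 * K + 1) + C + 6 * C * K + 3 * cE * (1 + C) * (K + 1)) / \<delta>)"
  define G where "G = p i * (\<alpha> i + \<alpha> J) * (1 + B + 2 * cE) / \<alpha> i + C + 6 * C * K + (1 + C) * (K + 1)"
  let ?t = "\<Sum>\<^sub>\<infinity>j\<in>{j \<in> I. J < j}. \<alpha> j * p j"
  have ai: "0 < \<alpha> i" and pi: "0 < p i" using i sizes_pos probs_pos by auto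
  have C0: "0 \<le> C" using beta_nonneg[OF i] first_size_pos by (simp add: C_def)
  have Kd0: "0 \<le> Kd" using pi by (simp add: Kd_def)
  have Kh0: "0 \<le> Kh" unfolding Kh_def using C0 Kd0 \<delta> by simp
  have "p i * miss i r \<le> \<delta> + (p i * (((1 + \<alpha> i / \<Delta>) / (real m - 1) * beta i + ?t) / \<alpha> i) + G * omega i r) / \<delta>"
    if r1: "1 \<le> r" for r
  proof -
    have r: "0 < r" using r1 by simp
    define x where "x = r * (beta i - \<alpha> i * \<delta>)"
    define x1 where "x1 = r * beta0 i"
    have d1: "\<alpha> i * \<delta> < \<alpha> i * p i" using ai \<delta> by simp
    have x10: "0 \<le> x1" using r beta0_nonneg[OF i] by (simp add: x1_def)
    have x1x: "x1 < x" unfolding x_def x1_def using r d1 beta_eq[OF i] by (intro mult_strict_left_mono) auto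
    have x0: "0 \<le> x" using x10 x1x by simp
    have xb: "x \<le> r * beta i" unfolding x_def using r ai \<delta> by (intro mult_left_mono) auto
    interpret W: windowed_first_fit I \<alpha> p r "\<pi> r" i x m x1
      by (intro windowed_first_fit.intro stationary_locale r i x0 windowed_first_fit_axioms.intro x10) (use m2 in simp)
    \<comment> \<open>The second level \<open>x1\<close> serves to control how often an i-item fits
      into the room that the smaller types are expected to occupy.\<close>
    interpret W1: stationary_first_fit I \<alpha> p r "\<pi> r" i x1 by (rule stationary_locale[OF r i x10])
    let ?Z = "surplus i r"
    obtain CZ where Z: "\<And>s. valid s \<Longrightarrow> 0 \<le> ?Z s" "\<And>s. valid s \<Longrightarrow> ?Z s \<le> CZ"
      using surplus_bounds[OF i, of r] r by auto
    have EZ: "W.E ?Z = slack i r" by (rule E_surplus[OF i r])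
    have nbZ: "W.nb s \<le> (p i - \<delta>) * r + ?Z s" if "valid s" for s
    proof -
      have "(x - r * beta0 i) / \<alpha> i = (p i - \<delta>) * r"
        unfolding x_def beta_eq[OF i] using ai by (simp add: field_simps)
      then show ?thesis
        using big_le_surplus[OF that i _ x1x[unfolded x1_def, THEN less_imp_le]] r unfolding W.nb_def by simp
    qed
    define w where "w = r * omega i r"
    let ?P = "\<Sum>j\<in>{1..<i}. miss j r"
    have P0: "0 \<le> ?P" using miss_nonneg by (intro sum_nonneg)
    have sl0: "0 \<le> slack i r" unfolding EZ[symmetric] using Z by (intro W.E_nonneg) auto
    have sq: "sqrt r * sqrt r = r" "1 \<le> sqrt r" using r r1 by auto
    have w_eq: "w = sqrt r + slack i r + r * ?P"
      unfolding w_def omega_def using r sq(1) by (simp add: distrib_left real_div_sqrt)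
    have rP0: "0 \<le> r * ?P" using P0 r by simp
    have w1: "sqrt r \<le> w" "1 \<le> w" "W.E ?Z \<le> w" "r * ?P \<le> w"
      unfolding EZ using w_eq sl0 rP0 sq(2) by linarith+
    have MC: "W.M \<le> C * r"
    proof -
      have "x / \<alpha> 1 \<le> r * beta i / \<alpha> 1" using xb first_size_pos by (intro divide_right_mono) auto
      then show ?thesis unfolding W.M_def C_def using r1 by (simp add: algebra_simps)
    qed
    have int_miss: "integrable (measure_pmf (\<pi> r)) (\<lambda>s. of_bool (r * beta j \<le> pos s j) :: real)" for j
      by (intro W.integrable_E[where C = 1]) auto
    \<comment> \<open>Counts the smaller types whose next item would start beyond its nominal level;
      a small item landing beyond \<open>x1\<close> forces this count to be positive.\<close>
    define late :: "packing \<Rightarrow> real" where "late s = (\<Sum>j\<in>{1..<i}. of_bool (r * beta j \<le> pos s j))" for s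
    have int_late: "integrable (measure_pmf (\<pi> r)) late"
      unfolding late_def by (intro Bochner_Integration.integrable_sum int_miss)
    have EP: "W.E late = ?P"
      unfolding miss_def late_def using int_miss by (rule Bochner_Integration.integral_sum)
    have late0: "0 \<le> late s" for s unfolding late_def by (intro sum_nonneg) auto
    have far: "\<exists>j\<in>{1..<i}. r * beta j \<le> pos s j" if "j' \<in> I" "j' < i" "x1 \<le> pos s j'" for s j'
    proof -
      have j: "j' \<in> {1..<i}" using that types_ge_1 by auto
      have "r * beta j' \<le> x1" unfolding x1_def using beta_le_beta0[OF i j] r by simp
      then show ?thesis using j that(3) by (intro bexI[of _ j']) auto
    qed
    have one_le: "1 \<le> late s"
      if ex: "\<exists>j\<in>{1..<i}. r * beta j \<le> pos s j" for s
    proof -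
      obtain j where j: "j \<in> {1..<i}" "r * beta j \<le> pos s j" using ex by blast
      have "(of_bool (r * beta j \<le> pos s j) :: real) \<le> late s"
        unfolding late_def by (rule member_le_sum[OF j(1)]) auto
      then show ?thesis using j(2) by simp
    qed
    have small: "W.E W.small_rate \<le> w"
    proof -
      have "W.E W.small_rate \<le> W.E (\<lambda>s. r * late s)"
      proof (intro integral_mono_AE AE_stationary[OF r W.stat])
        fix s assume s: "valid s"
        note S0 = late0[of s]
        have "W.ET (W.small_far s) \<le> W.ET (\<lambda>_. late s)"
        proof (intro integral_mono_AE AE_arrival_type W.int_small_far)
          fix j assume "j \<in> I"
          then show "W.small_far s j \<le> late s" using far one_le S0 by (fastforce simp: W.small_far_def)
        qed simp
        then show "W.small_rate s \<le> r * late s" unfolding W.small_rate_def using r by (intro mult_left_mono) auto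
      qed (use W.int_small_rate int_late in auto)
      also have "\<dots> = r * ?P" using EP by simp
      finally show ?thesis using w1(4) by simp
    qed
    \<comment> \<open>Little's law at the level \<open>x1\<close>: the big items below
      \<open>x1\<close> number no more than the surplus, so an i-item rarely fits there.\<close>
    have reach1: "p i * r * W1.reach \<le> w"
    proof -
      have "p i * r * W1.reach = W1.E W1.cnt" by (rule W1.E_cnt[symmetric])
      also have "\<dots> \<le> W1.E ?Z"
      proof (rule W1.E_mono)
        fix s assume s: "valid s"
        have "W1.nb s \<le> (x1 - r * beta0 i) / \<alpha> i + ?Z s"
          unfolding W1.nb_def using r by (intro big_le_surplus[OF s i]) (auto simp: x1_def)
        then show "W1.cnt s \<le> ?Z s" using W1.cnt_bounds(2)[OF s] by (simp add: x1_def)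
        show "\<bar>W1.cnt s\<bar> \<le> W1.M" using W1.cnt_bounds[OF s] by simp
        show "\<bar>?Z s\<bar> \<le> CZ" using Z[OF s] by simp
      qed
      finally show ?thesis using w1(3) by simp
    qed
    \<comment> \<open>A small item that fills a hole either lands beyond \<open>x1\<close>, so that
      some type is late, or shows that an i-item fits below \<open>x1\<close>.\<close>
    have d: "W.E W.d_rate \<le> Kd * w"
    proof -
      have "W.E W.d_rate \<le> W.E (\<lambda>s. r * (late s + of_bool (pos s i < x1)))"
      proof (intro integral_mono_AE AE_stationary[OF r W.stat])
        fix s assume s: "valid s"
        note S0 = late0[of s]
        have "W.ET (W.small_fill s) \<le> W.ET (\<lambda>_. late s + of_bool (pos s i < x1))"
        proof (intro integral_mono_AE AE_arrival_type W.int_small_fill)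
          fix j assume j: "j \<in> I"
          show "W.small_fill s j \<le> late s + of_bool (pos s i < x1)"
          proof (cases "j < i \<and> pos s j \<in> holes i s \<and> \<not> pos s i < x1")
            case True
            then have "x1 \<le> pos s j" using pos_le[OF s i] by force
            then have "1 \<le> late s" using far[OF j] True one_le by blast
            then show ?thesis by (simp add: W.small_fill_def)
          next
            case False
            then show ?thesis using S0 by (auto simp: W.small_fill_def)
          qed
        qed simp
        then show "W.d_rate s \<le> r * (late s + of_bool (pos s i < x1))" unfolding W.d_rate_def using r by (intro mult_left_mono) auto
      next
        show "integrable (measure_pmf (\<pi> r)) (\<lambda>s. r * (late s + of_bool (pos s i < x1)))"
          using int_late W.integrable_E[of "\<lambda>s. of_bool (pos s i < x1)" 1] by simp
      qed (rule W.int_basic)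
      also have "\<dots> = r * ?P + r * W1.reach"
        using int_late W.integrable_E[of "\<lambda>s. of_bool (pos s i < x1)" 1] EP by (simp add: W1.reach_def distrib_left)
      also have "\<dots> \<le> w + w / p i"
        using w1(4) reach1 pi by (intro add_mono) (auto simp: field_simps)
      finally show ?thesis by (simp add: Kd_def algebra_simps)
    qed
    have h: "W.E (\<lambda>s. real (W.nh s)) \<le> Kh * w"
    proof -
      have "W.E (\<lambda>s. real (W.nh s)) \<le> sqrt r + 1 + 2 * W.M / (\<delta> * r) * (W.M / sqrt r + 2 * sqrt r + W.E W.d_rate + W.E ?Z)"
        by (rule W.E_holes_le[OF sq(2) \<delta>(1) Z nbZ])
      also have "\<dots> \<le> w + w + 2 * C / \<delta> * (C * w + 2 * w + Kd * w + w)"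
      proof (intro add_mono mult_mono)
        show "2 * W.M / (\<delta> * r) \<le> 2 * C / \<delta>" using MC \<delta> r by (simp add: field_simps)
        have "W.M / sqrt r \<le> C * r / sqrt r" using MC r by (intro divide_right_mono) auto
        also have "\<dots> = C * sqrt r" using real_div_sqrt[of r] r by (metis less_imp_le times_divide_eq_right)
        also have "\<dots> \<le> C * w" using w1(1) C0 by (intro mult_left_mono)
        finally show "W.M / sqrt r \<le> C * w" .
        show "0 \<le> W.M / sqrt r + 2 * sqrt r + W.E W.d_rate + W.E ?Z"
          using W.M_ge_1 r sl0 W.rate_bounds unfolding EZ
          by (intro add_nonneg_nonneg W.E_nonneg) auto
      qed (use w1 d C0 \<delta> r in auto)
      also have "\<dots> = Kh * w" by (simp add: Kh_def algebra_simps add_divide_distrib)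
      finally show ?thesis .
    qed
    have w0: "0 \<le> w" using w1 by simp
    have dK: "W.E W.d_rate \<le> K * w" using d Kh0 w0 unfolding K_def by (simp add: distrib_right add_increasing2)
    have hK: "W.E (\<lambda>s. real (W.nh s)) \<le> K * w" using h Kd0 w0 unfolding K_def by (simp add: distrib_right add_increasing)
    have K0: "0 \<le> K" using Kd0 Kh0 by (simp add: K_def)
    have cE: "W.cE = cE" by (simp add: W.cE_def W.L_def cE_def)
    let ?\<kappa> = "(1 + \<alpha> i / \<Delta>) / (real m - 1)"
    have main: "\<delta> * ((x - x1) / \<alpha> i - p i * r * W.reach) \<le> p i * ((?\<kappa> * x + r * ?t) / \<alpha> i) + G * w"
      using W.reach_bound[OF Z nbZ \<delta>(1) MC C0 w1(2,3) small K0 dK hK _ m2 \<Delta> gap J x1x finite_mean, of B]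
      unfolding cE B_def G_def by simp
    have xx: "(x - x1) / \<alpha> i = (p i - \<delta>) * r"
      unfolding x_def x1_def beta_eq[OF i] using ai by (simp add: field_simps)
    have k0: "0 \<le> ?\<kappa>" using ai \<Delta> m2 by simp
    have "p i * ((?\<kappa> * x + r * ?t) / \<alpha> i) \<le> p i * ((?\<kappa> * (r * beta i) + r * ?t) / \<alpha> i)"
      using xb k0 ai pi by (intro mult_left_mono divide_right_mono add_right_mono) auto
    also have "\<dots> = r * (p i * ((?\<kappa> * beta i + ?t) / \<alpha> i))" by (simp add: algebra_simps)
    finally have "\<delta> * ((p i - \<delta>) * r - p i * r * W.reach) \<le> r * (p i * ((?\<kappa> * beta i + ?t) / \<alpha> i)) + G * (r * omega i r)"
      using main unfolding xx w_def by linarith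
    then have "r * (\<delta> * (p i * (1 - W.reach) - \<delta>)) \<le> r * (p i * ((?\<kappa> * beta i + ?t) / \<alpha> i) + G * omega i r)"
      by (simp add: algebra_simps)
    then have "\<delta> * (p i * (1 - W.reach) - \<delta>) \<le> p i * ((?\<kappa> * beta i + ?t) / \<alpha> i) + G * omega i r"
      using r by simp
    then have "p i * (1 - W.reach) - \<delta> \<le> (p i * ((?\<kappa> * beta i + ?t) / \<alpha> i) + G * omega i r) / \<delta>"
      using \<delta> by (simp add: le_divide_eq mult.commute)
    moreover have "miss i r \<le> 1 - W.reach"
    proof -
      have "miss i r \<le> W.E (\<lambda>s. 1 - of_bool (pos s i < x))"
        unfolding miss_def using xb by (intro W.E_mono[where C = 1 and C' = 1]) auto
      also have "\<dots> = 1 - W.reach"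
        unfolding W.reach_def using W.integrable_E[of "\<lambda>s. of_bool (pos s i < x)" 1] by simp
      finally show ?thesis .
    qed
    then have "p i * miss i r \<le> p i * (1 - W.reach)" using pi by simp
    ultimately show ?thesis by linarith
  qed
  then show ?thesis by blast
qed

text \<open>In \<open>dev_le\<close> the term \<open>p j * r\<close> is of lower order than the
  square of \<open>r\<close>, and the other term carries the factor \<open>miss j r\<close>.\<close>

lemma dev_negligible:
  assumes jI: "j \<in> I" and miss: "(miss j \<longlongrightarrow> 0) at_top"
  shows "((\<lambda>r. dev j r / r) \<longlongrightarrow> 0) at_top"
proof (rule tendsto_sandwich)
    show "\<forall>\<^sub>F r in at_top. 0 \<le> dev j r / r"
      using eventually_gt_at_top[of 0] by eventually_elim (simp add: dev_nonneg)
    show "\<forall>\<^sub>F r in at_top. dev j r / r \<le> sqrt (p j / r + (p j)\<^sup>2 * miss j r)"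
      using eventually_gt_at_top[of 0]
    proof eventually_elim
      fix r :: real assume r: "0 < r"
      have "dev j r / r \<le> sqrt (p j * r + (p j * r)\<^sup>2 * miss j r) / sqrt (r\<^sup>2)"
        using dev_le[OF r jI] r by (simp add: divide_right_mono)
      also have "\<dots> = sqrt ((p j * r + (p j * r)\<^sup>2 * miss j r) / r\<^sup>2)" by (simp add: real_sqrt_divide)
      also have "(p j * r + (p j * r)\<^sup>2 * miss j r) / r\<^sup>2 = p j / r + (p j)\<^sup>2 * miss j r"
        using r by (simp add: field_simps power2_eq_square)
      finally show "dev j r / r \<le> sqrt (p j / r + (p j)\<^sup>2 * miss j r)" .
    qed
    have "((\<lambda>r. sqrt (p j / r + (p j)\<^sup>2 * miss j r)) \<longlongrightarrow> sqrt (0 + (p j)\<^sup>2 * 0)) at_top"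
      by (intro tendsto_intros miss tendsto_divide_0[OF tendsto_const] filterlim_at_top_imp_at_infinity filterlim_ident)
    then show "((\<lambda>r. sqrt (p j / r + (p j)\<^sup>2 * miss j r)) \<longlongrightarrow> 0) at_top" by simp
  qed simp

lemma omega_tendsto:
  assumes i: "i \<in> I" and IH: "\<And>j. j \<in> {1..<i} \<Longrightarrow> (miss j \<longlongrightarrow> 0) at_top"
  shows "(omega i \<longlongrightarrow> 0) at_top"
proof -
  have dev: "((\<lambda>r. dev j r / r) \<longlongrightarrow> 0) at_top" if j: "j \<in> {1..<i}" for j
    using types_down[OF i] j by (intro dev_negligible IH) auto
  have "((\<lambda>r. 1 / sqrt r + (\<alpha> i / r + (\<Sum>j\<in>{1..<i}. \<alpha> j * (dev j r / r))) / \<alpha> i + (\<Sum>j\<in>{1..<i}. miss j r))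
     \<longlongrightarrow> 0 + (0 + (\<Sum>j\<in>{1..<i}. \<alpha> j * 0)) / \<alpha> i + (\<Sum>j\<in>{1..<i}. 0)) at_top"
    using sizes_pos[OF i]
    by (intro tendsto_intros IH dev tendsto_divide_0[OF tendsto_const] filterlim_at_top_imp_at_infinity filterlim_ident sqrt_at_top) auto
  moreover have "omega i = (\<lambda>r. 1 / sqrt r + (\<alpha> i / r + (\<Sum>j\<in>{1..<i}. \<alpha> j * (dev j r / r))) / \<alpha> i + (\<Sum>j\<in>{1..<i}. miss j r))"
    unfolding omega_def slack_def by (simp add: fun_eq_iff add_divide_distrib sum_divide_distrib mult.commute)
  ultimately show ?thesis by simp
qed

lemma tail_small:
  assumes "0 < e"
  obtains J where "J \<in> I" "(\<Sum>\<^sub>\<infinity>j\<in>{j \<in> I. J < j}. \<alpha> j * p j) \<le> e"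
proof -
  let ?f = "\<lambda>j. \<alpha> j * p j"
  have "(sum ?f \<longlongrightarrow> infsum ?f I) (finite_subsets_at_top I)"
    using finite_mean by (simp add: has_sum_infsum flip: has_sum_def)
  then have "\<forall>\<^sub>F F in finite_subsets_at_top I. dist (sum ?f F) (infsum ?f I) < e"
    using assms by (rule tendstoD)
  then obtain F where F: "finite F" "F \<subseteq> I" "dist (sum ?f F) (infsum ?f I) < e"
    unfolding eventually_finite_subsets_at_top by blast
  \<comment> \<open>The type 1 is inserted so that the maximum exists and is a type even if
    \<open>F\<close> is empty.\<close>
  define J where "J = Max (insert 1 F)"
  have J: "J \<in> I" "\<And>j. j \<in> F \<Longrightarrow> j \<le> J"
    using F one_in_types Max_in[of "insert 1 F"] by (auto simp: J_def)
  have nn: "0 \<le> ?f j" if "j \<in> I" for j using that by (rule size_prob_nonneg)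
  have s: "?f summable_on I - F" "?f summable_on F" "?f summable_on {j \<in> I. J < j}"
    using finite_mean F by (auto intro: summable_on_subset_banach)
  have "infsum ?f {j \<in> I. J < j} \<le> infsum ?f (I - F)"
    using s J(2) nn by (intro infsum_mono_neutral) force+
  also have "\<dots> = infsum ?f I - infsum ?f F"
    using F finite_mean s by (intro infsum_Diff) auto
  also have "infsum ?f F = sum ?f F" using F by simp
  also have "infsum ?f I - sum ?f F \<le> e" using F(3) by (simp add: dist_real_def abs_le_iff)
  finally show thesis using that J(1) by blast
qed

text \<open>The next size determines the gap; for a largest type the condition is empty and any
  positive number serves.\<close>

lemma size_gap:
  assumes i: "i \<in> I"
  obtains \<Delta> where "0 < \<Delta>" "\<And>j. j \<in> I \<Longrightarrow> i < j \<Longrightarrow> \<alpha> i + \<Delta> \<le> \<alpha> j"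
proof (cases "Suc i \<in> I")
  case True
  show ?thesis
  proof (rule that)
    show "0 < \<alpha> (Suc i) - \<alpha> i" using size_strict_mono[OF i True] by simp
    show "\<alpha> i + (\<alpha> (Suc i) - \<alpha> i) \<le> \<alpha> j" if "j \<in> I" "i < j" for j
      using size_mono[OF True that(1)] that(2) by simp
  qed
next
  case False
  then have "\<not> i < j" if "j \<in> I" for j using types_down[OF that, of "Suc i"] by auto
  then show ?thesis using that[of 1] by auto
qed

text \<open>The order of choices matters: \<delta> in terms of \<open>e\<close>, then
  \<open>J\<close> and \<open>m\<close> in terms of \<delta>, because the errors they control are
  divided by \<delta>, and \<open>r\<close> last.\<close>

lemma miss_step:
  assumes i: "i \<in> I" and IH: "\<And>j. j \<in> {1..<i} \<Longrightarrow> (miss j \<longlongrightarrow> 0) at_top"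
  shows "(miss i \<longlongrightarrow> 0) at_top"
proof (rule tendstoI)
  fix e :: real assume e: "0 < e"
  have ai: "0 < \<alpha> i" and pi: "0 < p i" using i sizes_pos probs_pos by auto
  obtain \<Delta> where \<Delta>: "0 < \<Delta>" "\<And>j. j \<in> I \<Longrightarrow> i < j \<Longrightarrow> \<alpha> i + \<Delta> \<le> \<alpha> j" using size_gap[OF i] by blast
  define \<delta> where "\<delta> = min (p i / 2) (p i * e / 4)"
  have \<delta>: "0 < \<delta>" "\<delta> < p i" "\<delta> \<le> p i * e / 4" using pi e by (auto simp: \<delta>_def min_less_iff_disj)
  \<comment> \<open>The errors from \<open>m\<close> and \<open>J\<close> are at most
    \<open>c\<close> each and thus contribute \<open>p i * e / 2\<close> in total; \<delta> and the
    term with \<open>omega\<close> contribute at most \<open>p i * e / 4\<close> each.\<close>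
  define c where "c = e * \<delta> * \<alpha> i / 4"
  have c: "0 < c" using e \<delta> ai by (simp add: c_def)
  obtain J where J: "J \<in> I" "(\<Sum>\<^sub>\<infinity>j\<in>{j \<in> I. J < j}. \<alpha> j * p j) \<le> c" using tail_small[OF c] by blast
  let ?k = "(1 + \<alpha> i / \<Delta>) * beta i"
  obtain n :: nat where n: "?k / c \<le> real n" using real_arch_simple by blast
  define m where "m = n + 2"
  have m2: "2 \<le> m" by (simp add: m_def)
  have "?k \<le> c * (real m - 1)"
  proof -
    have "?k \<le> c * real n" using n c by (simp add: field_simps)
    also have "\<dots> \<le> c * (real m - 1)" using c by (intro mult_left_mono) (auto simp: m_def)
    finally show ?thesis .
  qed
  then have "(1 + \<alpha> i / \<Delta>) / (real m - 1) * beta i \<le> c" using m2 by (simp add: field_simps)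
  then have kc: "(1 + \<alpha> i / \<Delta>) / (real m - 1) * beta i + (\<Sum>\<^sub>\<infinity>j\<in>{j \<in> I. J < j}. \<alpha> j * p j) \<le> 2 * c"
    using J(2) by simp
  obtain G where G: "\<And>r. 1 \<le> r \<Longrightarrow> p i * miss i r \<le> \<delta> + (p i * (((1 + \<alpha> i / \<Delta>) / (real m - 1) * beta i
     + (\<Sum>\<^sub>\<infinity>j\<in>{j \<in> I. J < j}. \<alpha> j * p j)) / \<alpha> i) + G * omega i r) / \<delta>"
    using miss_bound[OF i \<delta>(1,2) m2 \<Delta> J(1)] by blast
  have "((\<lambda>r. G * omega i r) \<longlongrightarrow> G * 0) at_top"
    by (intro tendsto_intros omega_tendsto[OF i IH])
  then have "\<forall>\<^sub>F r in at_top. G * omega i r < p i * e * \<delta> / 4"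
    using pi e \<delta> by (intro order_tendstoD(2)) auto
  then show "\<forall>\<^sub>F r in at_top. dist (miss i r) 0 < e"
    using eventually_ge_at_top[of 1]
  proof eventually_elim
    fix r :: real assume om: "G * omega i r < p i * e * \<delta> / 4" and r: "1 \<le> r"
    have "p i * miss i r \<le> \<delta> + (p i * (2 * c / \<alpha> i) + G * omega i r) / \<delta>"
      using kc ai pi \<delta>(1)
      by (intro order_trans[OF G[OF r]] add_left_mono divide_right_mono add_right_mono mult_left_mono) auto
    also have "\<dots> < \<delta> + (p i * (2 * c / \<alpha> i) + p i * e * \<delta> / 4) / \<delta>"
      using om \<delta>(1) by (intro add_strict_left_mono divide_strict_right_mono) auto
    also have "\<dots> = \<delta> + p i * e * (3 / 4)" using ai \<delta>(1) by (simp add: c_def field_simps)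
    also have "\<dots> \<le> p i * e" using \<delta>(3) by simp
    finally have "miss i r < e" using pi by simp
    then show "dist (miss i r) 0 < e" using miss_nonneg[of i r] by simp
  qed
qed

theorem miss_tendsto: "i \<in> I \<Longrightarrow> (miss i \<longlongrightarrow> 0) at_top"
proof (induction i rule: less_induct)
  case (less i)
  show ?case
  proof (rule miss_step[OF less.prems])
    fix j assume "j \<in> {1..<i}"
    then show "(miss j \<longlongrightarrow> 0) at_top" using types_down[OF less.prems, of j] by (intro less.IH) auto
  qed
qed

text \<open>An item that starts below \<open>y\<close> without lying within \<open>{0..<y}\<close>
  reaches beyond \<open>y\<close>, and disjoint items allow only one such.\<close>

lemma items_within_close:
  assumes s: "valid s" and i: "i \<in> I"
  shows "\<bar>started i y s - real (items_within \<alpha> i y s)\<bar> \<le> 1"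
proof -
  have ai: "0 < \<alpha> i" using i by (rule sizes_pos)
  have fin: "finite s" by (rule valid_finite[OF s])
  let ?A = "{z. (z, i) \<in> s \<and> z < y}" and ?B = "{z. (z, i) \<in> s \<and> {z..<z + \<alpha> i} \<subseteq> {0..<y}}"
  have finA: "finite ?A"
    using fin by (rule_tac finite_subset[of _ "fst ` s"]) force+
  have B: "?B = {z. (z, i) \<in> s \<and> z + \<alpha> i \<le> y}"
    using ai valid_item(2)[OF s] by (auto simp: ivl_subset)
  then have BA: "?B \<subseteq> ?A" using ai by auto
  have "started i y s = (\<Sum>a\<in>(\<lambda>z. (z, i)) ` ?A. 1)"
    unfolding started_def wsum_def using fin by (intro sum.mono_neutral_cong_right) auto
  also have "\<dots> = real (card ?A)"
    by (simp add: card_image inj_on_def)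
  finally have A: "started i y s = real (card ?A)" .
  have "card (?A - ?B) \<le> 1"
  proof (rule card_le_oneI)
    fix z w assume zw: "z \<in> ?A - ?B" "w \<in> ?A - ?B"
    then have z: "(z, i) \<in> s" "z < y" "y < z + \<alpha> i" and w: "(w, i) \<in> s" "w < y" "y < w + \<alpha> i"
      unfolding B by auto
    have "\<not> z < w" using valid_less[OF s z(1) w(1)] z w by linarith
    moreover have "\<not> w < z" using valid_less[OF s w(1) z(1)] z w by linarith
    ultimately show "z = w" by simp
  qed
  moreover have "card ?A = card ?B + card (?A - ?B)"
    using card_Un_disjoint[of ?B "?A - ?B"] finA finite_subset[OF BA finA] BA by (simp add: Un_absorb1)
  ultimately show ?thesis unfolding A items_within_def by simp
qed

text \<open>Markov's inequality for \<open>started\<close>. The condition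
  \<open>2 \<le> e * r\<close> lets half of the deviation \<open>e * r\<close> absorb the difference
  of at most 1 between the two counts.\<close>

lemma items_within_prob:
  assumes i: "i \<in> I" and e: "0 < e" and r: "0 < r" "2 \<le> e * r"
  shows "measure_pmf.prob (\<pi> r) {s. \<bar>1 / r * real (items_within \<alpha> i (r * beta i) s) - p i\<bar> > e} \<le> 2 / e * (dev i r / r)"
proof -
  have y: "0 \<le> r * beta i" using r beta_nonneg[OF i] by simp
  interpret W: stationary_first_fit I \<alpha> p r "\<pi> r" i "r * beta i" by (rule stationary_locale[OF r(1) i y])
  let ?g = "\<lambda>s. \<bar>started i (r * beta i) s - p i * r\<bar>"
  have int: "integrable (measure_pmf (\<pi> r)) ?g"
  proof (rule W.integrable_E)
    fix s assume "valid s"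
    moreover have "0 \<le> p i * r" using probs_pos[OF i] r by simp
    ultimately show "\<bar>?g s\<bar> \<le> (r * beta i / \<alpha> 1 + 1) + p i * r"
      using started_bounds[of s "r * beta i" i] y by auto
  qed
  have "measure_pmf.prob (\<pi> r) {s. \<bar>1 / r * real (items_within \<alpha> i (r * beta i) s) - p i\<bar> > e}
     \<le> measure_pmf.prob (\<pi> r) {s. ?g s \<ge> e * r / 2}"
  proof (rule measure_pmf.finite_measure_mono_AE)
    have "?g s \<ge> e * r / 2" if s: "valid s" and d: "\<bar>1 / r * real (items_within \<alpha> i (r * beta i) s) - p i\<bar> > e" for s
    proof -
      have "\<bar>real (items_within \<alpha> i (r * beta i) s) - p i * r\<bar> = r * \<bar>1 / r * real (items_within \<alpha> i (r * beta i) s) - p i\<bar>"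
        using r by (simp add: abs_mult_pos' algebra_simps flip: abs_mult_pos)
      also have "\<dots> > r * e" using d r by simp
      finally have "e * r < \<bar>real (items_within \<alpha> i (r * beta i) s) - p i * r\<bar>" by (simp add: mult.commute)
      then show ?thesis using items_within_close[OF s i, of "r * beta i"] r(2) by arith
    qed
    then show "AE s in measure_pmf (\<pi> r). s \<in> {s. \<bar>1 / r * real (items_within \<alpha> i (r * beta i) s) - p i\<bar> > e} \<longrightarrow> s \<in> {s. ?g s \<ge> e * r / 2}"
      by (intro AE_stationary[OF r(1) W.stat]) auto
  qed simp
  also have "\<dots> \<le> dev i r / (e * r / 2)"
    unfolding dev_def using integral_Markov_inequality_measure[OF int, of UNIV "e * r / 2"] e r by simp
  also have "\<dots> = 2 / e * (dev i r / r)" using e r by simp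
  finally show ?thesis .
qed

end

theorem theorem4p1:
  fixes I :: "nat set" and \<alpha> p :: "nat \<Rightarrow> real" and \<pi> :: "real \<Rightarrow> packing pmf" and i :: nat
  assumes types: "I = {1..} \<or> (\<exists>n. I = {1..n})"
    and sizes_pos: "\<forall>j\<in>I. 0 < \<alpha> j"
    and sizes_increasing: "strict_mono_on I \<alpha>"
    and sizes_unbounded: "infinite I \<longrightarrow> filterlim \<alpha> at_top sequentially"
    and probs_pos: "\<forall>j\<in>I. 0 < p j"
    and probs_sum: "(p has_sum 1) I"
    and finite_mean: "(\<lambda>j. \<alpha> j * p j) summable_on I"
    and stationary: "\<forall>r>0. stationary_distribution (first_fit_rate I \<alpha> p r) {} (\<pi> r)"
    and item_type: "i \<in> I"
  shows "\<forall>\<epsilon>>0. ((\<lambda>r. measure_pmf.prob (\<pi> r)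
            {s. \<bar>1 / r * real (items_within \<alpha> i (r * (\<Sum>j = 1..i. \<alpha> j * p j)) s) - p i\<bar> > \<epsilon>})
          \<longlongrightarrow> 0) at_top"
proof (intro allI impI)
  fix \<epsilon> :: real
  assume e: "0 < \<epsilon>"
  interpret first_fit_family I \<alpha> p \<pi>
    by (intro first_fit_family.intro first_fit_model.intro first_fit_family_axioms.intro types
        sizes_pos[rule_format] sizes_increasing probs_pos[rule_format] probs_sum finite_mean stationary[rule_format])
  have "((\<lambda>r. 2 / \<epsilon> * (dev i r / r)) \<longlongrightarrow> 0) at_top"
    by (intro tendsto_mult_right_zero dev_negligible[OF item_type miss_tendsto[OF item_type]])
  moreover have "\<forall>\<^sub>F r in at_top. measure_pmf.prob (\<pi> r)
      {s. \<bar>1 / r * real (items_within \<alpha> i (r * (\<Sum>j = 1..i. \<alpha> j * p j)) s) - p i\<bar> > \<epsilon>} \<le> 2 / \<epsilon> * (dev i r / r)"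
    using eventually_gt_at_top[of 0] eventually_ge_at_top[of "2 / \<epsilon>"]
  proof eventually_elim
    case (elim r)
    then have "2 \<le> \<epsilon> * r" using e by (simp add: field_simps)
    then show ?case
      using items_within_prob[OF item_type e elim(1)] by (simp add: beta_def)
  qed
  moreover have "\<forall>\<^sub>F r in at_top. 0 \<le> measure_pmf.prob (\<pi> r)
      {s. \<bar>1 / r * real (items_within \<alpha> i (r * (\<Sum>j = 1..i. \<alpha> j * p j)) s) - p i\<bar> > \<epsilon>}"
    by (intro always_eventually allI measure_nonneg)
  ultimately show "((\<lambda>r. measure_pmf.prob (\<pi> r)
            {s. \<bar>1 / r * real (items_within \<alpha> i (r * (\<Sum>j = 1..i. \<alpha> j * p j)) s) - p i\<bar> > \<epsilon>})
          \<longlongrightarrow> 0) at_top"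
    by - (rule tendsto_sandwich[OF _ _ tendsto_const])
qed

end
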